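(* Let $n\ge3$ and let $\mathcal{L}\subset\mathbb{S}^n$ be a regular net of quadrics, i.e. a $3$-dimensional linear subspace containing an invertible matrix. The following conditions are equivalent: 1. Every nonzero complex matrix in $\mathcal{L}$ has rank $\ge n-1$. 2. The linear span of the surface $\mathcal{L}^{-1}\subset\mathbb{P}(\mathbb{S}^n)$ is the ambient projective space $\mathbb{P}(\mathbb{S}^n)$. 3. $\mathcal{L}^{-1}\subset\mathbb{P}(\mathbb{S}^n)$ is linearly isomorphic to the $(n-1)$st Veronese embedding of $\mathbb{P}^2$. 4. The Chow matrix of $\mathcal{L}$ is invertible.
   Context: $\mathbb{S}^n$ is the space of symmetric $n\times n$ matrices over $\mathbb{C}$, $\mathbb{P}(\mathbb{S}^n)\cong\mathbb{P}^{\binom{n+1}{2}-1}$ its projectivization. $\mathcal{L}^{-1}$ is the Zariski closure of $\{X^{-1}\mid X\in\mathcal{L},\det X\neq0\}$, regarded as a projective surface in $\mathbb{P}(\mathbb{S}^n)$. Chow matrix: fix a basis $X,Y,Z$ of $\mathcal{L}$ and let $x,y,z$ be unknowns. The Chow matrix is the square matrix of size $\binom{n+1}{2}$ whose columns are labeled by the monomials of degree $n-1$ in $x,y,z$ and whose rows are labeled by pairs $(i,j)$ with $1\le i\le j\le n$; the row indexed by $(i,j)$ consists of the coefficients of the $(i,j)$ entry of the adjoint (adjugate) matrix of $xX+yY+zZ$, which is a homogeneous polynomial of degree $n-1$ in $x,y,z$. Its invertibility does not depend on the choice of basis. *)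

theory Defs
  imports "Jordan_Normal_Form.DL_Rank" "HOL-Library.Poly_Mapping"
begin

subsection \<open>Symmetric matrices and regular nets\<close>

definition sym_space :: "nat \<Rightarrow> (complex, complex mat) module" where
  "sym_space n = (module_mat TYPE(complex) n n)
     \<lparr>carrier := {A \<in> carrier_mat n n. transpose_mat A = A}\<rparr>"

lemma subspace_sym_mats:
  "subspace class_ring {A \<in> carrier_mat n n. transpose_mat A = A} (module_mat TYPE(complex) n n)"
proof -
  interpret M: vectorspace class_ring "module_mat TYPE(complex) n n" by (rule matrix_vs)
  have smult: "transpose_mat (c \<cdot>\<^sub>m A) = c \<cdot>\<^sub>m transpose_mat A" for c and A :: "complex mat"
    by (rule eq_matI) auto
  have "submodule class_ring {A \<in> carrier_mat n n. transpose_mat A = A}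
      (module_mat TYPE(complex) n n)"
    by unfold_locales (auto simp: module_mat_simps transpose_add smult)
  then show ?thesis by (simp add: subspace_def matrix_vs)
qed

lemma vectorspace_sym_space: "vectorspace class_ring (sym_space n)"
  unfolding sym_space_def
  by (rule vectorspace.subspace_is_vs[OF matrix_vs subspace_sym_mats])

definition regular_net :: "nat \<Rightarrow> complex mat set \<Rightarrow> bool" where
  "regular_net n L \<longleftrightarrow>
     subspace class_ring L (sym_space n) \<and>
     vectorspace.dim class_ring ((sym_space n)\<lparr>carrier := L\<rparr>) = 3 \<and>
     (\<exists>A\<in>L. invertible_mat A)"

subsection \<open>Projective spaces\<close>

text \<open>The points of the projective space of \<open>V\<close> are its one-dimensional subspaces.
  \<open>proj_pts V S\<close> is the set of points represented by the nonzero elements of \<open>S\<close>.\<close>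

definition proj_pts :: "(complex, 'v) module \<Rightarrow> 'v set \<Rightarrow> 'v set set" where
  "proj_pts V S = {LinearCombinations.module.span class_ring V {v} | v. v \<in> S \<and> v \<noteq> \<zero>\<^bsub>V\<^esub>}"

abbreviation proj_space :: "(complex, 'v) module \<Rightarrow> 'v set set" where
  "proj_space V \<equiv> proj_pts V (carrier V)"

definition proj_span :: "(complex, 'v) module \<Rightarrow> 'v set set \<Rightarrow> 'v set set" where
  "proj_span V P = proj_pts V (LinearCombinations.module.span class_ring V (\<Union>P))"

text \<open>An isomorphism of the ambient projective spaces that is induced by a linear isomorphism
  and maps \<open>P\<close> onto \<open>Q\<close>; a point of projective space, being a set of vectors, is mapped to its
  image.\<close>

definition linearly_isomorphic ::
  "(complex, 'v) module \<Rightarrow> 'v set set \<Rightarrow> (complex, 'w) module \<Rightarrow> 'w set set \<Rightarrow> bool" where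
  "linearly_isomorphic V P W Q \<longleftrightarrow>
     (\<exists>T. linear_map class_ring V W T \<and> bij_betw T (carrier V) (carrier W) \<and>
          (\<lambda>p. T ` p) ` P = Q)"

subsection \<open>The reciprocal surface\<close>

text \<open>Polynomials are finitely supported functions from exponent vectors to coefficients, with
  the convolution product of \<^type>\<open>poly_mapping\<close>. The coordinate ring of the space of symmetric
  matrices has one variable for each entry \<open>(i,j)\<close> with \<open>i \<le> j\<close>.\<close>

definition sym_positions :: "nat \<Rightarrow> (nat \<times> nat) list" where
  "sym_positions n = [(i, j). i \<leftarrow> [0..<n], j \<leftarrow> [i..<n]]"

definition sym_polys :: "nat \<Rightarrow> ((nat \<times> nat \<Rightarrow>\<^sub>0 nat) \<Rightarrow>\<^sub>0 complex) set" where
  "sym_polys n = {p. \<forall>m\<in>Poly_Mapping.keys p. Poly_Mapping.keys m \<subseteq> set (sym_positions n)}"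

definition eval_poly :: "(('x \<Rightarrow>\<^sub>0 nat) \<Rightarrow>\<^sub>0 complex) \<Rightarrow> ('x \<Rightarrow> complex) \<Rightarrow> complex" where
  "eval_poly p f = (\<Sum>m\<in>Poly_Mapping.keys p. Poly_Mapping.lookup p m * (\<Prod>v\<in>Poly_Mapping.keys m. f v ^ Poly_Mapping.lookup m v))"

definition zariski_closure :: "nat \<Rightarrow> complex mat set \<Rightarrow> complex mat set" where
  "zariski_closure n S =
     {A \<in> carrier (sym_space n). \<forall>p\<in>sym_polys n.
        (\<forall>B\<in>S. eval_poly p (($$) B) = 0) \<longrightarrow> eval_poly p (($$) A) = 0}"

definition inverses :: "complex mat set \<Rightarrow> complex mat set" where
  "inverses L = {B. \<exists>A\<in>L. inverts_mat A B \<and> inverts_mat B A}"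

definition reciprocal_surface :: "nat \<Rightarrow> complex mat set \<Rightarrow> complex mat set set" where
  "reciprocal_surface n L = proj_pts (sym_space n) (zariski_closure n (inverses L))"

subsection \<open>The Veronese surface\<close>

text \<open>Exponent vectors of the monomials of degree \<open>d\<close> in three variables.\<close>

definition monos3 :: "nat \<Rightarrow> (nat \<times> nat \<times> nat) list" where
  "monos3 d = [(a, b, d - a - b). a \<leftarrow> [0..<Suc d], b \<leftarrow> [0..<Suc (d - a)]]"

definition veronese_map :: "nat \<Rightarrow> complex vec \<Rightarrow> complex vec" where
  "veronese_map d v = vec (length (monos3 d))
     (\<lambda>k. case monos3 d ! k of (a, b, c) \<Rightarrow> v $ 0 ^ a * v $ 1 ^ b * v $ 2 ^ c)"

abbreviation veronese_space :: "nat \<Rightarrow> (complex, complex vec) module" where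
  "veronese_space d \<equiv> module_vec TYPE(complex) (length (monos3 d))"

definition veronese_surface :: "nat \<Rightarrow> complex vec set set" where
  "veronese_surface d =
     proj_pts (veronese_space d) (veronese_map d ` {v \<in> carrier_vec 3. v \<noteq> 0\<^sub>v 3})"

subsection \<open>The Chow matrix\<close>

type_synonym cpoly = "(nat \<Rightarrow>\<^sub>0 nat) \<Rightarrow>\<^sub>0 complex"

definition cvar :: "nat \<Rightarrow> cpoly" where
  "cvar k = Poly_Mapping.single (Poly_Mapping.single k 1) 1"

definition cconst :: "complex \<Rightarrow> cpoly" where
  "cconst c = Poly_Mapping.single 0 c"

text \<open>The matrix \<open>xX + yY + zZ\<close>, where the unknowns \<open>x, y, z\<close> are the variables 0, 1, 2.\<close>

definition generic_member :: "complex mat \<Rightarrow> complex mat \<Rightarrow> complex mat \<Rightarrow> cpoly mat" where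
  "generic_member X Y Z =
     cvar 0 \<cdot>\<^sub>m map_mat cconst X + cvar 1 \<cdot>\<^sub>m map_mat cconst Y + cvar 2 \<cdot>\<^sub>m map_mat cconst Z"

definition mono_coeff :: "cpoly \<Rightarrow> nat \<times> nat \<times> nat \<Rightarrow> complex" where
  "mono_coeff p = (\<lambda>(a, b, c). Poly_Mapping.lookup p
     (Poly_Mapping.single 0 a + Poly_Mapping.single 1 b + Poly_Mapping.single 2 c))"

definition chow_matrix :: "nat \<Rightarrow> complex mat \<Rightarrow> complex mat \<Rightarrow> complex mat \<Rightarrow> complex mat" where
  "chow_matrix n X Y Z =
     mat (length (sym_positions n)) (length (monos3 (n - 1)))
       (\<lambda>(r, s). mono_coeff (adj_mat (generic_member X Y Z) $$ (sym_positions n ! r))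
                            (monos3 (n - 1) ! s))"

lemma length_sym_positions: "length (sym_positions n) = Suc n choose 2"
proof -
  have "length (sym_positions n) = (\<Sum>i\<leftarrow>[0..<n]. n - i)"
    by (simp add: sym_positions_def length_concat comp_def)
  also have "\<dots> = (\<Sum>i<n. n - i)"
    by (simp add: interv_sum_list_conv_sum_set_nat atLeast0LessThan)
  also have "\<dots> = (\<Sum>i<n. Suc i)"
    by (subst sum.nat_diff_reindex[symmetric]) (rule sum.cong, auto)
  also have "\<dots> = Suc n choose 2"
    by (induction n) (auto simp: numeral_2_eq_2)
  finally show ?thesis .
qed

lemma length_monos3: "length (monos3 d) = (d + 2) choose 2"
proof -
  have "length (monos3 d) = (\<Sum>i\<leftarrow>[0..<Suc d]. Suc d - i)"
    by (simp add: monos3_def length_concat comp_def del: upt_Suc)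
       (rule arg_cong[where f = sum_list], auto simp: Suc_diff_le)
  also have "\<dots> = length (sym_positions (Suc d))"
    by (simp add: sym_positions_def length_concat comp_def del: upt_Suc)
  finally show ?thesis by (simp add: length_sym_positions)
qed

lemma square_chow_matrix:
  "n \<ge> 1 \<Longrightarrow> chow_matrix n X Y Z \<in> carrier_mat (Suc n choose 2) (Suc n choose 2)"
  by (cases n) (auto simp: chow_matrix_def length_sym_positions length_monos3)

end

theory Submission
  imports Defs "Jordan_Normal_Form.Char_Poly" "HOL-Computational_Algebra.Fundamental_Theorem_Algebra"
begin

text \<open>Write \<open>M(v) = v\<^sub>0 X + v\<^sub>1 Y + v\<^sub>2 Z\<close>, let \<open>C\<close> be the Chow matrix and \<open>\<nu>\<close> the Veronese map of
  degree \<open>n - 1\<close>. All four conditions are compared with \<open>det C \<noteq> 0\<close> through the identity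
  \<open>C \<nu>(v) = vec (adj M(v))\<close> (\<open>chow_matrix_mult_veronese\<close>), where \<open>vec\<close> lists the entries on and above the
  diagonal: up to scalars, the inverses of members of the net are the images of Veronese points.

  If \<open>det C \<noteq> 0\<close>, then \<open>C\<close> itself is the linear isomorphism of the Veronese surface with the reciprocal
  surface. The cone \<open>{\<nu>(v)}\<close> is cut out by the quadrics \<open>w\<^sub>m w\<^sub>m\<^sub>' = w\<^sub>k w\<^sub>k\<^sub>'\<close> with \<open>m + m' = k + k'\<close>
  (\<open>veronese_cone\<close>); pulled back along \<open>C\<close> they vanish on the inverses, so the Zariski closure contains
  nothing but the matrices \<open>adj M(v)\<close>. It contains all of them, because on the line through \<open>M(v)\<close> and an
  invertible member a polynomial vanishing on the inverses has infinitely many zeros. A linear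
  isomorphism with the Veronese surface implies that the reciprocal surface spans, since the Veronese
  points span. If \<open>C\<close> is singular, a vector \<open>y \<noteq> 0\<close> with \<open>y\<^sup>T C = 0\<close> is a linear form that vanishes on the
  inverses, hence on the closure and on its span. Finally, a nonzero member \<open>M(v)\<close> of rank at most
  \<open>n - 2\<close> has \<open>adj M(v) = 0\<close>, so \<open>\<nu>(v)\<close> is in the kernel of \<open>C\<close>.

  The substance is that the rank condition forces \<open>det C \<noteq> 0\<close>. If \<open>y\<^sup>T C = 0\<close>, then \<open>y\<close> is a symmetric
  matrix \<open>B\<close> with \<open>tr (B adj M(v)) = 0\<close> for all \<open>v\<close>, and \<open>B = 0\<close> has to be shown
  (\<open>symmetric_trace_form_zero\<close>). In sheaf language, \<open>B = M A + A\<^sup>T M\<close> locally, for some matrix \<open>A\<close>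
  of local sections of \<open>O(-1)\<close>, and the obstruction to gluing, with values in skew matrices, lies in
  \<open>H\<^sup>1(\<bbbP>\<^sup>2, O(-2)) = 0\<close>. The proof below extracts the linear algebra. Fix an invertible member \<open>P\<close> and
  let \<open>Q\<close> be a member independent of \<open>P\<close>. Then \<open>B = P K Q - Q K P\<close> has exactly one skew solution \<open>K\<close>:

    \<^item> the matrix \<open>N = P\<^sup>-\<^sup>1 Q\<close> has a cyclic vector because \<open>adj (x - N)\<close> never vanishes
      (\<open>cyclic_if_adj_mat_nonvanishing\<close>);
    \<^item> cyclicity leaves no skew \<open>K \<noteq> 0\<close> with \<open>P K Q = Q K P\<close> (\<open>skew_intertwiner_zero\<close>);
    \<^item> the trace condition gives \<open>tr (P\<^sup>-\<^sup>1 B N\<^sup>k) = 0\<close> for all \<open>k\<close> (\<open>mtrace_mult_pow_vanishes\<close>), which is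
      what is needed to solve \<open>P\<^sup>-\<^sup>1 B = H N - N H\<close> (\<open>commutator_solvable\<close>), and \<open>K\<close> is the skew part
      of \<open>H P\<^sup>-\<^sup>1\<close>.

  Now let \<open>Q\<close> run over a line of members that avoids \<open>P\<close>. The solution \<open>K\<close> scales by \<open>1/c\<close> when \<open>Q\<close>
  scales by \<open>c\<close>, so it is a section of \<open>O(-1)\<^sup>m\<close> over the whole of \<open>\<bbbP>\<^sup>1\<close> and vanishes
  (\<open>pencil_section_vanishes\<close>). Hence \<open>B = 0\<close>.\<close>

section \<open>Traces, adjugates and rank\<close>

definition mtrace :: "nat \<Rightarrow> 'a::comm_ring_1 mat \<Rightarrow> 'a" where
  "mtrace n A = (\<Sum>i<n. A $$ (i, i))"

lemma index_mult_mat_sum: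
  assumes "A \<in> carrier_mat n m" "B \<in> carrier_mat m k" "i < n" "j < k"
  shows "(A * B) $$ (i, j) = (\<Sum>l<m. A $$ (i, l) * B $$ (l, j))"
  using assms by (auto simp: scalar_prod_def atLeast0LessThan)

lemma mtrace_mult:
  assumes "A \<in> carrier_mat n m" "B \<in> carrier_mat m n"
  shows "mtrace n (A * B) = (\<Sum>i<n. \<Sum>j<m. A $$ (i, j) * B $$ (j, i))"
  unfolding mtrace_def by (intro sum.cong refl index_mult_mat_sum[OF assms]) auto

lemma mtrace_mult_commute:
  assumes "A \<in> carrier_mat n m" "B \<in> carrier_mat m n"
  shows "mtrace n (A * B) = mtrace m (B * A)"
  unfolding mtrace_mult[OF assms] mtrace_mult[OF assms(2,1)]
  by (subst sum.swap) (simp add: mult.commute)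

lemma mult_mat_zero_vec:
  fixes A :: "'a::comm_ring_1 mat"
  assumes "A \<in> carrier_mat n m"
  shows "A *\<^sub>v 0\<^sub>v m = 0\<^sub>v n"
  using assms by (intro eq_vecI) auto

lemma mtrace_smult:
  "A \<in> carrier_mat n n \<Longrightarrow> mtrace n (c \<cdot>\<^sub>m A) = c * mtrace n A"
  by (simp add: mtrace_def sum_distrib_left)

lemma mtrace_add:
  "A \<in> carrier_mat n n \<Longrightarrow> B \<in> carrier_mat n n \<Longrightarrow> mtrace n (A + B) = mtrace n A + mtrace n B"
  by (simp add: mtrace_def sum.distrib)

lemma mtrace_minus:
  "A \<in> carrier_mat n n \<Longrightarrow> B \<in> carrier_mat n n \<Longrightarrow> mtrace n (A - B) = mtrace n A - mtrace n B"
  by (simp add: mtrace_def sum_subtractf)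

lemma (in comm_ring_hom) hom_cofactor:
  assumes "A \<in> carrier_mat n n" "i < n" "j < n"
  shows "cofactor (map_mat hom A) i j = hom (cofactor A i j)"
proof -
  have "mat_delete (map_mat hom A) i j = map_mat hom (mat_delete A i j)"
    using assms by (auto simp: mat_delete_def intro!: eq_matI)
  then show ?thesis by (simp add: cofactor_def hom_mult hom_power hom_distribs)
qed

lemma (in comm_ring_hom) hom_adj_mat:
  assumes "A \<in> carrier_mat n n"
  shows "adj_mat (map_mat hom A) = map_mat hom (adj_mat A)"
  using assms by (intro eq_matI) (auto simp: adj_mat_def hom_cofactor)

lemma adj_mat_transpose:
  assumes A: "A \<in> carrier_mat n n"
  shows "adj_mat (transpose_mat A) = transpose_mat (adj_mat A)"
proof (rule eq_matI)
  fix i j assume "i < dim_row (transpose_mat (adj_mat A))" "j < dim_col (transpose_mat (adj_mat A))"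
  then have ij: "i < n" "j < n" using adj_mat(1)[OF A] by auto
  have "mat_delete (transpose_mat A) j i = transpose_mat (mat_delete A i j)"
    using A ij by (auto simp: mat_delete_def intro!: eq_matI)
  moreover have "det (transpose_mat (mat_delete A i j)) = det (mat_delete A i j)"
    by (rule det_transpose) (rule mat_delete_carrier[OF A])
  ultimately show "adj_mat (transpose_mat A) $$ (i, j) = transpose_mat (adj_mat A) $$ (i, j)"
    using A ij by (auto simp: adj_mat_def cofactor_def add.commute)
qed (use A in \<open>auto simp: adj_mat_def\<close>)

lemma transpose_adj_mat_symmetric:
  "A \<in> carrier_mat n n \<Longrightarrow> transpose_mat A = A \<Longrightarrow> transpose_mat (adj_mat A) = adj_mat A"
  using adj_mat_transpose by metis

lemma smult_mat_cancel:
  fixes A :: "'a::idom mat"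
  assumes "c \<cdot>\<^sub>m A = c \<cdot>\<^sub>m B" "c \<noteq> 0" "A \<in> carrier_mat n m" "B \<in> carrier_mat n m"
  shows "A = B"
proof (rule eq_matI)
  fix i j assume "i < dim_row B" "j < dim_col B"
  then have "(c \<cdot>\<^sub>m A) $$ (i, j) = c * A $$ (i, j)" "(c \<cdot>\<^sub>m B) $$ (i, j) = c * B $$ (i, j)"
    using assms(3,4) by auto
  then show "A $$ (i, j) = B $$ (i, j)"
    using assms(1,2) by (metis mult_cancel_left)
qed (use assms in auto)

lemma adj_mat_mult_nonsingular:
  fixes A :: "'a::idom mat"
  assumes A: "A \<in> carrier_mat n n" and B: "B \<in> carrier_mat n n" and "det A \<noteq> 0" "det B \<noteq> 0"
  shows "adj_mat (A * B) = adj_mat B * adj_mat A"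
proof (rule smult_mat_cancel)
  note c = A B adj_mat(1)[OF A] adj_mat(1)[OF B] 
  have AB: "A * B \<in> carrier_mat n n" using A B by simp
  note cAB = adj_mat(1)[OF AB]
  have "(A * B) * (adj_mat B * adj_mat A) = A * ((B * adj_mat B) * adj_mat A)"
    using c by (simp add: assoc_mult_mat[of _ n n _ n _ n])
  also have "\<dots> = det B \<cdot>\<^sub>m (A * adj_mat A)"
    using c by (simp add: adj_mat(2)[OF B] mult_smult_distrib[of _ n n _ n]
        mult_smult_assoc_mat[of _ n n _ n])
  also have "\<dots> = (det A * det B) \<cdot>\<^sub>m 1\<^sub>m n"
    by (auto simp: adj_mat(2)[OF A] mult.commute)
  finally have *: "(A * B) * (adj_mat B * adj_mat A) = (det A * det B) \<cdot>\<^sub>m 1\<^sub>m n" .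
  have "(det A * det B) \<cdot>\<^sub>m (adj_mat B * adj_mat A) = (adj_mat (A * B) * (A * B)) * (adj_mat B * adj_mat A)"
    using c by (simp add: adj_mat(3)[OF AB] det_mult[OF A B] mult_smult_assoc_mat[of _ n n _ n])
  also have "\<dots> = adj_mat (A * B) * ((A * B) * (adj_mat B * adj_mat A))"
    by (rule assoc_mult_mat[of _ n n _ n _ n]) (use c AB cAB in auto)
  also have "\<dots> = (det A * det B) \<cdot>\<^sub>m adj_mat (A * B)"
    by (simp add: * mult_smult_distrib[OF cAB one_carrier_mat] right_mult_one_mat[OF cAB])
  finally show "(det A * det B) \<cdot>\<^sub>m adj_mat (A * B) = (det A * det B) \<cdot>\<^sub>m (adj_mat B * adj_mat A)"
    by simp
  show "adj_mat (A * B) \<in> carrier_mat n n" "adj_mat B * adj_mat A \<in> carrier_mat n n"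
    using c cAB by auto
  show "det A * det B \<noteq> 0" using assms by simp
qed

lemmas poly_eval_det = comm_ring_hom.hom_det[OF poly_hom.comm_ring_hom_axioms]
lemmas poly_eval_mult = semiring_hom.mat_hom_mult[OF poly_hom.semiring_hom_axioms]

lemma poly_at_pencil:
  fixes F G :: "'a::comm_ring_1 mat"
  assumes "F \<in> carrier_mat n n" "G \<in> carrier_mat n n"
  shows "map_mat (\<lambda>p. poly p x) (mat n n (\<lambda>ij. [:F $$ ij, G $$ ij:])) = F + x \<cdot>\<^sub>m G"
  using assms by (intro eq_matI) auto

lemma det_pencil_polynomial:
  fixes F G :: "'a::comm_ring_1 mat"
  assumes "F \<in> carrier_mat n n" "G \<in> carrier_mat n n"
  obtains p where "\<And>x. poly p x = det (F + x \<cdot>\<^sub>m G)"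
  using poly_eval_det[of _ "mat n n (\<lambda>ij. [:F $$ ij, G $$ ij:])"]
  unfolding poly_at_pencil[OF assms] by (rule that[OF sym])

text \<open>The adjugate of a pencil is evaluated from one polynomial matrix, which is what allows identities
  to be continued across the singular members.\<close>

lemma adj_pencil_polynomial:
  fixes F G :: "'a::comm_ring_1 mat"
  assumes "F \<in> carrier_mat n n" "G \<in> carrier_mat n n"
  obtains p where "\<And>i j x. i < n \<Longrightarrow> j < n \<Longrightarrow> poly (p i j) x = adj_mat (F + x \<cdot>\<^sub>m G) $$ (i, j)"
proof -
  let ?P = "mat n n (\<lambda>ij. [:F $$ ij, G $$ ij:])"
  have P: "?P \<in> carrier_mat n n" by simp
  have "poly (adj_mat ?P $$ (i, j)) x = adj_mat (F + x \<cdot>\<^sub>m G) $$ (i, j)" if "i < n" "j < n" for i j x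
  proof -
    have "adj_mat (F + x \<cdot>\<^sub>m G) = map_mat (\<lambda>p. poly p x) (adj_mat ?P)"
      using poly_hom.hom_adj_mat[OF P, of x] unfolding poly_at_pencil[OF assms] .
    moreover have "dim_row (adj_mat ?P) = n" "dim_col (adj_mat ?P) = n"
      by (rule carrier_matD[OF adj_mat(1)[OF P]])+
    ultimately show ?thesis
      using index_map_mat(1)[of i "adj_mat ?P" j "\<lambda>p. poly p x"] that by argo
  qed
  then show ?thesis by (rule that)
qed

text \<open>This extends identities from generic values of a parameter to all values.\<close>

lemma poly_eq_0_if_vanishes_generically:
  fixes p q :: "complex poly"
  assumes "q \<noteq> 0" and "\<And>x. poly q x \<noteq> 0 \<Longrightarrow> poly p x = 0"
  shows "p = 0"
proof -
  have "poly (p * q) x = 0" for x using assms(2)[of x] by auto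
  then have "p * q = 0" using poly_all_0_iff_0[of "p * q"] by blast
  then show ?thesis using assms(1) by simp
qed

lemma poly_char_poly_eq_det:
  fixes N :: "complex mat"
  assumes "N \<in> carrier_mat n n"
  shows "poly (char_poly N) x = det (x \<cdot>\<^sub>m 1\<^sub>m n - N)"
  unfolding char_poly_def
  by (rule poly_det_cong[of _ n], insert assms, auto simp: char_poly_matrix_def)

text \<open>Over a domain the identity follows by cancelling \<open>det A det B\<close>. Singular factors are perturbed to
  \<open>A + x\<close> and \<open>B + x\<close>, whose determinants are monic polynomials in \<open>x\<close>, and \<open>x\<close> is then set to zero.\<close>

lemma adj_mat_mult:
  fixes A B :: "complex mat"
  assumes A: "A \<in> carrier_mat n n" and B: "B \<in> carrier_mat n n"
  shows "adj_mat (A * B) = adj_mat B * adj_mat A"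
proof -
  let ?p = "\<lambda>A. char_poly_matrix (- A)"
  have ev: "map_mat (\<lambda>p. poly p 0) (?p M) = M" if "M \<in> carrier_mat n n" for M :: "complex mat"
    using that by (intro eq_matI) (auto simp: char_poly_matrix_def)
  have nz: "det (?p M) \<noteq> 0" if "M \<in> carrier_mat n n" for M :: "complex mat"
    using degree_monic_char_poly[of "-M" n] that by (auto simp: char_poly_def)
  have cA: "?p A \<in> carrier_mat n n" and cB: "?p B \<in> carrier_mat n n" using A B by auto
  have "map_mat (\<lambda>p. poly p 0) (adj_mat (?p A * ?p B)) =
      map_mat (\<lambda>p. poly p 0) (adj_mat (?p B) * adj_mat (?p A))"
    using adj_mat_mult_nonsingular[OF cA cB nz[OF A] nz[OF B]] by simp
  then show ?thesis
    using cA cB by (simp add: poly_hom.hom_adj_mat[symmetric, of _ n]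
       poly_eval_mult[of _ n n _ n] adj_mat(1) ev A B)
qed

text \<open>The determinant of \<open>A\<close> with column \<open>j\<close> replaced by \<open>w\<close> is \<open>\<Sum>\<^sub>i w\<^sub>i cofactor\<^sub>i\<^sub>j\<close>. Hence a nonzero cofactor in
  column \<open>j\<close> means that the other \<open>n - 1\<close> columns can be completed to a basis, that is, that they are
  independent.\<close>

lemma adj_mat_nonzero_iff_rank:
  fixes A :: "complex mat"
  assumes A: "A \<in> carrier_mat n n" and n: "n > 0"
  shows "adj_mat A \<noteq> 0\<^sub>m n n \<longleftrightarrow> vec_space.rank n A \<ge> n - 1"
proof -
  interpret vec_space "TYPE(complex)" n .
  have dims: "dim_row A = n" "dim_col A = n" using A by auto
  have rep: "det (replace_col A w j) = (\<Sum>i<n. w $ i * cofactor A i j)"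
    if "w \<in> carrier_vec n" "j < n" for w j
  proof -
    have R: "replace_col A w j \<in> carrier_mat n n" using A by (auto simp: replace_col_def)
    have "mat_delete (replace_col A w j) i j = mat_delete A i j" if "i < n" for i
      using that \<open>j < n\<close> A by (auto simp: mat_delete_def replace_col_def intro!: eq_matI)
    then show ?thesis
      unfolding laplace_expansion_column[OF R \<open>j < n\<close>]
      using that dims by (auto simp: replace_col_def cofactor_def intro!: sum.cong)
  qed
  have col_rep: "col (replace_col A w j) k = (if k = j then w else col A k)"
    if "w \<in> carrier_vec n" "k < n" for w j k
    using that dims by (intro eq_vecI) (auto simp: replace_col_def)
  show ?thesis
  proof
    assume "adj_mat A \<noteq> 0\<^sub>m n n"
    then obtain i j where ij: "i < n" "j < n" and cof: "cofactor A i j \<noteq> 0"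
      using A by (force simp: adj_mat_def mat_eq_iff)
    define R where "R = replace_col A (unit_vec n i) j"
    have R: "R \<in> carrier_mat n n" using A by (auto simp: R_def replace_col_def)
    have "det R = cofactor A i j"
      using ij by (auto simp: R_def rep sum.delta' if_distrib[of "\<lambda>x. x * _"] cong: if_cong)
    then have rk: "rank R = n" using low_rank_det_zero[OF R] cof by simp
    then have dist: "distinct (cols R)" using non_distinct_low_rank[OF R] by auto
    have ind: "lin_indpt (set (cols R))" by (rule full_rank_lin_indpt[OF R rk dist])
    let ?U = "col A ` ({..<n} - {j})"
    have colR: "col R k = col A k" if "k \<in> {..<n} - {j}" for k
      using that by (simp add: R_def col_rep)
    have U: "?U = col R ` ({..<n} - {j})" using colR by auto
    have "inj_on (col R) {..<n}"
      using dist R by (auto simp: distinct_conv_nth inj_on_def)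
    then have "card ?U = n - 1"
      unfolding U using ij by (subst card_image) (auto intro: inj_on_subset)
    moreover have "?U \<subseteq> set (cols R)"
      unfolding U using R by (auto simp: cols_def)
    then have "lin_indpt ?U" using ind subset_li_is_li by blast
    moreover have "?U \<subseteq> set (cols A)" using A by (auto simp: cols_def)
    ultimately show "rank A \<ge> n - 1" using rank_ge_card_indpt[OF A, of ?U] by simp
  next
    assume rk: "rank A \<ge> n - 1"
    show "adj_mat A \<noteq> 0\<^sub>m n n"
    proof
      assume z: "adj_mat A = 0\<^sub>m n n"
      have cof: "cofactor A i j = 0" if "i < n" "j < n" for i j
        using z that A by (auto simp: adj_mat_def mat_eq_iff)
      have "det A = 0"
        using laplace_expansion_column[OF A n] cof n by simp
      then have "rank A < n" by (rule det_zero_low_rank[OF A])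
      with rk have rk: "rank A = n - 1" by simp
      obtain S where S: "maximal S (\<lambda>T. T \<subseteq> set (cols A) \<and> lin_indpt T)" "finite S"
        using maximal_exists_superset[of "set (cols A)" "\<lambda>T. T \<subseteq> set (cols A) \<and> lin_indpt T" "{}"]
        by (auto simp: lin_dep_def)
      have cardS: "card S = n - 1" using rank_card_indpt[OF A S(1)] rk by simp
      have SA: "S \<subseteq> set (cols A)" and li: "lin_indpt S" using S(1) by (auto simp: maximal_def)
      have Sc: "S \<subseteq> carrier_vec n" using SA cols_dim A by blast
      have "S \<subseteq> col A ` {..<n}" using SA A by (auto simp: cols_def)
      then obtain J where J: "J \<subseteq> {..<n}" "inj_on (col A) J" "S = col A ` J"
        by (auto simp: subset_image_inj)
      have "card J = n - 1" using J cardS card_image by metis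
      then have "card ({..<n} - J) = 1"
        using J(1) n by (subst card_Diff_subset) (auto intro: finite_subset)
      then obtain j where j: "{..<n} - J = {j}" by (auto simp: card_1_singleton_iff)
      have "span S \<noteq> carrier_vec n"
      proof
        assume "span S = carrier_vec n"
        then have "n \<le> card S" using gen_ge_dim[OF S(2)] Sc by (simp add: dim_is_n)
        then show False using cardS n by simp
      qed
      then obtain w where w: "w \<in> carrier_vec n" "w \<notin> span S"
        using span_is_subset2[OF Sc] by auto
      have wS: "w \<notin> S" using w(2) in_own_span[OF Sc] by blast
      define R where "R = replace_col A w j"
      have R: "R \<in> carrier_mat n n" using A by (auto simp: R_def replace_col_def)
      have jn: "j < n" "j \<notin> J" and J': "{..<n} = insert j J" using j J(1) by auto
      have "set (cols R) = col R ` {..<n}" using R by (auto simp: cols_def)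
      also have "\<dots> = insert w S"
      proof -
        have "col R j = w" using jn w by (simp add: R_def col_rep)
        moreover have "col R ` J = S"
          unfolding J(3) using J(1) jn w by (intro image_cong) (auto simp: R_def col_rep)
        ultimately show ?thesis by (simp add: J')
      qed
      finally have cols: "set (cols R) = insert w S" .
      have "card (set (cols R)) = n" using wS S(2) cardS n by (simp add: cols)
      then have dist: "distinct (cols R)" using R by (simp add: card_distinct)
      have "lin_indpt (insert w S)"
        using lin_dep_iff_in_span[OF Sc li w(1) wS] w(2) by simp
      then have "rank R = n" using lin_indpt_full_rank[OF R dist] by (simp add: cols)
      then have "det R \<noteq> 0" using det_rank_iff[OF R] by simp
      moreover have "det R = 0"
        using rep[OF w(1) jn(1)] cof jn(1) by (simp add: R_def)
      ultimately show False by simp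
    qed
  qed
qed

section \<open>Sections of negative degree over the projective line\<close>

text \<open>Gaussian elimination of one coordinate at a time, stated for families of functions so that it
  applies to the entries of matrices.\<close>

lemma exists_dependency:
  fixes k :: "'t \<Rightarrow> 'i \<Rightarrow> 'a::field"
  assumes "finite I" "finite S" "card I < card S"
  shows "\<exists>c. (\<exists>t\<in>S. c t \<noteq> 0) \<and> (\<forall>i\<in>I. (\<Sum>t\<in>S. c t * k t i) = 0)"
  using assms
proof (induction I arbitrary: S k rule: finite_induct)
  case empty
  then have "S \<noteq> {}" by auto
  then show ?case by (intro exI[of _ "\<lambda>_. 1"]) auto
next
  case (insert i I)
  show ?case
  proof (cases "\<forall>t\<in>S. k t i = 0")
    case True
    then show ?thesis using insert.IH[of S k] insert.prems insert.hyps by auto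
  next
    case False
    then obtain t0 where t0: "t0 \<in> S" "k t0 i \<noteq> 0" by auto
    let ?S = "S - {t0}"
    let ?k = "\<lambda>t j. k t j - k t i / k t0 i * k t0 j"
    have "card I < card ?S" using insert.prems insert.hyps t0 by simp
    from insert.IH[OF _ this, of ?k] insert.prems obtain c where
      c: "\<exists>t\<in>?S. c t \<noteq> 0" "\<And>j. j \<in> I \<Longrightarrow> (\<Sum>t\<in>?S. c t * ?k t j) = 0" by auto
    define c0 where "c0 = - (\<Sum>t\<in>?S. c t * k t i) / k t0 i"
    let ?c = "c(t0 := c0)"
    have split: "(\<Sum>t\<in>S. ?c t * k t j) = c0 * k t0 j + (\<Sum>t\<in>?S. c t * k t j)" for j
      using t0 insert.prems by (subst sum.remove[of S t0]) auto
    have "(\<Sum>t\<in>S. ?c t * k t j) = 0" if "j \<in> insert i I" for j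
    proof (cases "j = i")
      case True
      then show ?thesis unfolding split using t0 by (simp add: c0_def)
    next
      case False
      then have "0 = (\<Sum>t\<in>?S. c t * ?k t j)" using c(2) that by simp
      also have "\<dots> = (\<Sum>t\<in>?S. c t * k t j) - (\<Sum>t\<in>?S. c t * k t i) / k t0 i * k t0 j"
        by (simp add: algebra_simps sum_subtractf sum_distrib_left sum_divide_distrib)
      finally show ?thesis unfolding split by (simp add: c0_def)
    qed
    then show ?thesis using c(1) by (intro exI[of _ ?c]) auto
  qed
qed

text \<open>After clearing denominators the left-hand side is a polynomial in \<open>\<tau>\<close> with leading coefficient
  \<open>\<Sum> c\<^sub>t\<close> in degree \<open>card S - 1\<close>, so it has a root. At a point \<open>t\<close> of \<open>S\<close> its value is
  \<open>c\<^sub>t \<Prod>\<^sub>s\<^sub>\<noteq>\<^sub>t (t - s) \<noteq> 0\<close>, so the root is not in \<open>S\<close>.\<close>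

lemma partial_fraction_root:
  fixes c :: "complex \<Rightarrow> complex"
  assumes S: "finite S" "card S \<ge> 2" and c: "\<And>t. t \<in> S \<Longrightarrow> c t \<noteq> 0" and sum: "(\<Sum>t\<in>S. c t) \<noteq> 0"
  obtains \<tau> where "\<tau> \<notin> S" "(\<Sum>t\<in>S. c t / (\<tau> - t)) = 0"
proof -
  let ?l = "\<lambda>t. \<Prod>s\<in>S - {t}. [:- s, 1:]"
  define d where "d = (\<Sum>t\<in>S. smult (c t) (?l t))"
  have pl: "poly (?l t) x = (\<Prod>s\<in>S - {t}. x - s)" for t x
    by (simp add: poly_prod)
  have "coeff (?l t) (card S - 1) = 1" if "t \<in> S" for t
  proof -
    have "degree (?l t) = card S - 1"
      using that S by (subst degree_prod_eq_sum_degree) auto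
    moreover have "lead_coeff (?l t) = 1" by (simp add: lead_coeff_prod)
    ultimately show ?thesis by simp
  qed
  then have "coeff d (card S - 1) = (\<Sum>t\<in>S. c t)" by (simp add: d_def coeff_sum)
  then have "degree d \<ge> card S - 1" using sum by (intro le_degree) simp
  then have "degree d \<noteq> 0" using S by simp
  then obtain \<tau> where \<tau>: "poly d \<tau> = 0"
    using fundamental_theorem_of_algebra constant_degree by metis
  have nS: "\<tau> \<notin> S"
  proof
    assume "\<tau> \<in> S"
    have "poly d \<tau> = (\<Sum>t\<in>S. c t * (\<Prod>s\<in>S - {t}. \<tau> - s))"
      by (simp add: d_def poly_sum pl)
    also have "\<dots> = (\<Sum>t\<in>{\<tau>}. c t * (\<Prod>s\<in>S - {t}. \<tau> - s))"
      using \<open>\<tau> \<in> S\<close> S(1)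
      by (intro sum.mono_neutral_right) (auto intro!: prod_zero bexI[of _ \<tau>])
    finally have "poly d \<tau> = c \<tau> * (\<Prod>s\<in>S - {\<tau>}. \<tau> - s)" by simp
    then show False using \<tau> c \<open>\<tau> \<in> S\<close> S by auto
  qed
  have nz: "(\<Prod>s\<in>S. \<tau> - s) \<noteq> 0" using nS S by auto
  have "c t / (\<tau> - t) = poly (smult (c t) (?l t)) \<tau> / (\<Prod>s\<in>S. \<tau> - s)" if "t \<in> S" for t
    using nS that S nz by (simp add: pl prod.remove[of S t] divide_simps)
  then have "(\<Sum>t\<in>S. c t / (\<tau> - t)) = poly d \<tau> / (\<Prod>s\<in>S. \<tau> - s)"
    by (simp add: d_def poly_sum sum_divide_distrib)
  then show ?thesis using \<tau> nS that by simp
qed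

text \<open>Suppose that \<open>(A + t D) k\<^sub>t = b\<close> for all \<open>t\<close>, where \<open>D\<close> and every \<open>A + t D\<close> are injective. From a relation
  \<open>\<Sum> c\<^sub>t k\<^sub>t = 0\<close> one computes
  \<open>D (\<Sum> c\<^sub>t t k\<^sub>t) = (\<Sum> c\<^sub>t) b\<close> and \<open>(A + \<tau> D) (\<Sum> c\<^sub>t/(\<tau> - t) k\<^sub>t) = (\<Sum> c\<^sub>t/(\<tau> - t)) b\<close>.
  If \<open>\<Sum> c\<^sub>t = 0\<close> or \<open>\<Sum> c\<^sub>t/(\<tau> - t) = 0\<close>, injectivity turns this into a new relation, with coefficients
  \<open>c\<^sub>t t\<close> or \<open>c\<^sub>t/(\<tau> - t)\<close>; the hypotheses record just these two consequences. A relation with at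
  least two terms meets one of the two conditions, the second one for a suitable \<open>\<tau>\<close>. For a shortest
  relation the new coefficients must be proportional to the old ones, which is impossible as soon as
  two parameters occur. So a shortest relation has a single term and some \<open>k\<^sub>t\<close> is zero.\<close>

lemma pencil_section_vanishes:
  fixes k :: "complex \<Rightarrow> 'i \<Rightarrow> complex"
  assumes I: "finite I"
    and H1: "\<And>S c. finite S \<Longrightarrow> (\<And>i. i \<in> I \<Longrightarrow> (\<Sum>t\<in>S. c t * k t i) = 0) \<Longrightarrow> (\<Sum>t\<in>S. c t) = 0
               \<Longrightarrow> \<forall>i\<in>I. (\<Sum>t\<in>S. c t * t * k t i) = 0"
    and H2: "\<And>S c \<tau>. finite S \<Longrightarrow> \<tau> \<notin> S \<Longrightarrow> (\<And>i. i \<in> I \<Longrightarrow> (\<Sum>t\<in>S. c t * k t i) = 0)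
               \<Longrightarrow> (\<Sum>t\<in>S. c t / (\<tau> - t)) = 0 \<Longrightarrow> \<forall>i\<in>I. (\<Sum>t\<in>S. c t / (\<tau> - t) * k t i) = 0"
  shows "\<exists>t. \<forall>i\<in>I. k t i = 0"
proof -
  define rel where "rel S c \<longleftrightarrow> (\<forall>i\<in>I. (\<Sum>t\<in>S. c t * k t i) = 0)" for S c
  define dep where "dep S \<longleftrightarrow> finite S \<and> S \<noteq> {} \<and> (\<exists>c. (\<forall>t\<in>S. c t \<noteq> 0) \<and> rel S c)" for S
  have support: "dep {t\<in>S. c t \<noteq> 0}" if "finite S" "\<exists>t\<in>S. c t \<noteq> 0" "rel S c" for S c
  proof -
    have "(\<Sum>t\<in>{t\<in>S. c t \<noteq> 0}. c t * k t i) = (\<Sum>t\<in>S. c t * k t i)" for i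
      using that(1) by (intro sum.mono_neutral_left) auto
    then have "rel {t\<in>S. c t \<noteq> 0} c" using that(3) by (simp add: rel_def)
    then show ?thesis using that(1,2) by (auto simp: dep_def)
  qed
  have "\<exists>S::complex set. finite S \<and> card S = Suc (card I)"
    using infinite_arbitrarily_large[OF infinite_UNIV_char_0] by blast
  then obtain S0 :: "complex set" where S0: "finite S0" "card S0 = Suc (card I)" by blast
  from exists_dependency[OF I S0(1), of k] S0(2) obtain c0 where
    "\<exists>t\<in>S0. c0 t \<noteq> 0" "rel S0 c0" unfolding rel_def by auto
  from support[OF S0(1) this] have ex: "\<exists>S. dep S" by blast
  define S where "S = arg_min card dep"
  have depS: "dep S" and min: "\<And>S'. dep S' \<Longrightarrow> card S \<le> card S'"
    unfolding S_def using ex arg_min_nat_lemma[of dep _ card] by blast+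
  from depS obtain c where c: "finite S" "S \<noteq> {}" "\<And>t. t \<in> S \<Longrightarrow> c t \<noteq> 0" "rel S c"
    by (auto simp: dep_def)
  \<comment> \<open>By minimality the relation \<open>c\<close> is unique up to scaling.\<close>
  have uniq: "g t = g s" if "rel S (\<lambda>t. c t * g t)" "s \<in> S" "t \<in> S" for g s t
  proof (rule ccontr)
    assume "g t \<noteq> g s"
    let ?d = "\<lambda>t. c t * (g t - g s)"
    have "(\<Sum>t\<in>S. ?d t * k t i) = (\<Sum>t\<in>S. c t * g t * k t i) - g s * (\<Sum>t\<in>S. c t * k t i)" for i
      by (simp add: algebra_simps sum_subtractf sum_distrib_left)
    then have "rel S ?d" using that(1) c(4) by (simp add: rel_def)
    moreover have "\<exists>t\<in>S. ?d t \<noteq> 0" using \<open>g t \<noteq> g s\<close> that(3) c(3) by auto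
    ultimately have "dep {t\<in>S. ?d t \<noteq> 0}" by (rule support[OF c(1), rotated])
    then have "card S \<le> card {t\<in>S. ?d t \<noteq> 0}" by (rule min)
    moreover have "{t\<in>S. ?d t \<noteq> 0} \<subset> S" using that(2) by auto
    then have "card {t\<in>S. ?d t \<noteq> 0} < card S" by (rule psubset_card_mono[OF c(1)])
    ultimately show False by simp
  qed
  show ?thesis
  proof (cases "card S \<ge> 2")
    case False
    then have "card S = 1" using c(1,2) by (metis One_nat_def Suc_1 card_0_eq less_2_cases not_le)
    then obtain t where "S = {t}" by (auto simp: card_1_singleton_iff)
    then have "\<forall>i\<in>I. k t i = 0" using c(3,4) by (auto simp: rel_def)
    then show ?thesis by blast
  next
    case True
    then obtain T where "T \<subseteq> S" "card T = 2" by (rule obtain_subset_with_card_n)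
    then obtain s t where st: "s \<in> S" "t \<in> S" "s \<noteq> t" by (auto simp: card_2_iff)
    show ?thesis
    proof (cases "(\<Sum>t\<in>S. c t) = 0")
      case zero: True
      have "rel S (\<lambda>t. c t * t)"
        using H1[OF c(1) _ zero] c(4) by (simp add: rel_def)
      from uniq[of "\<lambda>t. t", OF this st(1,2)] st(3) show ?thesis by simp
    next
      case False
      obtain \<tau> where \<tau>: "\<tau> \<notin> S" "(\<Sum>t\<in>S. c t / (\<tau> - t)) = 0"
        using partial_fraction_root[OF c(1) True c(3) False] .
      have "rel S (\<lambda>t. c t * (1 / (\<tau> - t)))"
        using H2[OF c(1) \<tau>(1) _ \<tau>(2)] c(4) by (simp add: rel_def)
      from uniq[of "\<lambda>t. 1 / (\<tau> - t)", OF this st(1,2)] st \<tau>(1) show ?thesis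
        by (simp add: divide_simps split: if_splits)
    qed
  qed
qed

section \<open>Cyclic vectors\<close>

definition krylov_vec :: "'a::comm_ring_1 mat \<Rightarrow> 'a vec \<Rightarrow> nat \<Rightarrow> 'a vec" where
  "krylov_vec N u j = ((\<lambda>v. N *\<^sub>v v) ^^ j) u"

definition krylov_mat :: "nat \<Rightarrow> 'a::comm_ring_1 mat \<Rightarrow> 'a vec \<Rightarrow> 'a mat" where
  "krylov_mat n N u = mat n n (\<lambda>(i, j). krylov_vec N u j $ i)"

lemma krylov_vec_0 [simp]: "krylov_vec N u 0 = u"
  and krylov_vec_Suc: "krylov_vec N u (Suc j) = N *\<^sub>v krylov_vec N u j"
  by (simp_all add: krylov_vec_def)

lemma krylov_vec_carrier [simp]:
  "N \<in> carrier_mat n n \<Longrightarrow> u \<in> carrier_vec n \<Longrightarrow> krylov_vec N u j \<in> carrier_vec n"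
  by (induction j) (auto simp: krylov_vec_Suc)

lemma krylov_mat_carrier [simp]: "krylov_mat n N u \<in> carrier_mat n n"
  by (simp add: krylov_mat_def)

lemma col_krylov_mat:
  "N \<in> carrier_mat n n \<Longrightarrow> u \<in> carrier_vec n \<Longrightarrow> j < n \<Longrightarrow> col (krylov_mat n N u) j = krylov_vec N u j"
  by (intro eq_vecI) (simp_all add: krylov_mat_def carrier_vecD[OF krylov_vec_carrier])

text \<open>Away from the eigenvalues the adjugate is invertible and kills no nonzero vector. For each of the finitely
  many eigenvalues a nonzero row of the adjugate gives a nonzero polynomial in \<open>z\<close> when it is applied
  to \<open>(1, z, z\<^sup>2, \<dots>)\<close>; any \<open>z\<close> that is a root of none of them will do.\<close>

lemma exists_vector_not_killed_by_adj_mat: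
  fixes N :: "complex mat"
  assumes N: "N \<in> carrier_mat n n" and n: "n > 0"
    and adj: "\<And>x. adj_mat (x \<cdot>\<^sub>m 1\<^sub>m n - N) \<noteq> 0\<^sub>m n n"
  obtains u where "u \<in> carrier_vec n" "\<And>x. adj_mat (x \<cdot>\<^sub>m 1\<^sub>m n - N) *\<^sub>v u \<noteq> 0\<^sub>v n"
proof -
  let ?R = "\<lambda>x. x \<cdot>\<^sub>m 1\<^sub>m n - N"
  have R: "?R x \<in> carrier_mat n n" for x using N by (intro minus_carrier_mat)
  note aR = adj_mat(1)[OF R]
  have deg: "degree (char_poly N) = n" using degree_monic_char_poly[OF N] by blast
  then have \<chi>0: "char_poly N \<noteq> 0" using n by auto
  define \<Lambda> where "\<Lambda> = {x. poly (char_poly N) x = 0}"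
  have fin: "finite \<Lambda>" unfolding \<Lambda>_def using \<chi>0 by (rule poly_roots_finite)
  have "\<exists>i<n. \<exists>j<n. adj_mat (?R x) $$ (i, j) \<noteq> 0" for x
    using adj[of x] aR[of x] by (auto simp: mat_eq_iff)
  then obtain r s where rs: "\<And>x. r x < n" "\<And>x. s x < n"
    "\<And>x. adj_mat (?R x) $$ (r x, s x) \<noteq> 0" by metis
  define q where "q x = (\<Sum>j<n. monom (adj_mat (?R x) $$ (r x, j)) j)" for x
  have "coeff (q x) (s x) = adj_mat (?R x) $$ (r x, s x)" for x
    using rs(2)[of x] by (simp add: q_def coeff_sum)
  then have "q x \<noteq> 0" for x using rs(3)[of x] by (metis coeff_0)
  then have "(\<Prod>x\<in>\<Lambda>. q x) \<noteq> 0" using fin by simp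
  then have "finite {z. poly (\<Prod>x\<in>\<Lambda>. q x) z = 0}" by (rule poly_roots_finite)
  then obtain z where "poly (\<Prod>x\<in>\<Lambda>. q x) z \<noteq> 0"
    using ex_new_if_finite[OF infinite_UNIV_char_0[where 'a = complex]] by blast
  then have z: "poly (q x) z \<noteq> 0" if "x \<in> \<Lambda>" for x
    using that fin by (auto simp: poly_prod)
  define u where "u = vec n (\<lambda>j. z ^ j)"
  have u: "u \<in> carrier_vec n" by (simp add: u_def)
  have "adj_mat (?R x) *\<^sub>v u \<noteq> 0\<^sub>v n" for x
  proof
    assume *: "adj_mat (?R x) *\<^sub>v u = 0\<^sub>v n"
    show False
    proof (cases "x \<in> \<Lambda>")
      case True
      have "(adj_mat (?R x) *\<^sub>v u) $ r x = (\<Sum>j<n. adj_mat (?R x) $$ (r x, j) * z ^ j)"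
        using rs(1)[of x] carrier_matD[OF aR[of x]]
        by (simp add: u_def scalar_prod_def atLeast0LessThan)
      also have "\<dots> = poly (q x) z" by (simp add: q_def poly_sum poly_monom)
      finally show False using z[OF True] * rs(1)[of x] by simp
    next
      case False
      then have d: "det (?R x) \<noteq> 0" by (simp add: \<Lambda>_def poly_char_poly_eq_det[OF N])
      have "det (?R x) \<cdot>\<^sub>v u = (?R x * adj_mat (?R x)) *\<^sub>v u"
        using u unfolding adj_mat(2)[OF R] by (intro eq_vecI) (auto simp: smult_scalar_prod_distrib)
      also have "\<dots> = ?R x *\<^sub>v 0\<^sub>v n"
        using * assoc_mult_mat_vec[OF R aR u] by simp
      also have "\<dots> = 0\<^sub>v n"
        by (rule eq_vecI) (use N in \<open>simp_all add: scalar_prod_def\<close>)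
      finally have "det (?R x) * u $ 0 = 0"
        using n u by (metis index_smult_vec(1) index_zero_vec(1) carrier_vecD)
      then show False using d n by (simp add: u_def)
    qed
  qed
  then show ?thesis using that u by blast
qed

text \<open>Cancel common roots of \<open>p\<close> and \<open>q\<close>; as \<open>q\<close> has the larger degree, it keeps a root at which \<open>p\<close> does
  not vanish, and there every \<open>a\<^sub>i\<close> vanishes.\<close>

lemma common_root_of_quotients:
  fixes p q :: "complex poly" and g a :: "'i \<Rightarrow> complex poly"
  assumes "p \<noteq> 0" "degree p < degree q" "\<And>i. i \<in> I \<Longrightarrow> q * g i = p * a i"
  shows "\<exists>x. \<forall>i\<in>I. poly (a i) x = 0"
  using assms
proof (induction "degree p" arbitrary: p q rule: less_induct)
  case less
  from less.prems have "degree q \<noteq> 0" by simp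
  then obtain x where x: "poly q x = 0"
    using fundamental_theorem_of_algebra constant_degree by metis
  show ?case
  proof (cases "poly p x = 0")
    case False
    have "poly (a i) x = 0" if "i \<in> I" for i
      using arg_cong[OF less.prems(3)[OF that], of "\<lambda>r. poly r x"] x False by simp
    then show ?thesis by blast
  next
    case True
    with x obtain p' q' where pq: "p = [:- x, 1:] * p'" "q = [:- x, 1:] * q'"
      by (metis dvdE poly_eq_0_iff_dvd)
    have nz: "p' \<noteq> 0" "q' \<noteq> 0" using less.prems(1,2) pq by auto
    then have deg: "degree p = Suc (degree p')" "degree q = Suc (degree q')"
      by (simp_all add: pq degree_mult_eq del: mult_pCons_left)
    show ?thesis
    proof (rule less.hyps[of p' q'])
      fix i assume "i \<in> I"
      then have "[:- x, 1:] * (q' * g i) = [:- x, 1:] * (p' * a i)"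
        using less.prems(3) by (metis pq mult.assoc)
      then show "q' * g i = p' * a i" by (simp del: mult_pCons_left)
    qed (use deg nz less.prems in auto)
  qed
qed

text \<open>If \<open>p(N) u = 0\<close> with \<open>0 \<noteq> p\<close> of degree less than \<open>n\<close>, then \<open>(x - N) g(x) = p(x) u\<close> for a polynomial vector
  \<open>g\<close>. Multiplication by the adjugate gives \<open>\<chi> g = p a\<close> with \<open>a(x) = adj (x - N) u\<close>, where the characteristic
  polynomial \<open>\<chi>\<close> has larger degree than \<open>p\<close>; so \<open>a\<close> vanishes somewhere.\<close>

lemma cyclic_if_adj_mat_nonvanishing:
  fixes N :: "complex mat"
  assumes N: "N \<in> carrier_mat n n" and u: "u \<in> carrier_vec n"
    and adj: "\<And>x. adj_mat (x \<cdot>\<^sub>m 1\<^sub>m n - N) *\<^sub>v u \<noteq> 0\<^sub>v n"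
  shows "det (krylov_mat n N u) \<noteq> 0"
proof
  assume "det (krylov_mat n N u) = 0"
  then obtain c where c: "c \<in> carrier_vec n" "c \<noteq> 0\<^sub>v n" "krylov_mat n N u *\<^sub>v c = 0\<^sub>v n"
    using det_0_iff_vec_prod_zero_field[OF krylov_mat_carrier] by blast
  let ?e = "krylov_vec N u"
  let ?R = "\<lambda>x. x \<cdot>\<^sub>m 1\<^sub>m n - N"
  have R: "?R x \<in> carrier_mat n n" for x using N by (intro minus_carrier_mat)
  note aR = adj_mat(1)[OF R]
  have e: "?e j \<in> carrier_vec n" for j using N u by simp
  define p where "p = (\<Sum>j<n. monom (c $ j) j)"
  have coeff_p: "coeff p j = (if j < n then c $ j else 0)" for j
    by (auto simp: p_def coeff_sum)
  obtain j where "j < n" "c $ j \<noteq> 0" using c(1,2) by (auto simp: vec_eq_iff)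
  then have p0: "p \<noteq> 0" and n: "n > 0" using coeff_p[of j] by auto
  have degp: "degree p < n"
    using p0 coeff_p[of "degree p"] by (metis leading_coeff_0_iff)
  have deg: "degree (char_poly N) = n" using degree_monic_char_poly[OF N] by blast
  \<comment> \<open>The entries of \<open>h\<^sub>j = x\<^bsup>j-1\<^esup> u + x\<^bsup>j-2\<^esup> N u + \<dots> + N\<^bsup>j-1\<^esup> u\<close>, for which \<open>(x - N) h\<^sub>j = x\<^sup>j u - N\<^sup>j u\<close>.\<close>
  define h where "h = rec_nat (\<lambda>i. 0) (\<lambda>j hj i. pCons (?e j $ i) (hj i))"
  have h0: "h 0 i = 0" and hS: "h (Suc j) i = pCons (?e j $ i) (h j i)" for i j
    by (simp_all add: h_def)
  have Rmul: "(?R x *\<^sub>v v) $ i = x * v $ i - (N *\<^sub>v v) $ i" if "v \<in> carrier_vec n" "i < n" for x v i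
  proof -
    have "?R x *\<^sub>v v = x \<cdot>\<^sub>v v - N *\<^sub>v v"
      using that N by (subst minus_mult_distrib_mat_vec[of _ n n]) (auto intro!: eq_vecI)
    then show ?thesis using that N by simp
  qed
  have Nsum: "(N *\<^sub>v vec n f) $ i = (\<Sum>l<n. N $$ (i, l) * f l)" if "i < n" for f i
    using that N by (simp add: scalar_prod_def atLeast0LessThan)
  have tele: "x * poly (h j i) x - (\<Sum>l<n. N $$ (i, l) * poly (h j l) x) = x ^ j * u $ i - ?e j $ i"
    if "i < n" for x j i
  proof (induction j)
    case (Suc j)
    have "?e (Suc j) $ i = (\<Sum>l<n. N $$ (i, l) * ?e j $ l)"
      using that N e[of j] by (simp add: krylov_vec_Suc scalar_prod_def atLeast0LessThan)
    moreover have "(\<Sum>l<n. N $$ (i, l) * poly (h (Suc j) l) x) =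
        (\<Sum>l<n. N $$ (i, l) * ?e j $ l) + x * (\<Sum>l<n. N $$ (i, l) * poly (h j l) x)"
      by (simp add: hS algebra_simps sum.distrib sum_distrib_left)
    moreover have "x * (\<Sum>l<n. N $$ (i, l) * poly (h j l) x) =
        x * (x * poly (h j i) x) - x * (x ^ j * u $ i - ?e j $ i)"
      unfolding Suc[symmetric] by (simp add: algebra_simps)
    ultimately show ?case by (simp add: hS algebra_simps)
  qed (simp add: h0)
  define g where "g i = (\<Sum>j<n. smult (c $ j) (h j i))" for i
  have dep: "(\<Sum>j<n. c $ j * ?e j $ i) = 0" if "i < n" for i
  proof -
    have "(krylov_mat n N u *\<^sub>v c) $ i = (\<Sum>j<n. ?e j $ i * c $ j)"
      using that c(1) by (simp add: krylov_mat_def scalar_prod_def atLeast0LessThan)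
    then show ?thesis using c(3) that by (simp add: mult.commute)
  qed
  have Rg: "?R x *\<^sub>v vec n (\<lambda>i. poly (g i) x) = poly p x \<cdot>\<^sub>v u" for x
  proof (rule eq_vecI)
    fix i assume "i < dim_vec (poly p x \<cdot>\<^sub>v u)"
    then have i: "i < n" using u by simp
    have "(\<Sum>l<n. N $$ (i, l) * poly (g l) x) = (\<Sum>j<n. c $ j * (\<Sum>l<n. N $$ (i, l) * poly (h j l) x))"
      by (simp add: g_def poly_sum sum_distrib_left, subst sum.swap) (simp add: ac_simps)
    then have "(?R x *\<^sub>v vec n (\<lambda>i. poly (g i) x)) $ i =
      (\<Sum>j<n. c $ j * (x * poly (h j i) x - (\<Sum>l<n. N $$ (i, l) * poly (h j l) x)))"
      using i by (simp add: Rmul Nsum g_def poly_sum sum_distrib_left sum_subtractf algebra_simps)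
    also have "\<dots> = (\<Sum>j<n. c $ j * x ^ j) * u $ i - (\<Sum>j<n. c $ j * ?e j $ i)"
      by (simp add: tele[OF i] algebra_simps sum_subtractf sum_distrib_left)
    also have "\<dots> = poly p x * u $ i"
      by (simp add: dep[OF i] p_def poly_sum poly_monom)
    finally show "(?R x *\<^sub>v vec n (\<lambda>i. poly (g i) x)) $ i = (poly p x \<cdot>\<^sub>v u) $ i"
      using i u by simp
  qed (use N u in auto)
  obtain A where A: "\<And>i j x. i < n \<Longrightarrow> j < n \<Longrightarrow> poly (A i j) x = adj_mat (- N + x \<cdot>\<^sub>m 1\<^sub>m n) $$ (i, j)"
    using adj_pencil_polynomial[of "- N" n "1\<^sub>m n"] N by auto
  have Rx: "- N + x \<cdot>\<^sub>m 1\<^sub>m n = ?R x" for x using N by (intro eq_matI) auto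
  define a where "a i = (\<Sum>j<n. smult (u $ j) (A i j))" for i
  have a: "poly (a i) x = (adj_mat (?R x) *\<^sub>v u) $ i" if "i < n" for i x
    using that carrier_matD[OF aR[of x]] u
    by (simp add: a_def poly_sum A Rx scalar_prod_def atLeast0LessThan mult.commute)
  have "char_poly N * g i = p * a i" if i: "i < n" for i
  proof -
    have "poly (char_poly N * g i) x = poly (p * a i) x" for x
    proof -
      let ?v = "vec n (\<lambda>i. poly (g i) x)"
      have "det (?R x) \<cdot>\<^sub>v ?v = (adj_mat (?R x) * ?R x) *\<^sub>v ?v"
        unfolding adj_mat(3)[OF R] by (intro eq_vecI) (auto simp: smult_scalar_prod_distrib)
      also have "\<dots> = adj_mat (?R x) *\<^sub>v (poly p x \<cdot>\<^sub>v u)"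
        using assoc_mult_mat_vec[OF aR R, of ?v x x] by (simp add: Rg)
      also have "\<dots> = poly p x \<cdot>\<^sub>v (adj_mat (?R x) *\<^sub>v u)"
        using mult_mat_vec[OF aR u] .
      finally have "(det (?R x) \<cdot>\<^sub>v ?v) $ i = (poly p x \<cdot>\<^sub>v (adj_mat (?R x) *\<^sub>v u)) $ i" by simp
      then show ?thesis
        using i carrier_matD[OF aR[of x]] by (simp add: a poly_char_poly_eq_det[OF N])
    qed
    then show ?thesis using poly_eq_poly_eq_iff by blast
  qed
  then obtain x where "\<forall>i\<in>{..<n}. poly (a i) x = 0"
    using common_root_of_quotients[of p "char_poly N" "{..<n}" g a] p0 deg degp by auto
  then have "adj_mat (?R x) *\<^sub>v u = 0\<^sub>v n"
    using a carrier_matD[OF aR[of x]] by (intro eq_vecI) auto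
  then show False using adj by blast
qed

section \<open>Commutators with a cyclic matrix\<close>

text \<open>Write \<open>R(t) = 1 + t N\<close>. The trace of \<open>B R(t) adj R(t) = det R(t) B\<close> gives
  \<open>tr (B adj R(t)) + t tr (B N adj R(t)) = det R(t) tr B\<close>. At \<open>t = 0\<close> the hypothesis says
  \<open>tr B = 0\<close>, and then cancelling \<open>t\<close> passes the hypothesis from \<open>B\<close> to \<open>B N\<close>.\<close>

lemma mtrace_mult_pow_vanishes:
  fixes N B :: "complex mat"
  assumes N: "N \<in> carrier_mat n n" and B: "B \<in> carrier_mat n n"
    and tr: "\<And>t. mtrace n (B * adj_mat (1\<^sub>m n + t \<cdot>\<^sub>m N)) = 0"
  shows "mtrace n (B * N ^\<^sub>m k) = 0"
proof -
  let ?R = "\<lambda>t. 1\<^sub>m n + t \<cdot>\<^sub>m N"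
  have R: "?R t \<in> carrier_mat n n" for t using N by simp
  note aR = adj_mat(1)[OF R]
  have adj1: "adj_mat (1\<^sub>m n :: complex mat) = 1\<^sub>m n"
    using adj_mat(2)[of "1\<^sub>m n :: complex mat" n] adj_mat(1)[of "1\<^sub>m n :: complex mat" n]
    by (auto simp: mat_eq_iff)
  have step: "mtrace n B = 0 \<and> (\<forall>t. mtrace n ((B * N) * adj_mat (?R t)) = 0)"
    if B: "B \<in> carrier_mat n n" and tr: "\<And>t. mtrace n (B * adj_mat (?R t)) = 0" for B
  proof
    have "?R 0 = 1\<^sub>m n" using N by (intro eq_matI) auto
    then show B0: "mtrace n B = 0" using tr[of 0] B by (simp add: adj1)
    have ne: "mtrace n ((B * N) * adj_mat (?R t)) = 0" if "t \<noteq> 0" for t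
    proof -
      have "?R t * adj_mat (?R t) = adj_mat (?R t) + t \<cdot>\<^sub>m (N * adj_mat (?R t))"
        using N aR[of t] add_mult_distrib_mat[of "1\<^sub>m n" n n "t \<cdot>\<^sub>m N" "adj_mat (?R t)" n]
          mult_smult_assoc_mat[OF N aR] by simp
      then have "B * (adj_mat (?R t) + t \<cdot>\<^sub>m (N * adj_mat (?R t))) = B * (det (?R t) \<cdot>\<^sub>m 1\<^sub>m n)"
        using adj_mat(2)[OF R] by simp
      moreover have "B * (adj_mat (?R t) + t \<cdot>\<^sub>m (N * adj_mat (?R t))) =
          B * adj_mat (?R t) + t \<cdot>\<^sub>m ((B * N) * adj_mat (?R t))"
        using B N aR[of t] mult_add_distrib_mat[OF B aR, of "t \<cdot>\<^sub>m (N * adj_mat (?R t))" t]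
          mult_smult_distrib[OF B, of "N * adj_mat (?R t)" n t] by simp
      moreover have "B * (det (?R t) \<cdot>\<^sub>m 1\<^sub>m n) = det (?R t) \<cdot>\<^sub>m B"
        using B mult_smult_distrib[OF B one_carrier_mat] by simp
      ultimately have "mtrace n (B * adj_mat (?R t) + t \<cdot>\<^sub>m ((B * N) * adj_mat (?R t))) =
          det (?R t) * mtrace n B"
        using B by (simp add: mtrace_smult)
      moreover have "mtrace n (B * adj_mat (?R t) + t \<cdot>\<^sub>m ((B * N) * adj_mat (?R t))) =
          mtrace n (B * adj_mat (?R t)) + t * mtrace n ((B * N) * adj_mat (?R t))"
      proof -
        have "B * adj_mat (?R t) \<in> carrier_mat n n" "(B * N) * adj_mat (?R t) \<in> carrier_mat n n"
          using B N aR[of t] by (meson mult_carrier_mat)+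
        then show ?thesis by (simp add: mtrace_add mtrace_smult)
      qed
      ultimately show ?thesis using that tr[of t] B0 by simp
    qed
    obtain p where p: "\<And>i j t. i < n \<Longrightarrow> j < n \<Longrightarrow> poly (p i j) t = adj_mat (?R t) $$ (i, j)"
      using adj_pencil_polynomial[of "1\<^sub>m n" n N] N by auto
    define q where "q = (\<Sum>i<n. \<Sum>j<n. smult ((B * N) $$ (i, j)) (p j i))"
    have q: "poly q t = mtrace n ((B * N) * adj_mat (?R t))" for t
    proof -
      have "B * N \<in> carrier_mat n n" using B N by simp
      from mtrace_mult[OF this aR] show ?thesis by (simp add: q_def poly_sum p)
    qed
    have "q = 0"
      by (rule poly_eq_0_if_vanishes_generically[of "[:0, 1:]"]) (use ne q in auto)
    then show "\<forall>t. mtrace n ((B * N) * adj_mat (?R t)) = 0" using q by (metis poly_0)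
  qed
  have "B * N ^\<^sub>m k \<in> carrier_mat n n \<and> (\<forall>t. mtrace n ((B * N ^\<^sub>m k) * adj_mat (?R t)) = 0)"
  proof (induction k)
    case 0
    then show ?case using B N tr by simp
  next
    case (Suc k)
    have "B * N ^\<^sub>m Suc k = (B * N ^\<^sub>m k) * N"
      using B N by (simp add: assoc_mult_mat[of _ n n _ n _ n])
    then show ?case using step[of "B * N ^\<^sub>m k"] Suc B N by auto
  qed
  then show ?thesis using step by blast
qed

lemma mat_eq_if_mult_krylov_vecs_eq:
  fixes A :: "complex mat"
  assumes N: "N \<in> carrier_mat n n" and u: "u \<in> carrier_vec n"
    and A: "A \<in> carrier_mat n n" and B: "B \<in> carrier_mat n n"
    and det: "det (krylov_mat n N u) \<noteq> 0"
    and eq: "\<And>j. j < n \<Longrightarrow> A *\<^sub>v krylov_vec N u j = B *\<^sub>v krylov_vec N u j"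
  shows "A = B"
proof -
  let ?E = "krylov_mat n N u"
  have E: "?E \<in> carrier_mat n n" by simp
  have "A * ?E = B * ?E"
  proof (rule mat_col_eqI)
    fix j assume "j < dim_col (B * ?E)"
    then have "j < n" by (simp add: krylov_mat_def)
    then show "col (A * ?E) j = col (B * ?E) j"
      using eq[of j] N u by (simp add: col_mult2[OF A E] col_mult2[OF B E] col_krylov_mat)
  qed (use A B in auto)
  then have "A * (?E * adj_mat ?E) = B * (?E * adj_mat ?E)"
    using assoc_mult_mat[OF A E adj_mat(1)[OF E]] assoc_mult_mat[OF B E adj_mat(1)[OF E]] by simp
  then have "det ?E \<cdot>\<^sub>m A = det ?E \<cdot>\<^sub>m B"
    using A B by (simp add: adj_mat(2)[OF E] mult_smult_distrib[OF _ one_carrier_mat])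
  then show ?thesis by (rule smult_mat_cancel[OF _ det A B])
qed

lemma pow_mult_krylov_vec:
  fixes N :: "complex mat"
  assumes N: "N \<in> carrier_mat n n" and u: "u \<in> carrier_vec n"
  shows "N ^\<^sub>m k *\<^sub>v krylov_vec N u j = krylov_vec N u (k + j)"
proof (induction k arbitrary: j)
  case 0
  then show ?case using krylov_vec_carrier[OF N u, of j] N by simp
next
  case (Suc k)
  have "N ^\<^sub>m Suc k *\<^sub>v krylov_vec N u j = N ^\<^sub>m k *\<^sub>v krylov_vec N u (Suc j)"
    using assoc_mult_mat_vec[OF pow_carrier_mat[OF N] N krylov_vec_carrier[OF N u]]
    by (simp add: krylov_vec_Suc)
  then show ?case using Suc by simp
qed

text \<open>The image of \<open>H \<mapsto> H N - N H\<close> is the orthogonal complement, for the trace form, of the powers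
  of \<open>N\<close>. The solution with \<open>H u = 0\<close> is determined on the basis \<open>u, N u, \<dots>, N\<^bsup>n-1\<^esup> u\<close> by recursion, and
  the equation can only fail at the last basis vector. There the defect \<open>w\<close> satisfies
  \<open>\<phi>(N\<^sup>k w) = 0\<close> for all \<open>k\<close>, where \<open>\<phi>\<close> is the last coordinate, and this forces \<open>w = 0\<close>.\<close>

lemma commutator_solvable:
  fixes N B :: "complex mat"
  assumes N: "N \<in> carrier_mat n n" and B: "B \<in> carrier_mat n n" and u: "u \<in> carrier_vec n"
    and det: "det (krylov_mat n N u) \<noteq> 0"
    and tr: "\<And>k. mtrace n (B * N ^\<^sub>m k) = 0"
  obtains H where "H \<in> carrier_mat n n" "H * N - N * H = B"
proof (cases "n = 0")
  case True
  then show ?thesis using that[of "0\<^sub>m 0 0"] N B by (auto simp: mat_eq_iff)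
next
  case False
  let ?e = "krylov_vec N u" and ?E = "krylov_mat n N u"
  have E: "?E \<in> carrier_mat n n" by simp
  have e: "?e j \<in> carrier_vec n" for j using N u by simp
  obtain F where F: "F \<in> carrier_mat n n" and EF: "?E * F = 1\<^sub>m n" and FE: "F * ?E = 1\<^sub>m n"
  proof
    let ?F = "inverse (det ?E) \<cdot>\<^sub>m adj_mat ?E"
    show "?F \<in> carrier_mat n n" using adj_mat(1)[OF E] by simp
    show "?E * ?F = 1\<^sub>m n" "?F * ?E = 1\<^sub>m n"
      using det adj_mat[OF E] by (auto simp: mult_smult_distrib[OF E] mult_smult_assoc_mat[OF _ E] intro!: eq_matI)
  qed
  \<comment> \<open>\<open>H u = 0\<close> may be prescribed; then \<open>H N = N H + B\<close> forces the values \<open>g\<^sub>j\<close> of \<open>H\<close> at \<open>N\<^sup>j u\<close>.\<close>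
  define g where "g = rec_nat (0\<^sub>v n) (\<lambda>j gj. B *\<^sub>v ?e j + N *\<^sub>v gj)"
  have g0: "g 0 = 0\<^sub>v n" and gS: "g (Suc j) = B *\<^sub>v ?e j + N *\<^sub>v g j" for j
    by (simp_all add: g_def)
  have g: "g j \<in> carrier_vec n" for j
    by (induction j) (use B N e in \<open>auto simp: g0 gS\<close>)
  define G where "G = mat n n (\<lambda>(i, j). g j $ i)"
  define H where "H = G * F"
  have G: "G \<in> carrier_mat n n" by (simp add: G_def)
  have H: "H \<in> carrier_mat n n" using G F by (simp add: H_def)
  have HE: "H * ?E = G"
    using G F E by (simp add: H_def assoc_mult_mat[of _ n n _ n _ n] FE)
  then have He: "H *\<^sub>v ?e j = g j" if "j < n" for j
  proof -
    have "H *\<^sub>v ?e j = col (H * ?E) j" using that N u by (simp add: col_mult2[OF H E] col_krylov_mat)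
    also have "\<dots> = g j" unfolding HE using that carrier_vecD[OF g[of j]]
      by (intro eq_vecI) (simp_all add: G_def)
    finally show ?thesis .
  qed
  define D where "D = H * N - N * H - B"
  have D: "D \<in> carrier_mat n n" unfolding D_def by (rule minus_carrier_mat[OF B])
  have HN: "H * N \<in> carrier_mat n n" and NH: "N * H \<in> carrier_mat n n" using H N by auto
  have Dv: "D *\<^sub>v v = H *\<^sub>v (N *\<^sub>v v) - N *\<^sub>v (H *\<^sub>v v) - B *\<^sub>v v" if "v \<in> carrier_vec n" for v
    unfolding D_def
    using that minus_mult_distrib_mat_vec[OF _ B that, of "H * N - N * H"]
      minus_mult_distrib_mat_vec[OF HN NH that] assoc_mult_mat_vec[OF H N that]
      assoc_mult_mat_vec[OF N H that] HN NH by (simp add: minus_carrier_mat)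
  have De: "D *\<^sub>v ?e j = 0\<^sub>v n" if "Suc j < n" for j
  proof -
    have "D *\<^sub>v ?e j = g (Suc j) - N *\<^sub>v g j - B *\<^sub>v ?e j"
      using He[of j] He[of "Suc j"] that by (simp add: Dv[OF e] krylov_vec_Suc[symmetric])
    then show ?thesis using B N e[of j] g[of j] by (auto simp: gS intro!: eq_vecI)
  qed
  define w where "w = D *\<^sub>v ?e (n - 1)"
  have w: "w \<in> carrier_vec n" using D e by (simp add: w_def)
  define c where "c = F *\<^sub>v w"
  have c: "c \<in> carrier_vec n" using F w by (simp add: c_def)
  have Ec: "?E *\<^sub>v c = w"
    using assoc_mult_mat_vec[OF E F w] w by (simp add: c_def EF)
  have Nk: "N ^\<^sub>m k \<in> carrier_mat n n" for k using N by simp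
  have trD: "mtrace n (D * N ^\<^sub>m k) = 0" for k
  proof -
    have comm: "N * N ^\<^sub>m k = N ^\<^sub>m k * N"
      by (induction k) (use N in \<open>auto simp: assoc_mult_mat[of _ n n _ n _ n, symmetric]\<close>)
    have "D * N ^\<^sub>m k = H * N * N ^\<^sub>m k - N * H * N ^\<^sub>m k - B * N ^\<^sub>m k"
      unfolding D_def
      using minus_mult_distrib_mat[OF _ B Nk, of "H * N - N * H" k] HN NH
        minus_mult_distrib_mat[OF HN NH Nk, of k] by (simp add: minus_carrier_mat)
    moreover have "H * N * N ^\<^sub>m k \<in> carrier_mat n n" "N * H * N ^\<^sub>m k \<in> carrier_mat n n"
      "B * N ^\<^sub>m k \<in> carrier_mat n n" using HN NH Nk[of k] B by (meson mult_carrier_mat)+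
    moreover have "mtrace n (N * H * N ^\<^sub>m k) = mtrace n (H * N * N ^\<^sub>m k)"
    proof -
      have "mtrace n (N * H * N ^\<^sub>m k) = mtrace n (N * (H * N ^\<^sub>m k))"
        using assoc_mult_mat[OF N H Nk] by simp
      also have "\<dots> = mtrace n (H * N ^\<^sub>m k * N)"
        by (rule mtrace_mult_commute) (use N H Nk in auto)
      also have "H * N ^\<^sub>m k * N = H * N * N ^\<^sub>m k"
        using assoc_mult_mat[OF H Nk N] assoc_mult_mat[OF H N Nk] comm by simp
      finally show ?thesis .
    qed
    ultimately show ?thesis using tr[of k] by (simp add: mtrace_minus minus_carrier_mat)
  qed
  have FNE: "(F *\<^sub>v (N ^\<^sub>m k *\<^sub>v ?e j)) $ (n - 1) = (if k + j = n - 1 then 1 else 0)" if "k + j < n" for k j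
  proof -
    have "F *\<^sub>v (N ^\<^sub>m k *\<^sub>v ?e j) = col (F * ?E) (k + j)"
      using that N u by (simp add: pow_mult_krylov_vec col_mult2[OF F E] col_krylov_mat)
    then show ?thesis using that False by (simp add: FE)
  qed
  have FNw: "(F *\<^sub>v (N ^\<^sub>m k *\<^sub>v w)) $ (n - 1) = 0" for k
  proof -
    have FN: "F * N ^\<^sub>m k \<in> carrier_mat n n" using F Nk[of k] by simp
    have DE: "D * ?E \<in> carrier_mat n n" using D E by simp
    have DF: "D = D * ?E * F"
      using D E F assoc_mult_mat[OF D E F] by (simp add: EF)
    have cols: "(D * ?E) $$ (i, j) = (if j = n - 1 then w $ i else 0)" if "i < n" "j < n" for i j
    proof -
      have "(D * ?E) $$ (i, j) = (D *\<^sub>v ?e j) $ i"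
        using that col_mult2[OF D E that(2)] N u DE by (metis col_krylov_mat index_col carrier_matD)
      then show ?thesis using De[of j] that by (auto simp: w_def)
    qed
    have "0 = mtrace n ((D * ?E) * (F * N ^\<^sub>m k))"
      using trD[of k] DF assoc_mult_mat[OF DE F Nk] by simp
    also have "\<dots> = (\<Sum>i<n. \<Sum>j<n. (D * ?E) $$ (i, j) * (F * N ^\<^sub>m k) $$ (j, i))"
      by (rule mtrace_mult[OF DE FN])
    also have "\<dots> = (\<Sum>i<n. \<Sum>j<n. if j = n - 1 then w $ i * (F * N ^\<^sub>m k) $$ (n - 1, i) else 0)"
      by (intro sum.cong refl) (simp add: cols)
    also have "\<dots> = (\<Sum>i<n. w $ i * (F * N ^\<^sub>m k) $$ (n - 1, i))"
      using False by simp
    also have "\<dots> = ((F * N ^\<^sub>m k) *\<^sub>v w) $ (n - 1)"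
      using FN w False carrier_matD[OF FN]
      by (simp add: scalar_prod_def atLeast0LessThan mult.commute del: index_mult_mat)
    finally show ?thesis using assoc_mult_mat_vec[OF F Nk w] by simp
  qed
  have FNw_sum: "(F *\<^sub>v (N ^\<^sub>m k *\<^sub>v w)) $ (n - 1) = (\<Sum>j<n. (F *\<^sub>v (N ^\<^sub>m k *\<^sub>v ?e j)) $ (n - 1) * c $ j)" for k
  proof -
    let ?M = "F * N ^\<^sub>m k * ?E"
    have FN: "F * N ^\<^sub>m k \<in> carrier_mat n n" using F Nk[of k] by simp
    have M: "?M \<in> carrier_mat n n" using FN E by simp
    have "F *\<^sub>v (N ^\<^sub>m k *\<^sub>v w) = ?M *\<^sub>v c"
      using assoc_mult_mat_vec[OF FN E c] assoc_mult_mat_vec[OF F Nk w] by (simp add: Ec)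
    moreover have "?M $$ (n - 1, j) = (F *\<^sub>v (N ^\<^sub>m k *\<^sub>v ?e j)) $ (n - 1)" if "j < n" for j
    proof -
      have "col ?M j = F *\<^sub>v (N ^\<^sub>m k *\<^sub>v ?e j)"
        using that N u assoc_mult_mat_vec[OF F Nk e] by (simp add: col_mult2[OF FN E] col_krylov_mat)
      moreover have "n - 1 < dim_row ?M" "j < dim_col ?M" using that False carrier_matD[OF M] by simp_all
      ultimately show ?thesis by (metis index_col)
    qed
    ultimately show ?thesis
      using M c False carrier_matD[OF M]
      by (simp add: scalar_prod_def atLeast0LessThan del: index_mult_mat)
  qed
  have "c $ (n - 1 - k) = 0" if "k < n" for k
    using that
  proof (induction k rule: less_induct)
    case (less k)
    have "(F *\<^sub>v (N ^\<^sub>m k *\<^sub>v ?e j)) $ (n - 1) * c $ j = (if j = n - 1 - k then c $ j else 0)" if "j < n" for j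
    proof (cases "k + j < n")
      case True
      then show ?thesis using FNE[OF True] less.prems by (auto split: if_splits)
    next
      case False
      then have "c $ j = 0" using less.IH[of "n - 1 - j"] that less.prems by simp
      then show ?thesis by auto
    qed
    then have "(\<Sum>j<n. (F *\<^sub>v (N ^\<^sub>m k *\<^sub>v ?e j)) $ (n - 1) * c $ j) = c $ (n - 1 - k)"
      using less.prems by simp
    then show ?case using FNw[of k] FNw_sum[of k] by simp
  qed
  then have "c $ j = 0" if "j < n" for j
    using that by (metis Suc_pred' diff_diff_cancel diff_less_Suc gr_implies_not0 less_Suc_eq_le neq0_conv)
  then have "c = 0\<^sub>v n" using c by (intro eq_vecI) auto
  then have "w = 0\<^sub>v n" using Ec by (auto intro!: eq_vecI simp: krylov_mat_def)
  then have "D *\<^sub>v ?e j = 0\<^sub>m n n *\<^sub>v ?e j" if "j < n" for j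
    using De[of j] that e[of j] by (cases "Suc j < n") (auto simp: w_def not_less_eq less_Suc_eq intro!: eq_vecI
        dest: le_antisym)
  then have D0: "D = 0\<^sub>m n n"
    by (intro mat_eq_if_mult_krylov_vecs_eq[OF N u D _ det]) auto
  have "H * N - N * H = B"
  proof (rule eq_matI)
    fix i j assume "i < dim_row B" "j < dim_col B"
    then have ij: "i < n" "j < n" using B by auto
    have "D $$ (i, j) = 0" using ij by (simp add: D0)
    moreover have "D $$ (i, j) = (H * N - N * H) $$ (i, j) - B $$ (i, j)"
      using ij B by (simp add: D_def)
    ultimately show "(H * N - N * H) $$ (i, j) = B $$ (i, j)" by simp
  qed (use B HN NH in auto)
  then show ?thesis using that H by blast
qed

text \<open>The numbers \<open>(N\<^sup>i u) \<bullet> S (N\<^sup>j u)\<close> depend only on \<open>i + j\<close> by the intertwining property, so they are symmetric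
  in \<open>i\<close> and \<open>j\<close>; they are also antisymmetric.\<close>

lemma skew_intertwiner_zero:
  fixes N S :: "complex mat"
  assumes N: "N \<in> carrier_mat n n" and S: "S \<in> carrier_mat n n" and u: "u \<in> carrier_vec n"
    and det: "det (krylov_mat n N u) \<noteq> 0"
    and skew: "transpose_mat S = - S" and inter: "S * N = transpose_mat N * S"
  shows "S = 0\<^sub>m n n"
proof -
  let ?e = "krylov_vec N u" and ?E = "krylov_mat n N u"
  have E: "?E \<in> carrier_mat n n" by simp
  have e: "?e j \<in> carrier_vec n" for j using N u by simp
  define s where "s i j = ?e i \<bullet> (S *\<^sub>v ?e j)" for i j
  have shift: "s (Suc i) j = s i (Suc j)" for i j
  proof -
    have "s (Suc i) j = (N *\<^sub>v ?e i) \<bullet> (S *\<^sub>v ?e j)" by (simp add: s_def krylov_vec_Suc)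
    also have "\<dots> = ?e i \<bullet> (transpose_mat N *\<^sub>v (S *\<^sub>v ?e j))"
      using transpose_vec_mult_scalar[of "transpose_mat N" n n "S *\<^sub>v ?e j" "?e i"] N S e[of i] e[of j]
      by simp
    also have "transpose_mat N *\<^sub>v (S *\<^sub>v ?e j) = S *\<^sub>v (N *\<^sub>v ?e j)"
      using assoc_mult_mat_vec[OF _ S e, of "transpose_mat N" n] assoc_mult_mat_vec[OF S N e] N inter
      by simp
    finally show ?thesis by (simp add: s_def krylov_vec_Suc)
  qed
  have s0: "s i j = s 0 (i + j)" for i j
    by (induction i arbitrary: j) (simp_all add: shift)
  have sk: "s i j = - s j i" for i j
  proof -
    have "s i j = (transpose_mat S *\<^sub>v ?e i) \<bullet> ?e j"
      using S e by (metis s_def transpose_vec_mult_scalar)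
    also have "\<dots> = - ((S *\<^sub>v ?e i) \<bullet> ?e j)"
      using S e[of i] e[of j] by (simp add: skew uminus_mult_mat_vec uminus_scalar_prod)
    also have "(S *\<^sub>v ?e i) \<bullet> ?e j = s j i"
      unfolding s_def using S e by (metis comm_scalar_prod mult_mat_vec_carrier)
    finally show ?thesis .
  qed
  have "s i j = 0" for i j
    using sk[of i j] s0[of i j] s0[of j i] by (simp add: add.commute)
  then have "transpose_mat ?E * (S * ?E) = 0\<^sub>m n n"
    using S N u carrier_matD[OF E]
    by (intro eq_matI) (simp_all add: s_def col_krylov_mat col_mult2[OF S E])
  moreover have Et: "transpose_mat ?E \<in> carrier_mat n n" by simp
  have "det ?E \<cdot>\<^sub>m (S * ?E) = (adj_mat (transpose_mat ?E) * transpose_mat ?E) * (S * ?E)"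
    using S E mult_smult_assoc_mat[OF one_carrier_mat, of "S * ?E" n n "det ?E"]
    by (simp add: adj_mat(3)[OF Et] det_transpose[OF E])
  ultimately have "det ?E \<cdot>\<^sub>m (S * ?E) = det ?E \<cdot>\<^sub>m (0\<^sub>m n n)"
    using assoc_mult_mat[OF adj_mat(1)[OF Et] Et, of "S * ?E" n] S E adj_mat(1)[OF Et] by simp
  then have SE: "S * ?E = 0\<^sub>m n n"
    by (rule smult_mat_cancel[OF _ det mult_carrier_mat[OF S E] zero_carrier_mat])
  show ?thesis
  proof (rule mat_eq_if_mult_krylov_vecs_eq[OF N u S _ det])
    fix j assume j: "j < n"
    have "S *\<^sub>v ?e j = col (S * ?E) j" using j N u by (simp add: col_mult2[OF S E] col_krylov_mat)
    then show "S *\<^sub>v ?e j = 0\<^sub>m n n *\<^sub>v ?e j" using j e[of j] by (auto simp: SE intro!: eq_vecI)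
  qed simp
qed

section \<open>Symmetric pencils and nets\<close>

lemma nonsingular_inverse:
  fixes P :: "complex mat"
  assumes P: "P \<in> carrier_mat n n" and det: "det P \<noteq> 0"
  obtains R where "R \<in> carrier_mat n n" "P * R = 1\<^sub>m n" "R * P = 1\<^sub>m n"
proof
  let ?R = "inverse (det P) \<cdot>\<^sub>m adj_mat P"
  show "?R \<in> carrier_mat n n" using adj_mat(1)[OF P] by simp
  show "P * ?R = 1\<^sub>m n" "?R * P = 1\<^sub>m n"
    using det adj_mat[OF P] by (auto simp: mult_smult_distrib[OF P] mult_smult_assoc_mat[OF _ P] intro!: eq_matI)
qed

text \<open>A pencil with an invertible member \<open>P\<close> in which every nonzero member has corank at most one, expressed
  by the adjugate.\<close>

locale symmetric_pencil =
  fixes n :: nat and P Q :: "complex mat"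
  assumes n: "n > 0"
    and P: "P \<in> carrier_mat n n" and Q: "Q \<in> carrier_mat n n"
    and symP: "transpose_mat P = P" and symQ: "transpose_mat Q = Q"
    and detP: "det P \<noteq> 0"
    and adj: "\<And>x y. (x, y) \<noteq> (0, 0) \<Longrightarrow> adj_mat (x \<cdot>\<^sub>m P + y \<cdot>\<^sub>m Q) \<noteq> 0\<^sub>m n n"
begin

definition R where "R = (SOME R. R \<in> carrier_mat n n \<and> P * R = 1\<^sub>m n \<and> R * P = 1\<^sub>m n)"

lemma R: "R \<in> carrier_mat n n" and PR: "P * R = 1\<^sub>m n" and RP: "R * P = 1\<^sub>m n"
  unfolding R_def by (rule someI2_ex, use nonsingular_inverse[OF P detP] in blast, blast)+

lemmas assoc = assoc_mult_mat[of _ n n _ n _ n]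

lemma PR_cancel: "A \<in> carrier_mat n n \<Longrightarrow> P * (R * A) = A"
  and RP_cancel: "A \<in> carrier_mat n n \<Longrightarrow> R * (P * A) = A"
  using P R by (simp_all add: assoc[symmetric] PR RP)

lemma R_symmetric: "transpose_mat R = R"
proof -
  have "transpose_mat R * P = 1\<^sub>m n"
    using arg_cong[OF PR, of transpose_mat] P R by (simp add: transpose_mult symP)
  then have "transpose_mat R * P * R = R" using R by simp
  then show ?thesis using P R by (simp add: assoc PR)
qed

lemma RQ: "R * Q \<in> carrier_mat n n"
  using R Q by simp

lemma det_R: "det R \<noteq> 0"
  using det_mult[OF R P] by (auto simp: RP)

lemma adj_mat_R_cancel: "A \<in> carrier_mat n n \<Longrightarrow> A * adj_mat R * R = det R \<cdot>\<^sub>m A"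
  using R adj_mat(1)[OF R] by (simp add: assoc adj_mat(3)[OF R] mult_smult_distrib[OF _ one_carrier_mat])

text \<open>Here \<open>x - P\<^sup>-\<^sup>1 Q = P\<^sup>-\<^sup>1 (x P - Q)\<close>, and adjugates are multiplicative.\<close>

lemma ex_cyclic_vector: "\<exists>u\<in>carrier_vec n. det (krylov_mat n (R * Q) u) \<noteq> 0"
proof -
  have "adj_mat (x \<cdot>\<^sub>m 1\<^sub>m n - R * Q) \<noteq> 0\<^sub>m n n" for x
  proof
    let ?A = "x \<cdot>\<^sub>m P + (- 1) \<cdot>\<^sub>m Q"
    have A: "?A \<in> carrier_mat n n" using P Q by simp
    assume *: "adj_mat (x \<cdot>\<^sub>m 1\<^sub>m n - R * Q) = 0\<^sub>m n n"
    have "R * ?A = x \<cdot>\<^sub>m (R * P) + (- 1) \<cdot>\<^sub>m (R * Q)"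
      using mult_add_distrib_mat[OF R, of "x \<cdot>\<^sub>m P" n "(- 1) \<cdot>\<^sub>m Q"] mult_smult_distrib[OF R P]
        mult_smult_distrib[OF R Q] P Q by simp
    also have "\<dots> = x \<cdot>\<^sub>m 1\<^sub>m n - R * Q" using RQ by (intro eq_matI) (simp_all add: RP)
    finally have "adj_mat ?A * adj_mat R = 0\<^sub>m n n" using adj_mat_mult[OF R A] * by simp
    then have "det R \<cdot>\<^sub>m adj_mat ?A = 0\<^sub>m n n * R"
      using adj_mat_R_cancel[OF adj_mat(1)[OF A]] by simp
    also have "\<dots> = det R \<cdot>\<^sub>m 0\<^sub>m n n" using R by simp
    finally have "adj_mat ?A = 0\<^sub>m n n"
      by (rule smult_mat_cancel[OF _ det_R adj_mat(1)[OF A] zero_carrier_mat])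
    then show False using adj[of x "-1"] by simp
  qed
  then obtain u where "u \<in> carrier_vec n" "\<And>x. adj_mat (x \<cdot>\<^sub>m 1\<^sub>m n - R * Q) *\<^sub>v u \<noteq> 0\<^sub>v n"
    using exists_vector_not_killed_by_adj_mat[OF RQ n] by blast
  then show ?thesis using cyclic_if_adj_mat_nonvanishing[OF RQ] by blast
qed

text \<open>The skew matrix \<open>S = P K P\<close> satisfies \<open>S N = P K Q\<close> and \<open>N\<^sup>T S = Q K P\<close> for \<open>N = P\<^sup>-\<^sup>1 Q\<close>.\<close>

lemma skew_solution_unique:
  assumes K: "K \<in> carrier_mat n n" and skew: "transpose_mat K = - K" and eq: "P * K * Q = Q * K * P"
  shows "K = 0\<^sub>m n n"
proof -
  obtain u where u: "u \<in> carrier_vec n" "det (krylov_mat n (R * Q) u) \<noteq> 0"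
    using ex_cyclic_vector by blast
  let ?S = "P * K * P"
  have S: "?S \<in> carrier_mat n n" using P K by simp
  have "transpose_mat ?S = P * (transpose_mat K * P)"
    using P K by (simp add: transpose_mult[of _ n n _ n] symP)
  also have "\<dots> = - ?S"
    using P K by (simp add: skew assoc)
  finally have skewS: "transpose_mat ?S = - ?S" .
  have "?S * (R * Q) = P * K * Q"
    using P K Q R by (simp add: assoc PR_cancel)
  also have "\<dots> = transpose_mat (R * Q) * ?S"
    using P K Q R by (simp add: eq transpose_mult[of _ n n _ n] symQ R_symmetric assoc RP_cancel)
  finally have "?S = 0\<^sub>m n n"
    by (rule skew_intertwiner_zero[OF RQ S u skewS])
  then have "R * (?S * R) = 0\<^sub>m n n" using R by simp
  then show ?thesis using P K R by (simp add: assoc PR RP_cancel)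
qed

text \<open>A solution \<open>H\<close> of \<open>H N - N H = P\<^sup>-\<^sup>1 B\<close> with \<open>N = P\<^sup>-\<^sup>1 Q\<close> gives the solution \<open>K = H P\<^sup>-\<^sup>1\<close> of \<open>P K Q - Q K P = B\<close>.
  Transposing shows that \<open>- K\<^sup>T\<close> is another one, and the mean of the two is skew.\<close>

lemma ex_skew_solution:
  assumes B: "B \<in> carrier_mat n n" and symB: "transpose_mat B = B"
    and tr: "\<And>x y. mtrace n (B * adj_mat (x \<cdot>\<^sub>m P + y \<cdot>\<^sub>m Q)) = 0"
  shows "\<exists>K\<in>carrier_mat n n. transpose_mat K = - K \<and> P * K * Q - Q * K * P = B"
proof -
  obtain u where u: "u \<in> carrier_vec n" "det (krylov_mat n (R * Q) u) \<noteq> 0"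
    using ex_cyclic_vector by blast
  have RB: "R * B \<in> carrier_mat n n" using R B by simp
  have "mtrace n (R * B * adj_mat (1\<^sub>m n + t \<cdot>\<^sub>m (R * Q))) = 0" for t
  proof -
    let ?A = "1 \<cdot>\<^sub>m P + t \<cdot>\<^sub>m Q"
    have A: "?A \<in> carrier_mat n n" using P Q by simp
    have "R * ?A = 1 \<cdot>\<^sub>m (R * P) + t \<cdot>\<^sub>m (R * Q)"
      using mult_add_distrib_mat[OF R, of "1 \<cdot>\<^sub>m P" n "t \<cdot>\<^sub>m Q"] mult_smult_distrib[OF R P]
        mult_smult_distrib[OF R Q] P Q by simp
    also have "\<dots> = 1\<^sub>m n + t \<cdot>\<^sub>m (R * Q)" using R Q by (intro eq_matI) (auto simp: RP)
    finally have "adj_mat (1\<^sub>m n + t \<cdot>\<^sub>m (R * Q)) = adj_mat ?A * adj_mat R"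
      using adj_mat_mult[OF R A] by simp
    then have "mtrace n (R * B * adj_mat (1\<^sub>m n + t \<cdot>\<^sub>m (R * Q))) = mtrace n (R * (B * (adj_mat ?A * adj_mat R)))"
      using R B adj_mat(1)[OF A] adj_mat(1)[OF R] by (simp add: assoc)
    also have "\<dots> = mtrace n (B * (adj_mat ?A * adj_mat R) * R)"
      by (rule mtrace_mult_commute[OF R]) (use R B adj_mat(1)[OF A] adj_mat(1)[OF R] in auto)
    also have "B * (adj_mat ?A * adj_mat R) * R = (B * adj_mat ?A) * adj_mat R * R"
      using R B adj_mat(1)[OF A] adj_mat(1)[OF R] by (simp add: assoc)
    also have "\<dots> = det R \<cdot>\<^sub>m (B * adj_mat ?A)"
      by (rule adj_mat_R_cancel) (use B adj_mat(1)[OF A] in auto)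
    also have "mtrace n \<dots> = 0"
      using B adj_mat(1)[OF A] tr[of 1 t] by (simp add: mtrace_smult)
    finally show ?thesis .
  qed
  then have "mtrace n (R * B * (R * Q) ^\<^sub>m k) = 0" for k
    by (rule mtrace_mult_pow_vanishes[OF RQ RB])
  then obtain H where H: "H \<in> carrier_mat n n" "H * (R * Q) - R * Q * H = R * B"
    using commutator_solvable[OF RQ RB u] by blast
  define K where "K = H * R"
  have K: "K \<in> carrier_mat n n" using H R by (simp add: K_def)
  have PKQ: "P * K * Q - Q * K * P = B"
  proof -
    have "P * K * Q = P * (H * (R * Q))" using P Q R H by (simp add: K_def assoc)
    moreover have "Q * K * P = P * (R * Q * H)" using P Q R H by (simp add: K_def assoc RP PR_cancel)
    ultimately have "P * K * Q - Q * K * P = P * (H * (R * Q) - R * Q * H)"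
      using mult_minus_distrib_mat[OF P, of "H * (R * Q)" n "R * Q * H"] H(1) R Q by simp
    then show ?thesis using H(2) B by (simp add: PR_cancel)
  qed
  let ?K = "(1 / 2) \<cdot>\<^sub>m (K - transpose_mat K)"
  have Kt: "transpose_mat K \<in> carrier_mat n n" using K by simp
  have PKtQ: "P * transpose_mat K * Q - Q * transpose_mat K * P = - B"
  proof -
    have "P * transpose_mat K * Q = transpose_mat (Q * K * P)"
      "Q * transpose_mat K * P = transpose_mat (P * K * Q)"
      using P Q K by (simp_all add: transpose_mult[of _ n n _ n] symP symQ assoc)
    moreover obtain U V where UV: "P * K * Q = U" "Q * K * P = V"
      "U \<in> carrier_mat n n" "V \<in> carrier_mat n n" using P Q K by simp
    moreover have "transpose_mat V - transpose_mat U = - B"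
    proof (rule eq_matI)
      fix i j assume "i < dim_row (- B)" "j < dim_col (- B)"
      then have ij: "i < n" "j < n" using B by auto
      then have "B $$ (i, j) = B $$ (j, i)" using arg_cong[OF symB, of "\<lambda>M. M $$ (j, i)"] B by simp
      also have "\<dots> = U $$ (j, i) - V $$ (j, i)"
        using arg_cong[OF PKQ, of "\<lambda>M. M $$ (j, i)"] UV ij by simp
      finally show "(transpose_mat V - transpose_mat U) $$ (i, j) = (- B) $$ (i, j)"
        using ij B UV by simp
    qed (use B UV in auto)
    ultimately show ?thesis by simp
  qed
  have lin: "A * ?K * C = (1 / 2) \<cdot>\<^sub>m (A * K * C - A * transpose_mat K * C)"
    if A: "A \<in> carrier_mat n n" and C: "C \<in> carrier_mat n n" for A C
  proof -
    have D: "K - transpose_mat K \<in> carrier_mat n n" by (rule minus_carrier_mat[OF Kt])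
    have "A * ?K * C = (1 / 2) \<cdot>\<^sub>m (A * (K - transpose_mat K) * C)"
      using mult_smult_distrib[OF A D] mult_smult_assoc_mat[OF mult_carrier_mat[OF A D] C] by simp
    then show ?thesis
      using mult_minus_distrib_mat[OF A K Kt] minus_mult_distrib_mat[OF _ _ C, of "A * K" n "A * transpose_mat K"]
        A K Kt by simp
  qed
  show ?thesis
  proof (intro bexI conjI)
    show "?K \<in> carrier_mat n n" using minus_carrier_mat[OF Kt, of K] by simp
    show "transpose_mat ?K = - ?K" using K by (intro eq_matI) (auto simp: field_simps)
    have e: "(P * K * Q - Q * K * P) $$ (i, j) = B $$ (i, j)"
      "(P * transpose_mat K * Q - Q * transpose_mat K * P) $$ (i, j) = - B $$ (i, j)" if "i < n" "j < n" for i j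
      using that B by (simp_all add: PKQ PKtQ)
    show "P * ?K * Q - Q * ?K * P = B"
      unfolding lin[OF P Q] lin[OF Q P]
    proof (rule eq_matI)
      fix i j assume "i < dim_row B" "j < dim_col B"
      then have ij: "i < n" "j < n" using B by auto
      have c: "P * K * Q \<in> carrier_mat n n" "Q * K * P \<in> carrier_mat n n"
        "P * transpose_mat K * Q \<in> carrier_mat n n" "Q * transpose_mat K * P \<in> carrier_mat n n"
        using P Q K Kt by (meson mult_carrier_mat)+
      have half: "(1 / 2) * (u - u') - (1 / 2) * (v - v') = b"
        if "u - v = b" "u' - v' = - b" for u v u' v' b :: complex
      proof -
        have "h * (u - u') - h * (v - v') = h * ((u - v) - (u' - v'))" for h
          by (simp add: algebra_simps)
        from this[of "1 / 2"] show ?thesis unfolding that by simp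
      qed
      have minus: "(X - Y) $$ (i, j) = X $$ (i, j) - Y $$ (i, j)"
        if "Y \<in> carrier_mat n n" for X Y :: "complex mat"
        using that ij by simp
      have smult: "(a \<cdot>\<^sub>m X) $$ (i, j) = a * X $$ (i, j)"
        if "X \<in> carrier_mat n n" for X :: "complex mat" and a
        using that ij by simp
      note cm = minus_carrier_mat[OF c(3), of "P * K * Q"] minus_carrier_mat[OF c(4), of "Q * K * P"]
      have "((1 / 2) \<cdot>\<^sub>m (P * K * Q - P * transpose_mat K * Q) -
          (1 / 2) \<cdot>\<^sub>m (Q * K * P - Q * transpose_mat K * P)) $$ (i, j) =
          (1 / 2) * ((P * K * Q) $$ (i, j) - (P * transpose_mat K * Q) $$ (i, j)) -
          (1 / 2) * ((Q * K * P) $$ (i, j) - (Q * transpose_mat K * P) $$ (i, j))"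
        by (simp only: minus[OF smult_carrier_mat[OF cm(2)]] smult[OF cm(1)] smult[OF cm(2)]
            minus[OF c(3)] minus[OF c(4)])
      also have "\<dots> = B $$ (i, j)"
        by (rule half) (use e[OF ij] minus[OF c(2)] minus[OF c(4)] in \<open>simp_all only:\<close>)
      finally show "((1 / 2) \<cdot>\<^sub>m (P * K * Q - P * transpose_mat K * Q) -
          (1 / 2) \<cdot>\<^sub>m (Q * K * P - Q * transpose_mat K * P)) $$ (i, j) = B $$ (i, j)" .
    qed (use P Q K B in auto)
  qed
qed

end

lemma mat_eq_if_minus_entries_zero:
  fixes A B :: "'a::ring_1 mat"
  assumes "A \<in> carrier_mat n m" "B \<in> carrier_mat n m"
    and "\<And>i j. i < n \<Longrightarrow> j < m \<Longrightarrow> (A - B) $$ (i, j) = 0"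
  shows "A = B"
proof (rule eq_matI)
  fix i j assume "i < dim_row B" "j < dim_col B"
  then show "A $$ (i, j) = B $$ (i, j)" using assms(1,2) assms(3)[of i j] by auto
qed (use assms in auto)

lemma index_sandwich:
  fixes A K C :: "complex mat"
  assumes "A \<in> carrier_mat n n" "K \<in> carrier_mat n n" "C \<in> carrier_mat n n" "i < n" "j < n"
  shows "(A * K * C) $$ (i, j) = (\<Sum>a<n. \<Sum>b<n. A $$ (i, a) * C $$ (b, j) * K $$ (a, b))"
proof -
  have AK: "A * K \<in> carrier_mat n n" using assms by simp
  have "(A * K * C) $$ (i, j) = (\<Sum>b<n. (\<Sum>a<n. A $$ (i, a) * K $$ (a, b)) * C $$ (b, j))"
    unfolding index_mult_mat_sum[OF AK assms(3,4,5)]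
    using index_mult_mat_sum[OF assms(1,2,4)] by (intro sum.cong refl) simp
  also have "\<dots> = (\<Sum>b<n. \<Sum>a<n. A $$ (i, a) * C $$ (b, j) * K $$ (a, b))"
    by (simp add: sum_distrib_left sum_distrib_right ac_simps)
  finally show ?thesis by (subst sum.swap)
qed

text \<open>For \<open>Q\<^sub>t = Y + t Z\<close> let \<open>K\<^sub>t\<close> be the skew solution of \<open>P K\<^sub>t Q\<^sub>t - Q\<^sub>t K\<^sub>t P = B\<close>. The left-hand side is affine
  linear in \<open>t\<close> for fixed \<open>K\<close>, and it is injective in \<open>K\<close> for \<open>Q = Q\<^sub>t\<close> and, at \<open>t = \<infinity>\<close>, for \<open>Q = Z\<close>. So some
  \<open>K\<^sub>t\<close> is zero.\<close>

lemma symmetric_trace_form_zero: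
  fixes P Y Z B :: "complex mat"
  assumes n: "n > 0"
    and P: "P \<in> carrier_mat n n" and Y: "Y \<in> carrier_mat n n" and Z: "Z \<in> carrier_mat n n"
    and sym: "transpose_mat P = P" "transpose_mat Y = Y" "transpose_mat Z = Z"
    and detP: "det P \<noteq> 0"
    and adj: "\<And>x y z. (x, y, z) \<noteq> (0, 0, 0) \<Longrightarrow> adj_mat (x \<cdot>\<^sub>m P + y \<cdot>\<^sub>m Y + z \<cdot>\<^sub>m Z) \<noteq> 0\<^sub>m n n"
    and B: "B \<in> carrier_mat n n" and symB: "transpose_mat B = B"
    and tr: "\<And>x y z. mtrace n (B * adj_mat (x \<cdot>\<^sub>m P + y \<cdot>\<^sub>m Y + z \<cdot>\<^sub>m Z)) = 0"
  shows "B = 0\<^sub>m n n"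
proof -
  have pencil: "symmetric_pencil n P (a \<cdot>\<^sub>m Y + b \<cdot>\<^sub>m Z)" if "(a, b) \<noteq> (0, 0)" for a b
  proof
    show "a \<cdot>\<^sub>m Y + b \<cdot>\<^sub>m Z \<in> carrier_mat n n" using Y Z by simp
    have "Y $$ (j, i) = Y $$ (i, j)" "Z $$ (j, i) = Z $$ (i, j)" if "i < n" "j < n" for i j
      using arg_cong[OF sym(2), of "\<lambda>M. M $$ (i, j)"] arg_cong[OF sym(3), of "\<lambda>M. M $$ (i, j)"] that Y Z
      by simp_all
    then show "transpose_mat (a \<cdot>\<^sub>m Y + b \<cdot>\<^sub>m Z) = a \<cdot>\<^sub>m Y + b \<cdot>\<^sub>m Z"
      using Y Z by (intro eq_matI) simp_all
    fix x y :: complex assume xy: "(x, y) \<noteq> (0, 0)"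
    have "x \<cdot>\<^sub>m P + y \<cdot>\<^sub>m (a \<cdot>\<^sub>m Y + b \<cdot>\<^sub>m Z) = x \<cdot>\<^sub>m P + (y * a) \<cdot>\<^sub>m Y + (y * b) \<cdot>\<^sub>m Z"
      using P Y Z by (intro eq_matI) (simp_all add: algebra_simps)
    then show "adj_mat (x \<cdot>\<^sub>m P + y \<cdot>\<^sub>m (a \<cdot>\<^sub>m Y + b \<cdot>\<^sub>m Z)) \<noteq> 0\<^sub>m n n"
      using adj[of x "y * a" "y * b"] xy that by auto
  qed (use n P sym detP in auto)
  define Q where "Q t = 1 \<cdot>\<^sub>m Y + t \<cdot>\<^sub>m Z" for t
  have Q: "Q t \<in> carrier_mat n n" for t using Y Z by (simp add: Q_def)
  define T where "T C K = P * K * C - C * K * P" for C K :: "complex mat"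
  have T: "T C K $$ (i, j) = (\<Sum>a<n. \<Sum>b<n. (P $$ (i, a) * C $$ (b, j) - C $$ (i, a) * P $$ (b, j)) * K $$ (a, b))"
    if "C \<in> carrier_mat n n" "K \<in> carrier_mat n n" "i < n" "j < n" for C K i j
  proof -
    have "P * K * C \<in> carrier_mat n n" "C * K * P \<in> carrier_mat n n" using that P by simp_all
    then have "T C K $$ (i, j) = (P * K * C) $$ (i, j) - (C * K * P) $$ (i, j)"
      using that by (simp add: T_def del: index_mult_mat)
    then show ?thesis
      unfolding index_sandwich[OF P that(2,1,3,4)] index_sandwich[OF that(1,2) P that(3,4)]
      by (simp add: left_diff_distrib sum_subtractf)
  qed
  have Tc: "T C K \<in> carrier_mat n n" if "C \<in> carrier_mat n n" "K \<in> carrier_mat n n" for C K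
    unfolding T_def by (rule minus_carrier_mat) (use that P in simp)
  have inj: "K = 0\<^sub>m n n"
    if "K \<in> carrier_mat n n" "transpose_mat K = - K" "(a, b) \<noteq> (0, 0)" "C = a \<cdot>\<^sub>m Y + b \<cdot>\<^sub>m Z"
      and z: "\<And>i j. i < n \<Longrightarrow> j < n \<Longrightarrow> T C K $$ (i, j) = 0" for K a b C
  proof -
    interpret symmetric_pencil n P C using pencil that by simp
    have "P * K * C \<in> carrier_mat n n" "C * K * P \<in> carrier_mat n n" using that P Q by simp_all
    then have "P * K * C = C * K * P"
      by (rule mat_eq_if_minus_entries_zero) (use z in \<open>simp add: T_def\<close>)
    then show ?thesis using skew_solution_unique that by blast
  qed
  have "\<exists>K\<in>carrier_mat n n. transpose_mat K = - K \<and> T (Q t) K = B" for t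
  proof -
    interpret symmetric_pencil n P "Q t" unfolding Q_def by (rule pencil) simp
    have "mtrace n (B * adj_mat (x \<cdot>\<^sub>m P + y \<cdot>\<^sub>m Q t)) = 0" for x y
    proof -
      have "x \<cdot>\<^sub>m P + y \<cdot>\<^sub>m Q t = x \<cdot>\<^sub>m P + y \<cdot>\<^sub>m Y + (y * t) \<cdot>\<^sub>m Z"
        using P Y Z by (intro eq_matI) (simp_all add: Q_def algebra_simps)
      then show ?thesis using tr by simp
    qed
    from ex_skew_solution[OF B symB this] show ?thesis unfolding T_def .
  qed
  then obtain K where K: "\<And>t. K t \<in> carrier_mat n n" "\<And>t. transpose_mat (K t) = - K t"
    "\<And>t. T (Q t) (K t) = B" by metis
  define comb where "comb c S = mat n n (\<lambda>ij. \<Sum>t\<in>S. c t * K t $$ ij)" for c :: "complex \<Rightarrow> complex" and S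
  have comb: "comb c S \<in> carrier_mat n n" for c S by (simp add: comb_def)
  have comb_skew: "transpose_mat (comb c S) = - comb c S" for c S
  proof (rule eq_matI)
    fix i j assume "i < dim_row (- comb c S)" "j < dim_col (- comb c S)"
    then have ij: "i < n" "j < n" by (simp_all add: comb_def)
    have "K t $$ (j, i) = - K t $$ (i, j)" for t
      using arg_cong[OF K(2), of "\<lambda>M. M $$ (i, j)" t] K(1)[of t] ij by simp
    then show "transpose_mat (comb c S) $$ (i, j) = (- comb c S) $$ (i, j)"
      using ij by (simp add: comb_def sum_negf)
  qed (simp_all add: comb_def)
  have Tcomb: "T C (comb c S) $$ (i, j) = (\<Sum>t\<in>S. c t * T C (K t) $$ (i, j))"
    if "C \<in> carrier_mat n n" "i < n" "j < n" for C c S i j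
  proof -
    let ?w = "\<lambda>a b. P $$ (i, a) * C $$ (b, j) - C $$ (i, a) * P $$ (b, j)"
    have "T C (comb c S) $$ (i, j) = (\<Sum>a<n. \<Sum>b<n. \<Sum>t\<in>S. c t * (?w a b * K t $$ (a, b)))"
      unfolding T[OF that(1) comb that(2,3)]
      by (intro sum.cong refl) (simp add: comb_def sum_distrib_left mult.left_commute)
    also have "\<dots> = (\<Sum>a<n. \<Sum>t\<in>S. \<Sum>b<n. c t * (?w a b * K t $$ (a, b)))"
      by (intro sum.cong refl sum.swap)
    also have "\<dots> = (\<Sum>t\<in>S. \<Sum>a<n. \<Sum>b<n. c t * (?w a b * K t $$ (a, b)))"
      by (rule sum.swap)
    also have "\<dots> = (\<Sum>t\<in>S. c t * T C (K t) $$ (i, j))"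
      by (simp add: T[OF that(1) K(1) that(2,3)] sum_distrib_left)
    finally show ?thesis .
  qed
  have TQ: "T (Q \<tau>) (K t) $$ (i, j) = B $$ (i, j) + (\<tau> - t) * T Z (K t) $$ (i, j)" if "i < n" "j < n" for \<tau> t i j
  proof -
    have "T (Q \<tau>) (K t) $$ (i, j) = T (Q t) (K t) $$ (i, j) + (\<tau> - t) * T Z (K t) $$ (i, j)"
    proof -
      have "Q \<tau> $$ (a, b) = Q t $$ (a, b) + (\<tau> - t) * Z $$ (a, b)" if "a < n" "b < n" for a b
        using that Y Z by (simp add: Q_def algebra_simps)
      then have "T (Q \<tau>) (K t) $$ (i, j) = (\<Sum>a<n. \<Sum>b<n. (P $$ (i, a) * (Q t $$ (b, j) + (\<tau> - t) * Z $$ (b, j))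
          - (Q t $$ (i, a) + (\<tau> - t) * Z $$ (i, a)) * P $$ (b, j)) * K t $$ (a, b))"
        unfolding T[OF Q K(1) that] using that by (intro sum.cong refl) simp
      also have "\<dots> = T (Q t) (K t) $$ (i, j) + (\<tau> - t) * T Z (K t) $$ (i, j)"
        unfolding T[OF Q K(1) that] T[OF Z K(1) that] sum_distrib_left sum.distrib[symmetric]
        by (intro sum.cong refl) (simp add: algebra_simps)
      finally show ?thesis .
    qed
    then show ?thesis by (simp add: K(3))
  qed
  have comb0: "comb c S = 0\<^sub>m n n"
    if "\<And>ij. ij \<in> {..<n} \<times> {..<n} \<Longrightarrow> (\<Sum>t\<in>S. c t * K t $$ ij) = 0" for c S
    using that by (intro eq_matI) (auto simp: comb_def)
  have comb0D: "\<forall>ij\<in>{..<n} \<times> {..<n}. (\<Sum>t\<in>S. c t * K t $$ ij) = 0" if "comb c S = 0\<^sub>m n n" for c S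
    using that by (auto simp: comb_def mat_eq_iff)
  have T0: "T C (0\<^sub>m n n) $$ (i, j) = 0" if "C \<in> carrier_mat n n" "i < n" "j < n" for C i j
    using that by (simp add: T)
  have "\<exists>t. \<forall>ij\<in>{..<n} \<times> {..<n}. K t $$ ij = 0"
  proof (rule pencil_section_vanishes)
    fix S :: "complex set" and c
    assume S: "finite S" and rel: "\<And>ij. ij \<in> {..<n} \<times> {..<n} \<Longrightarrow> (\<Sum>t\<in>S. c t * K t $$ ij) = 0"
    note c0 = comb0[OF rel]
    {
      assume sum: "(\<Sum>t\<in>S. c t) = 0"
      have "T Z (comb (\<lambda>t. c t * t) S) $$ (i, j) = 0" if "i < n" "j < n" for i j
      proof -
        have "t * T Z (K t) $$ (i, j) = B $$ (i, j) - T (Q 0) (K t) $$ (i, j)" for t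
          using TQ[OF that, of 0 t] by simp
        then have "T Z (comb (\<lambda>t. c t * t) S) $$ (i, j) = (\<Sum>t\<in>S. c t) * B $$ (i, j) - T (Q 0) (comb c S) $$ (i, j)"
          by (simp add: Tcomb[OF Z that] Tcomb[OF Q that] mult.assoc sum_distrib_right sum_subtractf right_diff_distrib)
        then show ?thesis by (simp add: sum c0 T0[OF Q that])
      qed
      then have "comb (\<lambda>t. c t * t) S = 0\<^sub>m n n"
        using Y Z by (intro inj[OF comb comb_skew, of 0 1 Z]) (auto intro!: eq_matI)
      then show "\<forall>ij\<in>{..<n} \<times> {..<n}. (\<Sum>t\<in>S. c t * t * K t $$ ij) = 0"
        by (rule comb0D)
    next
      fix \<tau> assume \<tau>: "\<tau> \<notin> S" and sum: "(\<Sum>t\<in>S. c t / (\<tau> - t)) = 0"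
      have "T (Q \<tau>) (comb (\<lambda>t. c t / (\<tau> - t)) S) $$ (i, j) = 0" if "i < n" "j < n" for i j
      proof -
        have "T (Q \<tau>) (comb (\<lambda>t. c t / (\<tau> - t)) S) $$ (i, j) =
            (\<Sum>t\<in>S. c t / (\<tau> - t) * B $$ (i, j) + c t * T Z (K t) $$ (i, j))"
          unfolding Tcomb[OF Q that] TQ[OF that]
          by (intro sum.cong refl) (use \<tau> in \<open>auto simp: distrib_left\<close>)
        also have "\<dots> = (\<Sum>t\<in>S. c t / (\<tau> - t)) * B $$ (i, j) + T Z (comb c S) $$ (i, j)"
          by (simp add: Tcomb[OF Z that] sum.distrib sum_distrib_right)
        finally show ?thesis by (simp add: sum c0 T0[OF Z that])
      qed
      then have "comb (\<lambda>t. c t / (\<tau> - t)) S = 0\<^sub>m n n"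
        by (intro inj[OF comb comb_skew, of 1 \<tau> "Q \<tau>"]) (auto simp: Q_def)
      then show "\<forall>ij\<in>{..<n} \<times> {..<n}. (\<Sum>t\<in>S. c t / (\<tau> - t) * K t $$ ij) = 0"
        by (rule comb0D)
    }
  qed simp
  then obtain t where "\<forall>ij\<in>{..<n} \<times> {..<n}. K t $$ ij = 0" ..
  then have "K t = 0\<^sub>m n n" using K(1)[of t] by (intro eq_matI) auto
  then show ?thesis using K(3)[of t] T0[OF Q, of _ _ t] B by (intro eq_matI) auto
qed

section \<open>Evaluation of polynomials and the Chow matrix\<close>

definition eval_monom :: "('x \<Rightarrow>\<^sub>0 nat) \<Rightarrow> ('x \<Rightarrow> complex) \<Rightarrow> complex" where
  "eval_monom m f = (\<Prod>v\<in>Poly_Mapping.keys m. f v ^ Poly_Mapping.lookup m v)"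

lemma eval_monom_superset:
  assumes "finite V" "Poly_Mapping.keys m \<subseteq> V"
  shows "eval_monom m f = (\<Prod>v\<in>V. f v ^ Poly_Mapping.lookup m v)"
  unfolding eval_monom_def
  using assms by (intro prod.mono_neutral_left) (auto simp: in_keys_iff)

lemma eval_monom_zero [simp]: "eval_monom 0 f = 1"
  by (simp add: eval_monom_def)

lemma eval_monom_single [simp]: "eval_monom (Poly_Mapping.single v k) f = f v ^ k"
  by (cases "k = 0") (simp_all add: eval_monom_def)

lemma eval_monom_add: "eval_monom (m + m') f = eval_monom m f * eval_monom m' f"
proof -
  let ?V = "Poly_Mapping.keys m \<union> Poly_Mapping.keys m'"
  have V: "finite ?V" "Poly_Mapping.keys (m + m') \<subseteq> ?V"
    "Poly_Mapping.keys m \<subseteq> ?V" "Poly_Mapping.keys m' \<subseteq> ?V"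
    using keys_add[of m m'] by auto
  show ?thesis
    unfolding V(2-4)[THEN eval_monom_superset[OF V(1)]]
    by (simp add: lookup_add power_add prod.distrib)
qed

lemma eval_poly_superset:
  assumes "finite S" "Poly_Mapping.keys p \<subseteq> S"
  shows "Defs.eval_poly p f = (\<Sum>m\<in>S. Poly_Mapping.lookup p m * eval_monom m f)"
  unfolding Defs.eval_poly_def eval_monom_def
  using assms by (intro sum.mono_neutral_left) (auto simp: in_keys_iff)

lemma eval_poly_single [simp]:
  "Defs.eval_poly (Poly_Mapping.single m c) f = c * eval_monom m f"
  by (subst eval_poly_superset[of "{m}"]) auto

lemma eval_poly_zero [simp]: "Defs.eval_poly 0 f = 0"
  by (simp add: Defs.eval_poly_def)

lemma eval_poly_add: "Defs.eval_poly (p + q) f = Defs.eval_poly p f + Defs.eval_poly q f"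
proof -
  let ?S = "Poly_Mapping.keys p \<union> Poly_Mapping.keys q"
  have S: "finite ?S" "Poly_Mapping.keys (p + q) \<subseteq> ?S"
    "Poly_Mapping.keys p \<subseteq> ?S" "Poly_Mapping.keys q \<subseteq> ?S"
    using keys_add[of p q] by auto
  show ?thesis
    unfolding S(2-4)[THEN eval_poly_superset[OF S(1)]]
    by (simp add: lookup_add distrib_right sum.distrib)
qed

lemma eval_poly_sum: "Defs.eval_poly (\<Sum>i\<in>I. p i) f = (\<Sum>i\<in>I. Defs.eval_poly (p i) f)"
  by (induction I rule: infinite_finite_induct) (simp_all add: eval_poly_add)

lemma sum_single_lookup:
  fixes p :: "'x \<Rightarrow>\<^sub>0 'a::comm_monoid_add"
  shows "(\<Sum>m\<in>Poly_Mapping.keys p. Poly_Mapping.single m (Poly_Mapping.lookup p m)) = p"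
  by (rule poly_mapping_eqI)
    (auto simp: lookup_sum lookup_single when_def sum.delta in_keys_iff)

lemma eval_poly_mult: "Defs.eval_poly (p * q) f = Defs.eval_poly p f * Defs.eval_poly q f"
proof -
  let ?s = "\<lambda>p m. Poly_Mapping.single m (Poly_Mapping.lookup p m)"
  have "Defs.eval_poly (p * q) f =
      Defs.eval_poly ((\<Sum>m\<in>Poly_Mapping.keys p. ?s p m) * (\<Sum>m\<in>Poly_Mapping.keys q. ?s q m)) f"
    by (simp add: sum_single_lookup)
  also have "\<dots> = Defs.eval_poly (\<Sum>m\<in>Poly_Mapping.keys p. ?s p m) f * Defs.eval_poly (\<Sum>m\<in>Poly_Mapping.keys q. ?s q m) f"
    by (simp add: sum_product mult_single eval_poly_sum eval_monom_add ac_simps)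
  finally show ?thesis by (simp add: sum_single_lookup)
qed

lemma eval_poly_one [simp]: "Defs.eval_poly 1 f = 1"
  by (simp add: single_one[symmetric] del: single_one)

lemma eval_poly_hom: "comm_ring_hom (\<lambda>p :: ('x \<Rightarrow>\<^sub>0 nat) \<Rightarrow>\<^sub>0 complex. Defs.eval_poly p f)"
  by unfold_locales (simp_all add: eval_poly_add eval_poly_mult)

lemma eval_poly_uminus: "Defs.eval_poly (- p) f = - Defs.eval_poly p f"
  using eval_poly_add[of p "- p" f] by (simp add: eq_neg_iff_add_eq_0 add.commute)

definition ternary_monom :: "nat \<times> nat \<times> nat \<Rightarrow> (nat \<Rightarrow>\<^sub>0 nat)" where
  "ternary_monom = (\<lambda>(a, b, c). Poly_Mapping.single 0 a + Poly_Mapping.single 1 b + Poly_Mapping.single 2 c)"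

lemma inj_ternary_monom: "inj ternary_monom"
proof (rule injI)
  fix x y assume "ternary_monom x = ternary_monom y"
  then have "Poly_Mapping.lookup (ternary_monom x) k = Poly_Mapping.lookup (ternary_monom y) k" for k by simp
  from this[of 0] this[of 1] this[of 2] show "x = y"
    by (cases x; cases y) (simp add: ternary_monom_def lookup_add lookup_single)
qed

lemma set_monos3: "set (monos3 d) = {(a, b, c). a + b + c = d}"
proof (rule Set.set_eqI)
  fix m :: "nat \<times> nat \<times> nat"
  obtain a b c where m: "m = (a, b, c)" by (cases m)
  have "m \<in> set (monos3 d) \<longleftrightarrow> a < Suc d \<and> b < Suc (d - a) \<and> c = d - a - b"
    by (auto simp: m monos3_def simp del: upt_Suc intro!: bexI[of _ a] rev_image_eqI[of b])
  then show "m \<in> set (monos3 d) \<longleftrightarrow> m \<in> {(a, b, c). a + b + c = d}"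
    by (auto simp: m)
qed

lemma distinct_concat_map:
  assumes "distinct xs" "\<And>x. x \<in> set xs \<Longrightarrow> distinct (f x)"
    and "\<And>x y. x \<noteq> y \<Longrightarrow> set (f x) \<inter> set (f y) = {}"
  shows "distinct (concat (map f xs))"
  using assms by (induction xs) fastforce+

lemma distinct_monos3: "distinct (monos3 d)"
  unfolding monos3_def
  by (rule distinct_concat_map) (auto simp: distinct_map inj_on_def simp del: upt_Suc)

text \<open>Homogeneity has to be tracked because the Chow matrix records only the coefficients of degree \<open>n - 1\<close>;
  these determine the entries of the adjugate as functions only if there are no others.\<close>

definition ternary_form :: "nat \<Rightarrow> cpoly \<Rightarrow> bool" where
  "ternary_form d p \<longleftrightarrow> Poly_Mapping.keys p \<subseteq> ternary_monom ` set (monos3 d)"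

lemma ternary_form_zero: "ternary_form d 0"
  by (simp add: ternary_form_def)

lemma ternary_form_one: "ternary_form 0 1"
  by (auto simp: ternary_form_def set_monos3 ternary_monom_def image_iff)

lemma ternary_form_add: "ternary_form d p \<Longrightarrow> ternary_form d q \<Longrightarrow> ternary_form d (p + q)"
  unfolding ternary_form_def using keys_add[of p q] by blast

lemma ternary_form_sum: "(\<And>i. i \<in> I \<Longrightarrow> ternary_form d (p i)) \<Longrightarrow> ternary_form d (\<Sum>i\<in>I. p i)"
  by (induction I rule: infinite_finite_induct) (auto intro: ternary_form_add ternary_form_zero)

lemma ternary_form_uminus: "ternary_form d p \<Longrightarrow> ternary_form d (- p)"
  by (simp add: ternary_form_def)

lemma ternary_form_mult:
  assumes "ternary_form d p" "ternary_form e q"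
  shows "ternary_form (d + e) (p * q)"
proof -
  have "\<exists>k\<in>set (monos3 (d + e)). ternary_monom i + ternary_monom j = ternary_monom k"
    if "i \<in> set (monos3 d)" "j \<in> set (monos3 e)" for i j
  proof -
    obtain a b c a' b' c' where ij: "i = (a, b, c)" "j = (a', b', c')" by (cases i; cases j)
    have "ternary_monom i + ternary_monom j = ternary_monom (a + a', b + b', c + c')"
      by (simp add: ij ternary_monom_def single_add ac_simps)
    moreover have "(a + a', b + b', c + c') \<in> set (monos3 (d + e))"
      using that by (auto simp: ij set_monos3)
    ultimately show ?thesis by blast
  qed
  then have "ternary_monom i + ternary_monom j \<in> ternary_monom ` set (monos3 (d + e))"
    if "i \<in> set (monos3 d)" "j \<in> set (monos3 e)" for i j
    using that by (simp add: image_iff)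
  note closed = this
  show ?thesis
    unfolding ternary_form_def
  proof
    fix m assume "m \<in> Poly_Mapping.keys (p * q)"
    then obtain a b where "m = a + b" "a \<in> Poly_Mapping.keys p" "b \<in> Poly_Mapping.keys q"
      using keys_mult[of p q] by blast
    moreover from this obtain i j where "i \<in> set (monos3 d)" "a = ternary_monom i"
      "j \<in> set (monos3 e)" "b = ternary_monom j"
      using assms unfolding ternary_form_def by blast
    ultimately show "m \<in> ternary_monom ` set (monos3 (d + e))" using closed by simp
  qed
qed

lemma ternary_form_prod:
  "(\<And>i. i \<in> I \<Longrightarrow> ternary_form 1 (p i)) \<Longrightarrow> ternary_form (card I) (\<Prod>i\<in>I. p i)"
proof (induction I rule: infinite_finite_induct)
  case (insert i I)
  then show ?case using ternary_form_mult[of 1 "p i" "card I"] by simp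
qed (auto intro: ternary_form_one)

lemma ternary_form_det:
  assumes A: "A \<in> carrier_mat k k" and entries: "\<And>i j. i < k \<Longrightarrow> j < k \<Longrightarrow> ternary_form 1 (A $$ (i, j))"
  shows "ternary_form k (det A)"
  unfolding det_def'[OF A]
proof (rule ternary_form_sum)
  fix \<pi> assume "\<pi> \<in> {p. p permutes {0..<k}}"
  then have "ternary_form (card {0..<k}) (\<Prod>i = 0..<k. A $$ (i, \<pi> i))"
    by (intro ternary_form_prod entries) (auto simp: permutes_in_image[of \<pi> "{0..<k}", simplified])
  then show "ternary_form k (signof \<pi> * (\<Prod>i = 0..<k. A $$ (i, \<pi> i)))"
    by (cases \<pi> rule: sign_cases) (simp_all add: ternary_form_uminus)
qed

lemma ternary_form_adj_mat:
  assumes A: "A \<in> carrier_mat n n" and entries: "\<And>i j. i < n \<Longrightarrow> j < n \<Longrightarrow> ternary_form 1 (A $$ (i, j))"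
    and ij: "i < n" "j < n"
  shows "ternary_form (n - 1) (adj_mat A $$ (i, j))"
proof -
  have "ternary_form (n - 1) (det (mat_delete A j i))"
  proof (rule ternary_form_det[OF mat_delete_carrier[OF A]])
    fix i' j' assume ij': "i' < n - 1" "j' < n - 1"
    have "mat_delete A j i $$ (i', j') = A $$ (if i' < j then i' else Suc i', if j' < i then j' else Suc j')"
      using ij' A by (simp add: mat_delete_def)
    moreover have "ternary_form 1 (A $$ (if i' < j then i' else Suc i', if j' < i then j' else Suc j'))"
      by (rule entries) (use ij' in auto)
    ultimately show "ternary_form 1 (mat_delete A j i $$ (i', j'))" by (simp only:)
  qed
  moreover have "adj_mat A $$ (i, j) = (-1) ^ (j + i) * det (mat_delete A j i)"
    using A ij by (simp add: adj_mat_def cofactor_def)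
  ultimately show ?thesis
    by (cases "even (j + i)") (simp_all add: ternary_form_uminus)
qed

definition ternary_point :: "complex \<Rightarrow> complex \<Rightarrow> complex \<Rightarrow> nat \<Rightarrow> complex" where
  "ternary_point x y z = (\<lambda>k. if k = 0 then x else if k = 1 then y else z)"

lemma eval_monom_ternary: "eval_monom (ternary_monom (a, b, c)) (ternary_point x y z) = x ^ a * y ^ b * z ^ c"
  by (simp add: ternary_monom_def eval_monom_add ternary_point_def)

lemma sum_nth_distinct: "distinct xs \<Longrightarrow> (\<Sum>k<length xs. f (xs ! k)) = (\<Sum>x\<in>set xs. f x)"
  by (rule sum.reindex_bij_betw[OF bij_betw_nth]) auto

lemma eval_ternary_form:
  assumes "ternary_form d p"
  shows "Defs.eval_poly p (ternary_point x y z) =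
    (\<Sum>k<length (monos3 d). mono_coeff p (monos3 d ! k) * veronese_map d (vec_of_list [x, y, z]) $ k)"
proof -
  have coeff: "mono_coeff p m = Poly_Mapping.lookup p (ternary_monom m)" for m
    by (cases m) (simp add: mono_coeff_def ternary_monom_def)
  have "Defs.eval_poly p (ternary_point x y z) =
      (\<Sum>m\<in>ternary_monom ` set (monos3 d). Poly_Mapping.lookup p m * eval_monom m (ternary_point x y z))"
    by (rule eval_poly_superset) (use assms in \<open>auto simp: ternary_form_def\<close>)
  also have "\<dots> = (\<Sum>m\<in>set (monos3 d). mono_coeff p m * eval_monom (ternary_monom m) (ternary_point x y z))"
    by (subst sum.reindex) (auto simp: coeff intro: inj_on_subset[OF inj_ternary_monom])
  also have "\<dots> = (\<Sum>k<length (monos3 d). mono_coeff p (monos3 d ! k) *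
      eval_monom (ternary_monom (monos3 d ! k)) (ternary_point x y z))"
    by (rule sum_nth_distinct[OF distinct_monos3, symmetric])
  also have "\<dots> = (\<Sum>k<length (monos3 d). mono_coeff p (monos3 d ! k) * veronese_map d (vec_of_list [x, y, z]) $ k)"
  proof (intro sum.cong refl)
    fix k assume "k \<in> {..<length (monos3 d)}"
    then show "mono_coeff p (monos3 d ! k) * eval_monom (ternary_monom (monos3 d ! k)) (ternary_point x y z) =
        mono_coeff p (monos3 d ! k) * veronese_map d (vec_of_list [x, y, z]) $ k"
      by (cases "monos3 d ! k") (simp add: veronese_map_def eval_monom_ternary vec_of_list_index numeral_2_eq_2)
  qed
  finally show ?thesis .
qed

definition net_member :: "complex mat \<Rightarrow> complex mat \<Rightarrow> complex mat \<Rightarrow> complex vec \<Rightarrow> complex mat" where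
  "net_member X Y Z v = v $ 0 \<cdot>\<^sub>m X + v $ 1 \<cdot>\<^sub>m Y + v $ 2 \<cdot>\<^sub>m Z"

lemma ternary_form_generic_member:
  assumes "X \<in> carrier_mat n n" "Y \<in> carrier_mat n n" "Z \<in> carrier_mat n n" "i < n" "j < n"
  shows "ternary_form 1 (generic_member X Y Z $$ (i, j))"
proof -
  have mono: "Poly_Mapping.single k (Suc 0) \<in> ternary_monom ` set (monos3 (Suc 0))" if "k \<in> {0, 1, 2}" for k
  proof -
    have "Poly_Mapping.single 0 1 = ternary_monom (1, 0, 0)" "Poly_Mapping.single 1 1 = ternary_monom (0, 1, 0)"
      "Poly_Mapping.single 2 1 = ternary_monom (0, 0, 1)" by (simp_all add: ternary_monom_def)
    moreover have "{(1, 0, 0), (0, 1, 0), (0, 0, 1)} \<subseteq> set (monos3 (Suc 0))" by (auto simp: set_monos3)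
    ultimately show ?thesis using that by auto
  qed
  have "ternary_form 1 (cvar k * cconst c)" if "k \<in> {0, 1, 2}" for k c
    using mono[OF that] by (auto simp: ternary_form_def cvar_def cconst_def mult_single)
  then show ?thesis
    using assms by (auto simp: generic_member_def intro!: ternary_form_add)
qed

text \<open>Evaluation at \<open>v\<close> is a ring homomorphism, so it commutes with the adjugate and sends the generic member to
  \<open>M(v)\<close>. The entries of the generic adjugate are forms of degree \<open>n - 1\<close>, with coefficients the rows of the
  Chow matrix.\<close>

lemma chow_matrix_mult_veronese:
  assumes X: "X \<in> carrier_mat n n" and Y: "Y \<in> carrier_mat n n" and Z: "Z \<in> carrier_mat n n"
    and v: "v \<in> carrier_vec 3" and r: "r < length (sym_positions n)"
  shows "(chow_matrix n X Y Z *\<^sub>v veronese_map (n - 1) v) $ r =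
    adj_mat (net_member X Y Z v) $$ (sym_positions n ! r)"
proof -
  let ?G = "generic_member X Y Z" and ?f = "ternary_point (v $ 0) (v $ 1) (v $ 2)"
  interpret ev: comm_ring_hom "\<lambda>p. Defs.eval_poly p ?f" by (rule eval_poly_hom)
  have G: "?G \<in> carrier_mat n n" using X Y Z by (simp add: generic_member_def)
  have v3: "v = vec_of_list [v $ 0, v $ 1, v $ 2]"
    using v by (intro eq_vecI) (auto simp: vec_of_list_index less_Suc_eq numeral_3_eq_3 numeral_2_eq_2)
  obtain i j where ij: "sym_positions n ! r = (i, j)" by fastforce
  then have "(i, j) \<in> set (sym_positions n)" using r by (metis nth_mem)
  then have lt: "i < n" "j < n" by (auto simp: sym_positions_def)
  have "map_mat (\<lambda>p. Defs.eval_poly p ?f) ?G = net_member X Y Z v"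
    using X Y Z by (intro eq_matI)
      (auto simp: generic_member_def net_member_def eval_poly_add eval_poly_mult cvar_def cconst_def ternary_point_def)
  then have "adj_mat (net_member X Y Z v) $$ (i, j) = Defs.eval_poly (adj_mat ?G $$ (i, j)) ?f"
    using ev.hom_adj_mat[OF G] lt adj_mat(1)[OF G] by simp
  also have "\<dots> = (\<Sum>k<length (monos3 (n - 1)). mono_coeff (adj_mat ?G $$ (i, j)) (monos3 (n - 1) ! k) *
      veronese_map (n - 1) v $ k)"
    using eval_ternary_form[OF ternary_form_adj_mat[OF G ternary_form_generic_member[OF X Y Z] lt],
        of "v $ 0" "v $ 1" "v $ 2"]
    unfolding v3[symmetric] .
  also have "\<dots> = (chow_matrix n X Y Z *\<^sub>v veronese_map (n - 1) v) $ r"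
    using r ij by (simp add: chow_matrix_def scalar_prod_def atLeast0LessThan veronese_map_def)
  finally show ?thesis by (simp add: ij)
qed

section \<open>The cone over the Veronese surface\<close>

lemma exists_root_of_degree:
  fixes c :: complex
  assumes "d > 0"
  obtains z where "z ^ d = c"
proof -
  let ?p = "monom 1 d - [:c:]"
  have "coeff ?p d \<noteq> 0" using assms by (cases d) auto
  then have "degree ?p \<ge> d" by (rule le_degree)
  then have "\<not> constant (poly ?p)" using assms by (simp add: constant_degree)
  then obtain z where "poly ?p z = 0" using fundamental_theorem_of_algebra by blast
  then show ?thesis using that by (simp add: poly_monom)
qed

text \<open>The binomial quadrics that define the cone over the Veronese surface, with the coordinates
  indexed by exponents \<open>(a, b, c)\<close> with \<open>a + b + c = d\<close>; only these values of \<open>w\<close> matter.\<close>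

definition veronese_relations :: "nat \<Rightarrow> (nat \<Rightarrow> nat \<Rightarrow> nat \<Rightarrow> complex) \<Rightarrow> bool" where
  "veronese_relations d w \<longleftrightarrow> (\<forall>a b c a' b' c' i j k i' j' k'.
     a + b + c = d \<longrightarrow> a' + b' + c' = d \<longrightarrow> i + j + k = d \<longrightarrow> i' + j' + k' = d \<longrightarrow>
     a + a' = i + i' \<longrightarrow> b + b' = j + j' \<longrightarrow> c + c' = k + k' \<longrightarrow> w a b c * w a' b' c' = w i j k * w i' j' k')"

lemma veronese_relationsD:
  assumes "veronese_relations d w" "a + b + c = d" "a' + b' + c' = d" "i + j + k = d" "i' + j' + k' = d"
    "a + a' = i + i'" "b + b' = j + j'" "c + c' = k + k'"
  shows "w a b c * w a' b' c' = w i j k * w i' j' k'"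
  using assms unfolding veronese_relations_def by blast

text \<open>Take \<open>x\<close> with \<open>x\<^sup>d = w\<^sub>d\<^sub>0\<^sub>0\<close> and read off \<open>y\<close> and \<open>z\<close> from the neighbouring coordinates. The relation
  \<open>w\<^sub>a\<^sub>b\<^sub>c w\<^sub>d\<^sub>0\<^sub>0 = w\<^sub>a\<^sub>+\<^sub>1\<^sub>,\<^sub>b\<^sub>-\<^sub>1\<^sub>,\<^sub>c w\<^sub>d\<^sub>-\<^sub>1\<^sub>,\<^sub>1\<^sub>,\<^sub>0\<close>, or its analogue for \<open>c\<close>, reduces every other coordinate to these.\<close>

lemma veronese_parametrization:
  assumes rel: "veronese_relations d w" and nz: "w d 0 0 \<noteq> 0" and d: "d > 0"
  shows "\<exists>x y z. x \<noteq> 0 \<and> (\<forall>a b c. a + b + c = d \<longrightarrow> w a b c = x ^ a * y ^ b * z ^ c)"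
proof -
  obtain x where x: "x ^ d = w d 0 0" using exists_root_of_degree[OF d] .
  then have x0: "x \<noteq> 0" using nz d by (auto simp: power_0_left)
  define y where "y = w (d - 1) 1 0 / x ^ (d - 1)"
  define z where "z = w (d - 1) 0 1 / x ^ (d - 1)"
  have y: "w (d - 1) 1 0 = y * x ^ (d - 1)" and z: "w (d - 1) 0 1 = z * x ^ (d - 1)"
    using x0 by (simp_all add: y_def z_def)
  have xd: "w d 0 0 = x * x ^ (d - 1)" using d by (simp add: x[symmetric] power_eq_if)
  have "w a b c = x ^ a * y ^ b * z ^ c" if "a + b + c = d" for a b c
    using that
  proof (induction "b + c" arbitrary: a b c)
    case 0
    then show ?case using x by simp
  next
    case (Suc e)
    show ?case
    proof (cases b)
      case (Suc b')
      have "w a b c * w d 0 0 = w (a + 1) b' c * w (d - 1) 1 0"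
        by (rule veronese_relationsD[OF rel]) (use Suc Suc.prems d in auto)
      also have "w (a + 1) b' c = x ^ (a + 1) * y ^ b' * z ^ c"
        by (rule Suc.hyps) (use Suc Suc.prems Suc.hyps(2) in auto)
      finally have "w a b c * (x * x ^ (d - 1)) = x ^ (a + 1) * y ^ b' * z ^ c * (y * x ^ (d - 1))"
        unfolding xd y .
      then have "(w a b c * x) * x ^ (d - 1) = (x ^ a * y ^ b * z ^ c * x) * x ^ (d - 1)"
        unfolding Suc power_Suc power_add by (simp only: ac_simps power_one_right)
      then show ?thesis using x0 by simp
    next
      case 0
      then obtain c' where c: "c = Suc c'" using Suc.hyps(2) by (cases c) auto
      have "w a b c * w d 0 0 = w (a + 1) b c' * w (d - 1) 0 1"
        by (rule veronese_relationsD[OF rel]) (use c Suc.prems d in auto)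
      also have "w (a + 1) b c' = x ^ (a + 1) * y ^ b * z ^ c'"
        by (rule Suc.hyps) (use c Suc.prems Suc.hyps(2) in auto)
      finally have "w a b c * (x * x ^ (d - 1)) = x ^ (a + 1) * y ^ b * z ^ c' * (z * x ^ (d - 1))"
        unfolding xd z .
      then have "(w a b c * x) * x ^ (d - 1) = (x ^ a * y ^ b * z ^ c * x) * x ^ (d - 1)"
        unfolding c power_Suc power_add by (simp only: ac_simps power_one_right)
      then show ?thesis using x0 by simp
    qed
  qed
  then show ?thesis using x0 by blast
qed

text \<open>Among the nonzero coordinates take one that maximizes \<open>a\<^sup>2 + b\<^sup>2 + c\<^sup>2\<close>. If two exponents were positive, the
  square of this coordinate would be the product of two others, one with a larger sum of squares.\<close>

lemma veronese_relations_pure_power: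
  assumes rel: "veronese_relations d w" and nz: "w a b c \<noteq> 0" "a + b + c = d"
  shows "w d 0 0 \<noteq> 0 \<or> w 0 d 0 \<noteq> 0 \<or> w 0 0 d \<noteq> 0"
proof -
  define P where "P m \<longleftrightarrow> (case m of (a, b, c) \<Rightarrow> w a b c \<noteq> 0 \<and> a + b + c = d)" for m
  define f :: "nat \<times> nat \<times> nat \<Rightarrow> nat" where "f = (\<lambda>(a, b, c). a * a + b * b + c * c)"
  have "f m \<le> 3 * (d * d)" if "P m" for m
  proof -
    obtain a b c where m: "m = (a, b, c)" by (cases m)
    then have "a \<le> d" "b \<le> d" "c \<le> d" using that by (auto simp: P_def)
    then have "a * a \<le> d * d" "b * b \<le> d * d" "c * c \<le> d * d" by (simp_all add: mult_le_mono)
    then show ?thesis by (simp add: f_def m)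
  qed
  moreover have "P (a, b, c)" using nz by (simp add: P_def)
  ultimately have "\<exists>m. P m \<and> (\<forall>m'. P m' \<longrightarrow> f m' \<le> f m)"
    using ex_has_greatest_nat[of P "(a, b, c)" f "Suc (3 * (d * d))"] by (meson le_imp_less_Suc)
  then obtain a b c where max: "P (a, b, c)" "\<And>m'. P m' \<Longrightarrow> f m' \<le> f (a, b, c)"
    by (metis prod_cases3)
  then have w: "w a b c \<noteq> 0" and sum: "a + b + c = d" by (auto simp: P_def)
  \<comment> \<open>Moving one unit from one positive exponent to another, or back, increases the sum of squares
    in at least one of the two directions.\<close>
  have ab: "a = 0 \<or> b = 0"
  proof (rule ccontr)
    assume "\<not> (a = 0 \<or> b = 0)"
    then obtain a' b' where [simp]: "a = Suc a'" "b = Suc b'" by (metis not0_implies_Suc)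
    have "w a b c * w a b c = w (Suc a) b' c * w a' (Suc b) c"
      by (rule veronese_relationsD[OF rel]) (use sum in auto)
    then have "P (Suc a, b', c)" "P (a', Suc b, c)" using w sum by (auto simp: P_def)
    from this[THEN max(2)] show False by (simp add: f_def)
  qed
  have ac: "a = 0 \<or> c = 0"
  proof (rule ccontr)
    assume "\<not> (a = 0 \<or> c = 0)"
    then obtain a' c' where [simp]: "a = Suc a'" "c = Suc c'" by (metis not0_implies_Suc)
    have "w a b c * w a b c = w (Suc a) b c' * w a' b (Suc c)"
      by (rule veronese_relationsD[OF rel]) (use sum in auto)
    then have "P (Suc a, b, c')" "P (a', b, Suc c)" using w sum by (auto simp: P_def)
    from this[THEN max(2)] show False by (simp add: f_def)
  qed
  have bc: "b = 0 \<or> c = 0"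
  proof (rule ccontr)
    assume "\<not> (b = 0 \<or> c = 0)"
    then obtain b' c' where [simp]: "b = Suc b'" "c = Suc c'" by (metis not0_implies_Suc)
    have "w a b c * w a b c = w a (Suc b) c' * w a b' (Suc c)"
      by (rule veronese_relationsD[OF rel]) (use sum in auto)
    then have "P (a, Suc b, c')" "P (a, b', Suc c)" using w sum by (auto simp: P_def)
    from this[THEN max(2)] show False by (simp add: f_def)
  qed
  show ?thesis using ab ac bc w sum by auto
qed

lemma veronese_cone:
  assumes rel: "veronese_relations d w" and d: "d > 0" and nz: "w a b c \<noteq> 0" "a + b + c = d"
  obtains x y z where "(x, y, z) \<noteq> (0, 0, 0)" "\<And>a b c. a + b + c = d \<Longrightarrow> w a b c = x ^ a * y ^ b * z ^ c"
proof -
  consider "w d 0 0 \<noteq> 0" | "w 0 d 0 \<noteq> 0" | "w 0 0 d \<noteq> 0"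
    using veronese_relations_pure_power[OF rel nz] by blast
  then show ?thesis
  proof cases
    case 1
    from veronese_parametrization[OF rel this d] show ?thesis using that by blast
  next
    case 2
    have "veronese_relations d (\<lambda>a b c. w b a c)"
      unfolding veronese_relations_def
      by (intro allI impI, rule veronese_relationsD[OF rel]) auto
    from veronese_parametrization[OF this 2 d] obtain x y z where
      *: "x \<noteq> 0" "\<And>a b c. a + b + c = d \<Longrightarrow> w b a c = x ^ a * y ^ b * z ^ c" by blast
    have "w a b c = y ^ a * x ^ b * z ^ c" if "a + b + c = d" for a b c
      using *(2)[of b a c] that by (simp add: ac_simps)
    then show ?thesis using that[of y x z] *(1) by blast
  next
    case 3
    have "veronese_relations d (\<lambda>a b c. w c b a)"
      unfolding veronese_relations_def
      by (intro allI impI, rule veronese_relationsD[OF rel]) auto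
    from veronese_parametrization[OF this 3 d] obtain x y z where
      *: "x \<noteq> 0" "\<And>a b c. a + b + c = d \<Longrightarrow> w c b a = x ^ a * y ^ b * z ^ c" by blast
    have "w a b c = z ^ a * y ^ b * x ^ c" if "a + b + c = d" for a b c
      using *(2)[of c b a] that by (simp add: ac_simps)
    then show ?thesis using that[of z y x] *(1) by blast
  qed
qed

lemma veronese_map_carrier [simp]: "veronese_map d v \<in> carrier_vec (length (monos3 d))"
  by (simp add: veronese_map_def)

lemma veronese_map_index:
  assumes "k < length (monos3 d)" "monos3 d ! k = (a, b, c)"
  shows "veronese_map d v $ k = v $ 0 ^ a * v $ 1 ^ b * v $ 2 ^ c"
  using assms by (simp add: veronese_map_def)

lemma monos3_index:
  assumes "a + b + c = d"
  obtains k where "k < length (monos3 d)" "monos3 d ! k = (a, b, c)"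
proof -
  have "(a, b, c) \<in> set (monos3 d)" using assms by (simp add: set_monos3)
  then show ?thesis using that by (auto simp: in_set_conv_nth)
qed

lemma monos3_nth_sum: "k < length (monos3 d) \<Longrightarrow> monos3 d ! k = (a, b, c) \<Longrightarrow> a + b + c = d"
  using nth_mem[of k "monos3 d"] by (simp add: set_monos3)

lemma veronese_map_nonzero:
  assumes v: "v \<in> carrier_vec 3" "v \<noteq> 0\<^sub>v 3"
  shows "veronese_map d v \<noteq> 0\<^sub>v (length (monos3 d))"
proof
  assume *: "veronese_map d v = 0\<^sub>v (length (monos3 d))"
  have z: "v $ 0 ^ a * v $ 1 ^ b * v $ 2 ^ c = 0" if abc: "a + b + c = d" for a b c
  proof -
    obtain k where "k < length (monos3 d)" "monos3 d ! k = (a, b, c)" using monos3_index[OF abc] .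
    then show ?thesis using veronese_map_index[of k d a b c v] * by simp
  qed
  have "v $ 0 = 0" "v $ 1 = 0" "v $ 2 = 0"
    using z[of d 0 0] z[of 0 d 0] z[of 0 0 d] by simp_all
  then have "v = 0\<^sub>v 3"
    using v(1) by (intro eq_vecI) (auto simp: less_Suc_eq numeral_3_eq_3 numeral_2_eq_2)
  then show False using v(2) by simp
qed

lemma roots_of_unity_orthogonal:
  fixes M e e' :: nat
  assumes "e < M" "e' < M"
  shows "(\<Sum>i<M. cis (2 * pi * real e / real M) ^ i / cis (2 * pi * real e' / real M) ^ i) =
    (if e = e' then of_nat M else 0)"
proof -
  let ?\<omega> = "\<lambda>e. cis (2 * pi * real e / real M)"
  define q where "q = ?\<omega> e / ?\<omega> e'"
  have sum: "(\<Sum>i<M. ?\<omega> e ^ i / ?\<omega> e' ^ i) = (\<Sum>i<M. q ^ i)"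
    by (simp add: q_def power_divide)
  show ?thesis
  proof (cases "e = e'")
    case True
    then show ?thesis by (simp add: sum q_def)
  next
    case False
    have bij: "bij_betw ?\<omega> {..<M} {z. z ^ M = 1}"
      using bij_betw_roots_unity[of M] assms by simp
    have "?\<omega> e \<noteq> ?\<omega> e'" using bij False assms by (auto simp: bij_betw_def inj_on_def)
    then have q1: "q \<noteq> 1" by (simp add: q_def)
    have "?\<omega> e ^ M = 1" "?\<omega> e' ^ M = 1" using bij assms by (auto simp: bij_betw_def)
    then have "q ^ M = 1" by (simp add: q_def power_divide)
    then have "(\<Sum>i<M. q ^ i) = 0" using q1 geometric_sum[of q M] by simp
    then show ?thesis using False sum by simp
  qed
qed

text \<open>The points \<open>(s\<^bsup>d+1\<^esup> : s : 1)\<close> give all monomials of degree \<open>d\<close> different powers of \<open>s\<close>, which a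
  discrete Fourier transform over roots of unity \<open>s\<close> separates.\<close>

lemma veronese_points_span:
  assumes x: "x \<in> carrier_vec (length (monos3 d))"
  shows "\<exists>(K :: nat) \<gamma> v. (\<forall>i. v i \<in> carrier_vec 3 \<and> v i \<noteq> 0\<^sub>v 3) \<and>
    x = vec (length (monos3 d)) (\<lambda>k. \<Sum>i<K. \<gamma> i * veronese_map d (v i) $ k)"
proof -
  let ?N = "length (monos3 d)"
  define M where "M = Suc d * Suc d"
  define e where "e k = (case monos3 d ! k of (a, b, c) \<Rightarrow> a * Suc d + b)" for k
  define \<omega> where "\<omega> = cis (2 * pi / real M)"
  define v where "v i = vec_of_list [(\<omega> ^ i) ^ Suc d, \<omega> ^ i, 1]" for i
  define \<gamma> where "\<gamma> i = (\<Sum>l<?N. x $ l / (\<omega> ^ i) ^ e l) / of_nat M" for i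
  have v: "v i \<in> carrier_vec 3 \<and> v i \<noteq> 0\<^sub>v 3" for i
  proof
    show "v i \<in> carrier_vec 3" by (rule carrier_vecI) (simp add: v_def)
    have "v i $ 2 \<noteq> 0" by (simp add: v_def vec_of_list_index numeral_2_eq_2)
    then show "v i \<noteq> 0\<^sub>v 3" by auto
  qed
  have e: "e k < M" if "k < ?N" for k
  proof -
    obtain a b c where m: "monos3 d ! k = (a, b, c)" by (cases "monos3 d ! k")
    have "a + b + c = d" using monos3_nth_sum[OF that m] .
    then have "a * Suc d \<le> d * Suc d" "b \<le> d"
      using mult_le_mono1[of a d "Suc d"] by auto
    then have "a * Suc d + b < M" by (simp add: M_def)
    then show ?thesis by (simp add: e_def m)
  qed
  have inj: "k = l" if "k < ?N" "l < ?N" "e k = e l" for k l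
  proof -
    obtain a b c a' b' c' where m: "monos3 d ! k = (a, b, c)" "monos3 d ! l = (a', b', c')"
      by (cases "monos3 d ! k"; cases "monos3 d ! l")
    have s: "a + b + c = d" "a' + b' + c' = d" using monos3_nth_sum that(1,2) m by blast+
    have eq: "a * Suc d + b = a' * Suc d + b'" using that(3) by (simp only: e_def m prod.case)
    have "(q * Suc d + r) div Suc d = q" if "r \<le> d" for q r
      by (rule div_nat_eqI) (use that in \<open>auto simp: algebra_simps\<close>)
    from this[of b a] this[of b' a'] have "(a * Suc d + b) div Suc d = a" "(a' * Suc d + b') div Suc d = a'"
      using s by auto
    then have "a = a'" using eq by simp
    then have "b = b'" using eq by simp
    then have "monos3 d ! k = monos3 d ! l" using \<open>a = a'\<close> s m by simp
    then show ?thesis using distinct_monos3 that(1,2) by (simp add: nth_eq_iff_index_eq)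
  qed
  have val: "veronese_map d (v i) $ k = (\<omega> ^ i) ^ e k" if "k < ?N" for i k
  proof -
    obtain a b c where m: "monos3 d ! k = (a, b, c)" by (cases "monos3 d ! k")
    have "(s ^ Suc d) ^ a * s ^ b = s ^ (a * Suc d + b)" for s :: complex
      by (metis power_mult power_add mult.commute)
    from this[of "\<omega> ^ i"] show ?thesis
      using that by (simp add: veronese_map_index[OF that m] v_def vec_of_list_index e_def m numeral_2_eq_2 del: power_Suc)
  qed
  have pow: "(\<omega> ^ i) ^ m = cis (2 * pi * real m / real M) ^ i" for i m
    by (simp add: \<omega>_def DeMoivre mult.commute)
      (simp add: mult.left_commute mult.commute)
  have M0: "M > 0" by (simp add: M_def)
  have "x = vec ?N (\<lambda>k. \<Sum>i<M. \<gamma> i * veronese_map d (v i) $ k)"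
  proof (rule eq_vecI)
    fix k assume "k < dim_vec (vec ?N (\<lambda>k. \<Sum>i<M. \<gamma> i * veronese_map d (v i) $ k))"
    then have k: "k < ?N" by simp
    have "(\<Sum>i<M. \<gamma> i * veronese_map d (v i) $ k) =
        (\<Sum>i<M. \<Sum>l<?N. x $ l / of_nat M * (cis (2 * pi * real (e k) / real M) ^ i / cis (2 * pi * real (e l) / real M) ^ i))"
      by (simp add: \<gamma>_def val[OF k] pow sum_distrib_left sum_distrib_right sum_divide_distrib ac_simps)
    also have "\<dots> = (\<Sum>l<?N. x $ l / of_nat M * (\<Sum>i<M. cis (2 * pi * real (e k) / real M) ^ i / cis (2 * pi * real (e l) / real M) ^ i))"
      by (subst sum.swap) (simp add: sum_distrib_left)
    also have "\<dots> = (\<Sum>l<?N. if l = k then x $ l else 0)"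
      using M0 k e inj by (intro sum.cong refl) (auto simp: roots_of_unity_orthogonal)
    also have "\<dots> = x $ k" using k by simp
    finally show "x $ k = vec ?N (\<lambda>k. \<Sum>i<M. \<gamma> i * veronese_map d (v i) $ k) $ k" using k by simp
  qed (use x in simp)
  then show ?thesis using v by blast
qed

section \<open>Coordinates on symmetric matrices\<close>

lemma set_sym_positions: "set (sym_positions n) = {(i, j). i \<le> j \<and> j < n}"
proof safe
  fix i j assume "i \<le> j" "j < n"
  then show "(i, j) \<in> set (sym_positions n)" by (auto simp: sym_positions_def intro!: bexI[of _ i])
qed (auto simp: sym_positions_def)

lemma distinct_sym_positions: "distinct (sym_positions n)"
  unfolding sym_positions_def
  by (rule distinct_concat_map) (auto simp: distinct_map inj_on_def)

definition sym_index :: "nat \<Rightarrow> nat \<times> nat \<Rightarrow> nat" where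
  "sym_index n ij = (SOME r. r < length (sym_positions n) \<and> sym_positions n ! r = ij)"

lemma sym_index:
  assumes "i \<le> j" "j < n"
  shows "sym_index n (i, j) < length (sym_positions n)" "sym_positions n ! sym_index n (i, j) = (i, j)"
proof -
  have "\<exists>r. r < length (sym_positions n) \<and> sym_positions n ! r = (i, j)"
    using assms by (simp add: in_set_conv_nth[symmetric] set_sym_positions)
  from someI_ex[OF this] show "sym_index n (i, j) < length (sym_positions n)"
    "sym_positions n ! sym_index n (i, j) = (i, j)" by (simp_all add: sym_index_def)
qed

lemma sym_position_bounds:
  assumes "r < length (sym_positions n)" "sym_positions n ! r = (i, j)"
  shows "i \<le> j" "j < n" "sym_index n (i, j) = r"
proof -
  show ij: "i \<le> j" "j < n" using assms nth_mem[of r "sym_positions n"] by (auto simp: set_sym_positions)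
  show "sym_index n (i, j) = r"
    using sym_index[OF ij] assms distinct_sym_positions[of n] by (metis nth_eq_iff_index_eq)
qed

definition sym_coords :: "nat \<Rightarrow> complex mat \<Rightarrow> complex vec" where
  "sym_coords n A = vec (length (sym_positions n)) (\<lambda>r. A $$ (sym_positions n ! r))"

definition sym_of_coords :: "nat \<Rightarrow> complex vec \<Rightarrow> complex mat" where
  "sym_of_coords n x = mat n n (\<lambda>(i, j). x $ sym_index n (min i j, max i j))"

lemma sym_coords_carrier [simp]: "sym_coords n A \<in> carrier_vec (length (sym_positions n))"
  by (simp add: sym_coords_def)

lemma sym_of_coords_carrier [simp]: "sym_of_coords n x \<in> carrier_mat n n"
  by (simp add: sym_of_coords_def)

lemma transpose_sym_of_coords [simp]: "transpose_mat (sym_of_coords n x) = sym_of_coords n x"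
  by (rule eq_matI) (auto simp: sym_of_coords_def min.commute max.commute)

lemma sym_coords_of_coords:
  assumes "x \<in> carrier_vec (length (sym_positions n))"
  shows "sym_coords n (sym_of_coords n x) = x"
proof (rule eq_vecI)
  fix r assume "r < dim_vec x"
  then have r: "r < length (sym_positions n)" using assms by simp
  obtain i j where ij: "sym_positions n ! r = (i, j)" by fastforce
  show "sym_coords n (sym_of_coords n x) $ r = x $ r"
    using r sym_position_bounds[OF r ij] by (simp add: sym_coords_def sym_of_coords_def ij)
qed (use assms in \<open>simp add: sym_coords_def\<close>)

lemma sym_of_coords_coords:
  assumes A: "A \<in> carrier_mat n n" and sym: "transpose_mat A = A"
  shows "sym_of_coords n (sym_coords n A) = A"
proof (rule eq_matI)
  fix i j assume "i < dim_row A" "j < dim_col A"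
  then have ij: "i < n" "j < n" using A by auto
  have s: "A $$ (j, i) = A $$ (i, j)" using arg_cong[OF sym, of "\<lambda>M. M $$ (i, j)"] ij A by simp
  have mm: "min i j \<le> max i j" "max i j < n" using ij by auto
  show "sym_of_coords n (sym_coords n A) $$ (i, j) = A $$ (i, j)"
    using ij s sym_index[OF mm] by (simp add: sym_of_coords_def sym_coords_def min_def max_def split: if_splits)
qed (use A in \<open>simp_all add: sym_of_coords_def\<close>)

text \<open>The coordinates list each off-diagonal entry once while the trace meets it twice, whence the factors
  \<open>1/2\<close> in \<open>B\<close>.\<close>

lemma trace_pairing_as_coords:
  assumes y: "y \<in> carrier_vec (length (sym_positions n))" "y \<noteq> 0\<^sub>v (length (sym_positions n))"
  obtains B where "B \<in> carrier_mat n n" "transpose_mat B = B" "B \<noteq> 0\<^sub>m n n"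
    "\<And>A. A \<in> carrier_mat n n \<Longrightarrow> transpose_mat A = A \<Longrightarrow> mtrace n (B * A) = y \<bullet> sym_coords n A"
proof -
  let ?N = "length (sym_positions n)"
  define B where "B = mat n n (\<lambda>(i, j). y $ sym_index n (min i j, max i j) * (if i = j then 1 else 1 / 2))"
  have B: "B \<in> carrier_mat n n" by (simp add: B_def)
  have symB: "transpose_mat B = B"
    by (rule eq_matI) (auto simp: B_def min.commute max.commute)
  have "B \<noteq> 0\<^sub>m n n"
  proof
    assume z: "B = 0\<^sub>m n n"
    have "y $ r = 0" if r: "r < ?N" for r
    proof -
      obtain i j where ij: "sym_positions n ! r = (i, j)" by fastforce
      note b = sym_position_bounds[OF r ij]
      have "B $$ (i, j) = 0" using z b by simp
      then show ?thesis using b by (auto simp: B_def split: if_splits)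
    qed
    then have "y = 0\<^sub>v ?N" using y(1) by (intro eq_vecI) auto
    then show False using y(2) by simp
  qed
  moreover have "mtrace n (B * A) = y \<bullet> sym_coords n A"
    if A: "A \<in> carrier_mat n n" and symA: "transpose_mat A = A" for A
  proof -
    define g where "g = (\<lambda>(i, j). B $$ (i, j) * A $$ (j, i))"
    have gsym: "g (j, i) = g (i, j)" if "i < n" "j < n" for i j
      using that arg_cong[OF symB, of "\<lambda>M. M $$ (i, j)"] arg_cong[OF symA, of "\<lambda>M. M $$ (i, j)"] A B
      by (simp add: g_def)
    let ?U = "{(i, j). i < j \<and> j < n}" and ?L = "{(i, j). j < i \<and> i < n}" and ?D = "{(i, j). i = j \<and> i < n}"
    have sub: "?U \<subseteq> {..<n} \<times> {..<n}" "?L \<subseteq> {..<n} \<times> {..<n}" "?D \<subseteq> {..<n} \<times> {..<n}" by auto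
    have fin: "finite ?U" "finite ?L" "finite ?D"
      by (rule finite_subset[OF sub(1)], simp) (rule finite_subset[OF sub(2)], simp, rule finite_subset[OF sub(3)], simp)
    have "mtrace n (B * A) = sum g ({..<n} \<times> {..<n})"
      unfolding mtrace_mult[OF B A] by (simp add: g_def sum.cartesian_product)
    also have "{..<n} \<times> {..<n} = ?D \<union> (?U \<union> ?L)" by auto
    also have "sum g (?D \<union> (?U \<union> ?L)) = sum g ?D + (sum g ?U + sum g ?L)"
      using fin by (subst sum.union_disjoint, simp, simp, fastforce, subst sum.union_disjoint) auto
    also have "sum g ?L = sum g ?U"
      by (rule sum.reindex_bij_witness[of _ "\<lambda>(i, j). (j, i)" "\<lambda>(i, j). (j, i)"]) (auto simp: gsym)
    also have "sum g ?D + (sum g ?U + sum g ?U) = sum g ?D + (\<Sum>p\<in>?U. 2 * g p)"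
      by (simp add: sum_distrib_left[symmetric])
    also have "sum g ?D = (\<Sum>p\<in>?D. y $ sym_index n p * A $$ p)"
      by (intro sum.cong refl) (auto simp: g_def B_def)
    also have "(\<Sum>p\<in>?U. 2 * g p) = (\<Sum>p\<in>?U. y $ sym_index n p * A $$ p)"
    proof (intro sum.cong refl, safe)
      fix i j assume "i < j" "j < n"
      then show "2 * g (i, j) = y $ sym_index n (i, j) * A $$ (i, j)"
        using arg_cong[OF symA, of "\<lambda>M. M $$ (i, j)"] A by (simp add: g_def B_def)
    qed
    also have "(\<Sum>p\<in>?D. y $ sym_index n p * A $$ p) + (\<Sum>p\<in>?U. y $ sym_index n p * A $$ p)
        = (\<Sum>p\<in>?D \<union> ?U. y $ sym_index n p * A $$ p)"
      using fin by (subst sum.union_disjoint) auto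
    also have "?D \<union> ?U = set (sym_positions n)" by (auto simp: set_sym_positions)
    also have "(\<Sum>p\<in>set (sym_positions n). y $ sym_index n p * A $$ p) =
        (\<Sum>r<?N. y $ sym_index n (sym_positions n ! r) * A $$ (sym_positions n ! r))"
      by (rule sum_nth_distinct[OF distinct_sym_positions, symmetric])
    also have "\<dots> = y \<bullet> sym_coords n A"
    proof -
      have "sym_index n (sym_positions n ! r) = r" if "r < ?N" for r
        using sym_position_bounds(3)[OF that] by (cases "sym_positions n ! r") simp
      then show ?thesis by (simp add: scalar_prod_def sym_coords_def atLeast0LessThan)
    qed
    finally show ?thesis .
  qed
  ultimately show ?thesis using that B symB by blast
qed

section \<open>Zariski closure of the set of inverses\<close>

lemma sym_polys_add: "p \<in> sym_polys n \<Longrightarrow> q \<in> sym_polys n \<Longrightarrow> p + q \<in> sym_polys n"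
  using keys_add[of p q] by (auto simp: sym_polys_def)

lemma sym_polys_zero: "0 \<in> sym_polys n"
  by (simp add: sym_polys_def)

lemma sym_polys_uminus: "p \<in> sym_polys n \<Longrightarrow> - p \<in> sym_polys n"
  by (simp add: sym_polys_def)

lemma sym_polys_sum: "(\<And>i. i \<in> I \<Longrightarrow> p i \<in> sym_polys n) \<Longrightarrow> (\<Sum>i\<in>I. p i) \<in> sym_polys n"
  by (induction I rule: infinite_finite_induct) (auto intro: sym_polys_add sym_polys_zero)

lemma sym_polys_mult:
  assumes "p \<in> sym_polys n" "q \<in> sym_polys n"
  shows "p * q \<in> sym_polys n"
  unfolding sym_polys_def
proof (rule CollectI, rule ballI)
  fix m assume "m \<in> Poly_Mapping.keys (p * q)"
  then obtain a b where "m = a + b" "a \<in> Poly_Mapping.keys p" "b \<in> Poly_Mapping.keys q"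
    using keys_mult[of p q] by blast
  moreover have "Poly_Mapping.keys (a + b) \<subseteq> Poly_Mapping.keys a \<union> Poly_Mapping.keys b" by (rule keys_add)
  ultimately show "Poly_Mapping.keys m \<subseteq> set (sym_positions n)"
    using assms unfolding sym_polys_def by blast
qed

definition linear_poly :: "nat \<Rightarrow> complex vec \<Rightarrow> (nat \<times> nat \<Rightarrow>\<^sub>0 nat) \<Rightarrow>\<^sub>0 complex" where
  "linear_poly n y = (\<Sum>r<length (sym_positions n).
     Poly_Mapping.single (Poly_Mapping.single (sym_positions n ! r) 1) (y $ r))"

lemma linear_poly_in_sym_polys: "linear_poly n y \<in> sym_polys n"
  unfolding linear_poly_def
  by (intro sym_polys_sum) (auto simp: sym_polys_def)

lemma eval_linear_poly: "Defs.eval_poly (linear_poly n y) (($$) A) = y \<bullet> sym_coords n A"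
  by (simp add: linear_poly_def eval_poly_sum scalar_prod_def sym_coords_def atLeast0LessThan)

lemma zariski_closureD:
  assumes "A \<in> zariski_closure n S" "p \<in> sym_polys n"
    "\<And>B. B \<in> S \<Longrightarrow> Defs.eval_poly p (($$) B) = 0"
  shows "Defs.eval_poly p (($$) A) = 0"
  using assms unfolding zariski_closure_def by blast

lemma zariski_closure_linear:
  assumes "A \<in> zariski_closure n S" "\<And>B. B \<in> S \<Longrightarrow> y \<bullet> sym_coords n B = 0"
  shows "y \<bullet> sym_coords n A = 0"
  using zariski_closureD[OF assms(1) linear_poly_in_sym_polys, of y] assms(2)
  by (simp add: eval_linear_poly)

lemma carrier_sym_space: "carrier (sym_space n) = {A \<in> carrier_mat n n. transpose_mat A = A}"
  by (simp add: sym_space_def)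

locale spanned_net =
  fixes n :: nat and X Y Z :: "complex mat"
  assumes n: "n \<ge> 3"
    and X: "X \<in> carrier_mat n n" and Y: "Y \<in> carrier_mat n n" and Z: "Z \<in> carrier_mat n n"
    and symX: "transpose_mat X = X" and symY: "transpose_mat Y = Y" and symZ: "transpose_mat Z = Z"
    and regular: "\<exists>v\<in>carrier_vec 3. det (net_member X Y Z v) \<noteq> 0"
begin

abbreviation M where "M \<equiv> net_member X Y Z"
abbreviation C where "C \<equiv> chow_matrix n X Y Z"
abbreviation N where "N \<equiv> length (monos3 (n - 1))"
definition "L = M ` carrier_vec 3"

lemma length_positions: "length (sym_positions n) = N"
  using n by (cases n) (auto simp: length_sym_positions length_monos3)

lemma C: "C \<in> carrier_mat N N"
  by (simp add: chow_matrix_def length_positions)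

lemma M: "M v \<in> carrier_mat n n"
  using X Y Z by (simp add: net_member_def)

lemma symM: "transpose_mat (M v) = M v"
proof (rule eq_matI)
  fix i j assume "i < dim_row (M v)" "j < dim_col (M v)"
  then have ij: "i < n" "j < n" using carrier_matD[OF M[of v]] by simp_all
  have "X $$ (j, i) = X $$ (i, j)" "Y $$ (j, i) = Y $$ (i, j)" "Z $$ (j, i) = Z $$ (i, j)"
    using ij X Y Z arg_cong[OF symX, of "\<lambda>A. A $$ (i, j)"] arg_cong[OF symY, of "\<lambda>A. A $$ (i, j)"]
      arg_cong[OF symZ, of "\<lambda>A. A $$ (i, j)"] by simp_all
  then show "transpose_mat (M v) $$ (i, j) = M v $$ (i, j)"
    using ij X Y Z by (simp add: net_member_def)
qed (simp_all add: carrier_matD[OF M])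

lemma adjM: "adj_mat (M v) \<in> carrier_mat n n" and sym_adjM: "transpose_mat (adj_mat (M v)) = adj_mat (M v)"
  using adj_mat(1)[OF M] transpose_adj_mat_symmetric[OF M symM] by auto

lemma M_add: "u \<in> carrier_vec 3 \<Longrightarrow> v \<in> carrier_vec 3 \<Longrightarrow> M (u + v) = M u + M v"
  using X Y Z by (intro eq_matI) (simp_all add: net_member_def algebra_simps)

lemma M_smult: "v \<in> carrier_vec 3 \<Longrightarrow> M (c \<cdot>\<^sub>v v) = c \<cdot>\<^sub>m M v"
  using X Y Z by (intro eq_matI) (simp_all add: net_member_def algebra_simps)

lemma C_mult_veronese:
  assumes v: "v \<in> carrier_vec 3"
  shows "C *\<^sub>v veronese_map (n - 1) v = sym_coords n (adj_mat (M v))"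
proof (rule eq_vecI)
  fix r assume "r < dim_vec (sym_coords n (adj_mat (M v)))"
  then have r: "r < length (sym_positions n)" by (simp add: sym_coords_def)
  show "(C *\<^sub>v veronese_map (n - 1) v) $ r = sym_coords n (adj_mat (M v)) $ r"
    using chow_matrix_mult_veronese[OF X Y Z v r] r by (simp add: sym_coords_def)
qed (simp add: chow_matrix_def sym_coords_def)

lemma inversesE:
  assumes "B \<in> inverses L"
  obtains v where "v \<in> carrier_vec 3" "det (M v) \<noteq> 0" "B = inverse (det (M v)) \<cdot>\<^sub>m adj_mat (M v)"
proof -
  obtain v where v: "v \<in> carrier_vec 3" and inv: "inverts_mat (M v) B" "inverts_mat B (M v)"
    using assms by (auto simp: inverses_def L_def)
  have MB: "M v * B = 1\<^sub>m n" using inv(1) M[of v] by (simp add: inverts_mat_def)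
  have BM: "B * M v = 1\<^sub>m (dim_row B)" using inv(2) by (simp add: inverts_mat_def)
  have "dim_col B = n" using arg_cong[OF MB, of dim_col] by simp
  moreover have "dim_row B = n" using arg_cong[OF BM, of dim_col] M[of v] by simp
  ultimately have B: "B \<in> carrier_mat n n" by auto
  have "det (M v) * det B = 1" using det_mult[OF M[of v] B] MB by simp
  then have d: "det (M v) \<noteq> 0" by auto
  have "det (M v) \<cdot>\<^sub>m B = adj_mat (M v) * M v * B"
    using B adj_mat(3)[OF M, of v] mult_smult_assoc_mat[OF one_carrier_mat B, of "det (M v)"] by simp
  also have "\<dots> = adj_mat (M v)"
    using assoc_mult_mat[OF adjM M B] adjM[of v] by (simp add: MB)
  finally have "adj_mat (M v) = det (M v) \<cdot>\<^sub>m B" by simp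
  then have "B = inverse (det (M v)) \<cdot>\<^sub>m adj_mat (M v)"
    using d B by (auto intro!: eq_matI)
  then show ?thesis using that v d by blast
qed

lemma adj_mat_in_inverses:
  assumes v: "v \<in> carrier_vec 3" and d: "det (M v) \<noteq> 0"
  shows "adj_mat (M v) \<in> inverses L"
proof -
  let ?A = "M (inverse (det (M v)) \<cdot>\<^sub>v v)"
  have A: "?A = inverse (det (M v)) \<cdot>\<^sub>m M v" by (rule M_smult[OF v])
  have "?A * adj_mat (M v) = 1\<^sub>m n" "adj_mat (M v) * ?A = 1\<^sub>m n"
    using d adj_mat(2,3)[OF M, of v] mult_smult_assoc_mat[OF M adjM] mult_smult_distrib[OF adjM M]
    by (auto simp: A intro!: eq_matI)
  then have "inverts_mat ?A (adj_mat (M v))" "inverts_mat (adj_mat (M v)) ?A"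
    by (simp_all add: inverts_mat_def carrier_matD[OF M] carrier_matD[OF adjM])
  moreover have "?A \<in> L" using v by (simp add: L_def)
  ultimately show ?thesis by (auto simp: inverses_def)
qed

lemma inverse_coords:
  assumes "B \<in> inverses L"
  obtains v c where "v \<in> carrier_vec 3" "sym_coords n B = c \<cdot>\<^sub>v (C *\<^sub>v veronese_map (n - 1) v)"
proof -
  obtain v where v: "v \<in> carrier_vec 3" "B = inverse (det (M v)) \<cdot>\<^sub>m adj_mat (M v)"
    using inversesE[OF assms] by metis
  have "sym_coords n B = inverse (det (M v)) \<cdot>\<^sub>v sym_coords n (adj_mat (M v))"
  proof (rule eq_vecI)
    fix r assume "r < dim_vec (inverse (det (M v)) \<cdot>\<^sub>v sym_coords n (adj_mat (M v)))"
    then have r: "r < length (sym_positions n)" by (simp add: sym_coords_def)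
    obtain i j where ij: "sym_positions n ! r = (i, j)" by fastforce
    show "sym_coords n B $ r = (inverse (det (M v)) \<cdot>\<^sub>v sym_coords n (adj_mat (M v))) $ r"
      using r sym_position_bounds[OF r ij] adjM[of v] by (simp add: v(2) sym_coords_def ij)
  qed (simp add: sym_coords_def)
  then show ?thesis using that[OF v(1)] C_mult_veronese[OF v(1)] by simp
qed

text \<open>On the line joining \<open>M(v)\<close> to an invertible member, a polynomial that vanishes on the inverses becomes, after
  substituting the adjugate, a univariate polynomial that is zero wherever the determinant is not. The
  adjugate of an invertible member is the inverse of a multiple of that member.\<close>

lemma adj_mat_in_closure:
  assumes v: "v \<in> carrier_vec 3"
  shows "adj_mat (M v) \<in> zariski_closure n (inverses L)"
proof -
  obtain p0 where p0: "p0 \<in> carrier_vec 3" "det (M p0) \<noteq> 0" using regular by blast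
  define F where "F = M v"
  define G where "G = M (p0 - v)"
  have FG: "F \<in> carrier_mat n n" "G \<in> carrier_mat n n" by (simp_all add: F_def G_def M)
  have pv: "p0 - v \<in> carrier_vec 3" using p0 v by simp
  have line: "F + s \<cdot>\<^sub>m G = M (v + s \<cdot>\<^sub>v (p0 - v))" for s
    using M_add[OF v, of "s \<cdot>\<^sub>v (p0 - v)"] M_smult[OF pv] pv by (simp add: F_def G_def)
  have lc: "v + s \<cdot>\<^sub>v (p0 - v) \<in> carrier_vec 3" for s using v p0 by simp
  obtain d where d: "\<And>s. poly d s = det (F + s \<cdot>\<^sub>m G)" by (rule det_pencil_polynomial[OF FG]) (rule that)
  obtain a where a: "\<And>i j s. i < n \<Longrightarrow> j < n \<Longrightarrow> poly (a i j) s = adj_mat (F + s \<cdot>\<^sub>m G) $$ (i, j)"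
    using adj_pencil_polynomial[OF FG] by blast
  have "v + 1 \<cdot>\<^sub>v (p0 - v) = p0" using v p0 by (intro eq_vecI) auto
  then have "poly d 1 \<noteq> 0" using p0(2) by (simp add: d line)
  then have d0: "d \<noteq> 0" by auto
  have "Defs.eval_poly p (($$) (adj_mat (M v))) = 0"
    if p: "p \<in> sym_polys n" and van: "\<And>B. B \<in> inverses L \<Longrightarrow> Defs.eval_poly p (($$) B) = 0" for p
  proof -
    define q where "q = (\<Sum>m\<in>Poly_Mapping.keys p. smult (Poly_Mapping.lookup p m)
      (\<Prod>ij\<in>Poly_Mapping.keys m. a (fst ij) (snd ij) ^ Poly_Mapping.lookup m ij))"
    have q: "poly q s = Defs.eval_poly p (($$) (adj_mat (F + s \<cdot>\<^sub>m G)))" for s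
    proof -
      have "poly (a (fst ij) (snd ij)) s = adj_mat (F + s \<cdot>\<^sub>m G) $$ ij"
        if "m \<in> Poly_Mapping.keys p" "ij \<in> Poly_Mapping.keys m" for m ij
      proof -
        obtain i j where ij: "ij = (i, j)" by fastforce
        have "ij \<in> set (sym_positions n)" using that p by (auto simp: sym_polys_def)
        then show ?thesis using a[of i j s] by (simp add: ij set_sym_positions)
      qed
      then show ?thesis
        unfolding q_def Defs.eval_poly_def poly_sum poly_smult poly_prod poly_power
        by (intro sum.cong refl arg_cong2[of _ _ _ _ "(*)"] prod.cong) auto
    qed
    have "q = 0"
    proof (rule poly_eq_0_if_vanishes_generically[OF d0])
      fix s assume "poly d s \<noteq> 0"
      then have "adj_mat (F + s \<cdot>\<^sub>m G) \<in> inverses L"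
        using adj_mat_in_inverses[OF lc] by (simp add: d line)
      then show "poly q s = 0" using van q by simp
    qed
    moreover have "F + 0 \<cdot>\<^sub>m G = M v" using FG by (intro eq_matI) (auto simp: F_def)
    ultimately show ?thesis using q[of 0] by simp
  qed
  then show ?thesis
    using adjM sym_adjM by (auto simp: zariski_closure_def carrier_sym_space)
qed

text \<open>The coordinates \<open>w = C\<^sup>-\<^sup>1 vec A\<close> satisfy the quadrics of the Veronese cone on the inverses, where
  \<open>w = \<nu>(v)/det M(v)\<close>. These quadrics are polynomials in the entries of \<open>A\<close>, so they hold on the closure.\<close>

lemma closure_subset_cone:
  assumes detC: "det C \<noteq> 0" and A: "A \<in> zariski_closure n (inverses L)" "A \<noteq> 0\<^sub>m n n"
  obtains v where "v \<in> carrier_vec 3" "v \<noteq> 0\<^sub>v 3" "A = adj_mat (M v)"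
proof -
  let ?d = "n - 1"
  have Ac: "A \<in> carrier_mat n n" "transpose_mat A = A"
    using A(1) by (auto simp: zariski_closure_def carrier_sym_space)
  obtain D where D: "D \<in> carrier_mat N N" "C * D = 1\<^sub>m N" "D * C = 1\<^sub>m N"
    using nonsingular_inverse[OF C detC] .
  define w where "w B = D *\<^sub>v sym_coords n B" for B
  have coords: "sym_coords n B \<in> carrier_vec N" for B
    using sym_coords_carrier[of n B] by (simp add: length_positions)
  have w: "w B \<in> carrier_vec N" for B using D(1) coords by (simp add: w_def)
  have Cw: "C *\<^sub>v w B = sym_coords n B" for B
    using assoc_mult_mat_vec[OF C D(1) coords] coords by (simp add: w_def D(2))
  have wk: "w B $ k = row D k \<bullet> sym_coords n B" if "k < N" for B k
    using that D(1) by (simp add: w_def)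
  have w_inverse: "\<exists>v c. \<forall>k<N. w B $ k = c * veronese_map ?d v $ k" if B: "B \<in> inverses L" for B
  proof -
    obtain v c where vc: "sym_coords n B = c \<cdot>\<^sub>v (C *\<^sub>v veronese_map ?d v)"
      using inverse_coords[OF B] by metis
    have "w B = c \<cdot>\<^sub>v veronese_map ?d v"
      unfolding w_def vc using mult_mat_vec[OF D(1), of "C *\<^sub>v veronese_map ?d v" c] C
        assoc_mult_mat_vec[OF D(1) C veronese_map_carrier] by (simp add: D(3))
    then have "\<forall>k<N. w B $ k = c * veronese_map ?d v $ k" by (simp add: carrier_vecD[OF veronese_map_carrier])
    then show ?thesis by blast
  qed
  define idx where "idx m = (SOME k. k < N \<and> monos3 ?d ! k = m)" for m
  have idx: "idx (a, b, c) < N" "monos3 ?d ! idx (a, b, c) = (a, b, c)" if "a + b + c = ?d" for a b c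
  proof -
    have "\<exists>k. k < N \<and> monos3 ?d ! k = (a, b, c)" using monos3_index[OF that] by metis
    from someI_ex[OF this] show "idx (a, b, c) < N" "monos3 ?d ! idx (a, b, c) = (a, b, c)"
      by (simp_all add: idx_def)
  qed
  define f where "f a b c = w A $ idx (a, b, c)" for a b c
  have rel: "veronese_relations ?d f"
    unfolding veronese_relations_def
  proof (intro allI impI)
    fix a b c a' b' c' i j k i' j' k'
    assume sums: "a + b + c = ?d" "a' + b' + c' = ?d" "i + j + k = ?d" "i' + j' + k' = ?d"
      and eqs: "a + a' = i + i'" "b + b' = j + j'" "c + c' = k + k'"
    let ?l = "\<lambda>m. linear_poly n (row D (idx m))"
    define p where "p = ?l (a, b, c) * ?l (a', b', c') + - (?l (i, j, k) * ?l (i', j', k'))"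
    have p: "p \<in> sym_polys n"
      unfolding p_def by (intro sym_polys_add sym_polys_uminus sym_polys_mult linear_poly_in_sym_polys)
    note ix = idx[OF sums(1)] idx[OF sums(2)] idx[OF sums(3)] idx[OF sums(4)]
    note wx = wk[OF ix(1)] wk[OF ix(3)] wk[OF ix(5)] wk[OF ix(7)]
    have ev_p: "Defs.eval_poly p (($$) B) =
        w B $ idx (a, b, c) * w B $ idx (a', b', c') - w B $ idx (i, j, k) * w B $ idx (i', j', k')" for B
      unfolding p_def wx by (simp only: eval_poly_add eval_poly_uminus eval_poly_mult eval_linear_poly) simp
    have "Defs.eval_poly p (($$) A) = 0"
    proof (rule zariski_closureD[OF A(1) p])
      fix B assume "B \<in> inverses L"
      then obtain v t where t: "\<And>k. k < N \<Longrightarrow> w B $ k = t * veronese_map ?d v $ k"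
        using w_inverse by blast
      have "v $ 0 ^ a * v $ 0 ^ a' = v $ 0 ^ i * v $ 0 ^ i'" "v $ 1 ^ b * v $ 1 ^ b' = v $ 1 ^ j * v $ 1 ^ j'"
        "v $ 2 ^ c * v $ 2 ^ c' = v $ 2 ^ k * v $ 2 ^ k'"
        by (simp_all only: power_add[symmetric] eqs)
      then have "(v $ 0 ^ a * v $ 0 ^ a') * (v $ 1 ^ b * v $ 1 ^ b') * (v $ 2 ^ c * v $ 2 ^ c') =
        (v $ 0 ^ i * v $ 0 ^ i') * (v $ 1 ^ j * v $ 1 ^ j') * (v $ 2 ^ k * v $ 2 ^ k')" by (simp only:)
      then have "(v $ 0 ^ a * v $ 1 ^ b * v $ 2 ^ c) * (v $ 0 ^ a' * v $ 1 ^ b' * v $ 2 ^ c') =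
        (v $ 0 ^ i * v $ 1 ^ j * v $ 2 ^ k) * (v $ 0 ^ i' * v $ 1 ^ j' * v $ 2 ^ k')" by (simp only: ac_simps)
      then have "(t * t) * ((v $ 0 ^ a * v $ 1 ^ b * v $ 2 ^ c) * (v $ 0 ^ a' * v $ 1 ^ b' * v $ 2 ^ c')) =
        (t * t) * ((v $ 0 ^ i * v $ 1 ^ j * v $ 2 ^ k) * (v $ 0 ^ i' * v $ 1 ^ j' * v $ 2 ^ k'))" by (simp only:)
      then show "Defs.eval_poly p (($$) B) = 0"
        unfolding ev_p ix(1,3,5,7)[THEN t] veronese_map_index[OF ix(1,2)] veronese_map_index[OF ix(3,4)]
          veronese_map_index[OF ix(5,6)] veronese_map_index[OF ix(7,8)]
        by (simp only: right_minus_eq ac_simps)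
    qed
    then show "f a b c * f a' b' c' = f i j k * f i' j' k'" by (simp add: ev_p f_def)
  qed
  have "\<exists>k<N. w A $ k \<noteq> 0"
  proof (rule ccontr)
    assume "\<not> (\<exists>k<N. w A $ k \<noteq> 0)"
    then have "w A = 0\<^sub>v N" using w[of A] by (intro eq_vecI) auto
    then have "sym_coords n A = 0\<^sub>v N" using Cw[of A] mult_mat_zero_vec[OF C] by simp
    then have "A = sym_of_coords n (0\<^sub>v N)" using sym_of_coords_coords[OF Ac] by simp
    also have "\<dots> = 0\<^sub>m n n"
    proof (rule eq_matI)
      fix i j assume "i < dim_row (0\<^sub>m n n :: complex mat)" "j < dim_col (0\<^sub>m n n :: complex mat)"
      then show "sym_of_coords n (0\<^sub>v N) $$ (i, j) = 0\<^sub>m n n $$ (i, j)"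
        using sym_index(1)[of "min i j" "max i j" n] by (simp add: sym_of_coords_def length_positions)
    qed (simp_all add: sym_of_coords_def)
    finally show False using A(2) by simp
  qed
  then obtain k where k: "k < N" "w A $ k \<noteq> 0" by blast
  have idx_nth: "idx (monos3 ?d ! k) = k" if "k < N" for k
  proof -
    obtain a b c where m: "monos3 ?d ! k = (a, b, c)" by (cases "monos3 ?d ! k")
    then have "monos3 ?d ! idx (a, b, c) = monos3 ?d ! k" "idx (a, b, c) < N"
      using idx[of a b c] monos3_nth_sum[OF that m] by simp_all
    then show ?thesis using nth_eq_iff_index_eq[OF distinct_monos3] that m by metis
  qed
  obtain a b c where m: "monos3 ?d ! k = (a, b, c)" by (cases "monos3 ?d ! k")
  have "f a b c \<noteq> 0" using k idx_nth[OF k(1)] unfolding m by (simp add: f_def)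
  moreover have "a + b + c = ?d" by (rule monos3_nth_sum[OF k(1) m])
  moreover have "?d > 0" using n by simp
  ultimately obtain x y z where xyz: "(x, y, z) \<noteq> (0, 0, 0)"
    "\<And>a b c. a + b + c = ?d \<Longrightarrow> f a b c = x ^ a * y ^ b * z ^ c"
    using veronese_cone[OF rel] by metis
  define v where "v = vec_of_list [x, y, z]"
  have v: "v \<in> carrier_vec 3" by (rule carrier_vecI) (simp add: v_def)
  have vi: "v $ 0 = x" "v $ 1 = y" "v $ 2 = z" by (simp_all add: v_def vec_of_list_index numeral_2_eq_2)
  have "v \<noteq> 0\<^sub>v 3"
  proof
    assume "v = 0\<^sub>v 3"
    then have "v $ 0 = 0" "v $ 1 = 0" "v $ 2 = 0" by simp_all
    then show False using xyz(1) vi by simp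
  qed
  moreover have "w A = veronese_map ?d v"
  proof (rule eq_vecI)
    fix k assume "k < dim_vec (veronese_map ?d v)"
    then have k: "k < N" by (simp add: veronese_map_def)
    obtain a b c where m: "monos3 ?d ! k = (a, b, c)" by (cases "monos3 ?d ! k")
    have "w A $ k = f a b c" using idx_nth[OF k] unfolding m by (simp add: f_def)
    also have "\<dots> = veronese_map ?d v $ k"
      unfolding xyz(2)[OF monos3_nth_sum[OF k m]] veronese_map_index[OF k m] vi ..
    finally show "w A $ k = veronese_map ?d v $ k" .
  qed (use w[of A] in \<open>simp add: veronese_map_def\<close>)
  then have "sym_coords n A = sym_coords n (adj_mat (M v))"
    using Cw[of A] C_mult_veronese[OF v] by simp
  then have "A = adj_mat (M v)"
    using sym_of_coords_coords[OF Ac] sym_of_coords_coords[OF adjM sym_adjM] by metis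
  ultimately show ?thesis using that v by blast
qed

end

section \<open>Linear spans and projective spans\<close>

lemma (in Module.module) span_singleton:
  assumes "v \<in> carrier M"
  shows "span {v} = {c \<odot>\<^bsub>M\<^esub> v | c. c \<in> carrier R}"
proof -
  have "lincomb a {v} = a v \<odot>\<^bsub>M\<^esub> v" if "a \<in> {v} \<rightarrow> carrier R" for a
    using assms that by (simp add: lincomb_def)
  note single = this
  have span: "span {v} = {lincomb a {v} | a. a \<in> {v} \<rightarrow> carrier R}"
    by (rule finite_span) (use assms in auto)
  show ?thesis
  proof (intro equalityI subsetI)
    fix w assume "w \<in> span {v}"
    then obtain a where "a \<in> {v} \<rightarrow> carrier R" "w = lincomb a {v}" unfolding span by blast
    then show "w \<in> {c \<odot>\<^bsub>M\<^esub> v | c. c \<in> carrier R}" using single by auto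
  next
    fix w assume "w \<in> {c \<odot>\<^bsub>M\<^esub> v | c. c \<in> carrier R}"
    then obtain c where c: "c \<in> carrier R" "w = c \<odot>\<^bsub>M\<^esub> v" by blast
    then have "w = lincomb (\<lambda>_. c) {v}" using single[of "\<lambda>_. c"] by simp
    then show "w \<in> span {v}" unfolding span using c(1) by auto
  qed
qed

lemma (in Module.module) lincomb_three:
  assumes "x \<in> carrier M" "y \<in> carrier M" "z \<in> carrier M" "x \<noteq> y" "x \<noteq> z" "y \<noteq> z"
    and "a \<in> {x, y, z} \<rightarrow> carrier R"
  shows "lincomb a {x, y, z} = a x \<odot>\<^bsub>M\<^esub> x \<oplus>\<^bsub>M\<^esub> (a y \<odot>\<^bsub>M\<^esub> y \<oplus>\<^bsub>M\<^esub> a z \<odot>\<^bsub>M\<^esub> z)"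
  using assms by (simp add: lincomb_def)

lemma proj_span_full_iff:
  assumes V: "vectorspace class_ring V" and P: "\<Union>P \<subseteq> carrier V"
  shows "proj_span V P = proj_space V \<longleftrightarrow>
    LinearCombinations.module.span class_ring V (\<Union>P) = carrier V"
proof
  interpret V: vectorspace class_ring V by (rule V)
  interpret W: submodule class_ring "V.span (\<Union>P)" V by (rule V.span_is_submodule[OF P])
  assume eq: "proj_span V P = proj_space V"
  show "V.span (\<Union>P) = carrier V"
  proof
    show "V.span (\<Union>P) \<subseteq> carrier V" by (rule V.span_is_subset2[OF P])
    show "carrier V \<subseteq> V.span (\<Union>P)"
    proof
      fix v assume v: "v \<in> carrier V"
      show "v \<in> V.span (\<Union>P)"
      proof (cases "v = \<zero>\<^bsub>V\<^esub>")
        case False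
        then have "V.span {v} \<in> proj_span V P" using v unfolding eq by (auto simp: proj_pts_def)
        then obtain w where w: "w \<in> V.span (\<Union>P)" "V.span {v} = V.span {w}"
          by (auto simp: proj_span_def proj_pts_def)
        have "v \<in> V.span {v}" using V.in_own_span[of "{v}"] v by simp
        also have "\<dots> \<subseteq> V.span (\<Union>P)"
          unfolding w(2) by (rule V.span_is_subset) (use w(1) V.span_is_submodule[OF P] in auto)
        finally show ?thesis .
      qed simp
    qed
  qed
qed (simp add: proj_span_def)

lemma sym_space_simps:
  "add (sym_space n) = (+)" "zero (sym_space n) = 0\<^sub>m n n" "Module.smult (sym_space n) = (\<cdot>\<^sub>m)"
  by (simp_all add: sym_space_def module_mat_simps)

lemma sym_coords_add:
  assumes "A \<in> carrier_mat n n" "B \<in> carrier_mat n n"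
  shows "sym_coords n (A + B) = sym_coords n A + sym_coords n B"
proof (rule eq_vecI)
  fix r assume "r < dim_vec (sym_coords n A + sym_coords n B)"
  then have r: "r < length (sym_positions n)" by (simp add: sym_coords_def)
  obtain i j where ij: "sym_positions n ! r = (i, j)" by fastforce
  show "sym_coords n (A + B) $ r = (sym_coords n A + sym_coords n B) $ r"
    using r sym_position_bounds[OF r ij] assms by (simp add: sym_coords_def ij)
qed (simp add: sym_coords_def)

lemma sym_coords_smult:
  assumes "A \<in> carrier_mat n n"
  shows "sym_coords n (c \<cdot>\<^sub>m A) = c \<cdot>\<^sub>v sym_coords n A"
proof (rule eq_vecI)
  fix r assume "r < dim_vec (c \<cdot>\<^sub>v sym_coords n A)"
  then have r: "r < length (sym_positions n)" by (simp add: sym_coords_def)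
  obtain i j where ij: "sym_positions n ! r = (i, j)" by fastforce
  show "sym_coords n (c \<cdot>\<^sub>m A) $ r = (c \<cdot>\<^sub>v sym_coords n A) $ r"
    using r sym_position_bounds[OF r ij] assms by (simp add: sym_coords_def ij)
qed (simp add: sym_coords_def)

lemma sym_coords_zero: "sym_coords n (0\<^sub>m n n) = 0\<^sub>v (length (sym_positions n))"
proof -
  have "0 \<cdot>\<^sub>m 0\<^sub>m n n = (0\<^sub>m n n :: complex mat)" by (intro eq_matI) auto
  then have "sym_coords n (0\<^sub>m n n) = 0 \<cdot>\<^sub>v sym_coords n (0\<^sub>m n n)"
    using sym_coords_smult[of "0\<^sub>m n n" n 0] by simp
  also have "\<dots> = 0\<^sub>v (length (sym_positions n))"
    by (rule eq_vecI) (simp_all add: sym_coords_def)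
  finally show ?thesis .
qed

lemma sym_of_coords_add:
  assumes "x \<in> carrier_vec (length (sym_positions n))" "y \<in> carrier_vec (length (sym_positions n))"
  shows "sym_of_coords n (x + y) = sym_of_coords n x + sym_of_coords n y"
proof (rule eq_matI)
  fix i j assume "i < dim_row (sym_of_coords n x + sym_of_coords n y)"
    "j < dim_col (sym_of_coords n x + sym_of_coords n y)"
  then have ij: "i < n" "j < n" by (simp_all add: sym_of_coords_def)
  then show "sym_of_coords n (x + y) $$ (i, j) = (sym_of_coords n x + sym_of_coords n y) $$ (i, j)"
    using assms sym_index(1)[of "min i j" "max i j" n] by (simp add: sym_of_coords_def)
qed (simp_all add: sym_of_coords_def)

lemma sym_of_coords_smult:
  assumes "x \<in> carrier_vec (length (sym_positions n))"
  shows "sym_of_coords n (c \<cdot>\<^sub>v x) = c \<cdot>\<^sub>m sym_of_coords n x"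
proof (rule eq_matI)
  fix i j assume "i < dim_row (c \<cdot>\<^sub>m sym_of_coords n x)" "j < dim_col (c \<cdot>\<^sub>m sym_of_coords n x)"
  then have ij: "i < n" "j < n" by (simp_all add: sym_of_coords_def)
  then show "sym_of_coords n (c \<cdot>\<^sub>v x) $$ (i, j) = (c \<cdot>\<^sub>m sym_of_coords n x) $$ (i, j)"
    using assms sym_index(1)[of "min i j" "max i j" n] by (simp add: sym_of_coords_def)
qed (simp_all add: sym_of_coords_def)

lemma invertible_mat_iff_det:
  fixes A :: "complex mat"
  assumes A: "A \<in> carrier_mat n n"
  shows "invertible_mat A \<longleftrightarrow> det A \<noteq> 0"
proof
  assume "invertible_mat A"
  then obtain B where inv: "inverts_mat A B" "inverts_mat B A" by (auto simp: invertible_mat_def)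
  have AB: "A * B = 1\<^sub>m n" using inv(1) A by (simp add: inverts_mat_def)
  have BA: "B * A = 1\<^sub>m (dim_row B)" using inv(2) by (simp add: inverts_mat_def)
  have "dim_col B = n" using arg_cong[OF AB, of dim_col] by simp
  moreover have "dim_row B = n" using arg_cong[OF BA, of dim_col] A by simp
  ultimately have "B \<in> carrier_mat n n" by auto
  from det_mult[OF A this] show "det A \<noteq> 0" by (auto simp: AB)
next
  assume "det A \<noteq> 0"
  then obtain B where "B \<in> carrier_mat n n" "A * B = 1\<^sub>m n" "B * A = 1\<^sub>m n"
    using nonsingular_inverse[OF A] by blast
  then show "invertible_mat A"
    using A by (auto simp: invertible_mat_def inverts_mat_def)
qed

section \<open>The equivalences for a net\<close>

locale net_of_quadrics = spanned_net +
  assumes indep: "\<And>v. v \<in> carrier_vec 3 \<Longrightarrow> net_member X Y Z v = 0\<^sub>m n n \<Longrightarrow> v = 0\<^sub>v 3"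
begin

sublocale S: vectorspace class_ring "sym_space n"
  by (rule vectorspace_sym_space)

sublocale V: vectorspace class_ring "veronese_space (n - 1)"
  by (rule vec_vs)

abbreviation "surface \<equiv> reciprocal_surface n L"
abbreviation "closure_inverses \<equiv> zariski_closure n (inverses L)"

lemma closure_in_carrier: "closure_inverses \<subseteq> carrier (sym_space n)"
  by (auto simp: zariski_closure_def)

lemma span_line_sym: "A \<in> carrier (sym_space n) \<Longrightarrow> S.span {A} = {c \<cdot>\<^sub>m A | c. True}"
  using S.span_singleton[of A] by (simp add: sym_space_simps class_ring_simps)

lemma Union_surface: "\<Union>surface = {c \<cdot>\<^sub>m A | c A. A \<in> closure_inverses \<and> A \<noteq> 0\<^sub>m n n}"
  using closure_in_carrier
  by (auto simp: reciprocal_surface_def proj_pts_def sym_space_simps span_line_sym)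
    (use span_line_sym in blast)+

lemma Union_surface_carrier: "\<Union>surface \<subseteq> carrier (sym_space n)"
  using closure_in_carrier S.smult_closed by (auto simp: Union_surface sym_space_simps class_ring_simps)

lemma spans_iff: "proj_span (sym_space n) surface = proj_space (sym_space n) \<longleftrightarrow>
    S.span (\<Union>surface) = carrier (sym_space n)"
  by (rule proj_span_full_iff[OF vectorspace_sym_space Union_surface_carrier])

lemma left_kernel_of_chow_matrix:
  assumes "det C = 0"
  obtains y where "y \<in> carrier_vec N" "y \<noteq> 0\<^sub>v N"
    "\<And>v. v \<in> carrier_vec 3 \<Longrightarrow> y \<bullet> sym_coords n (adj_mat (M v)) = 0"
    "\<And>B. B \<in> inverses L \<Longrightarrow> y \<bullet> sym_coords n B = 0"
proof -
  have Ct: "transpose_mat C \<in> carrier_mat N N" using C by simp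
  have "det (transpose_mat C) = 0" using det_transpose[OF C] assms by simp
  then obtain y where y: "y \<in> carrier_vec N" "y \<noteq> 0\<^sub>v N" "transpose_mat C *\<^sub>v y = 0\<^sub>v N"
    using det_0_iff_vec_prod_zero_field[OF Ct] by blast
  have yC: "y \<bullet> (C *\<^sub>v x) = 0" if "x \<in> carrier_vec N" for x
    using transpose_vec_mult_scalar[OF C that y(1)] y(3) that by simp
  have "y \<bullet> sym_coords n (adj_mat (M v)) = 0" if "v \<in> carrier_vec 3" for v
    using yC[OF veronese_map_carrier, of v] unfolding C_mult_veronese[OF that] .
  moreover have "y \<bullet> sym_coords n B = 0" if B: "B \<in> inverses L" for B
  proof -
    obtain v c where "sym_coords n B = c \<cdot>\<^sub>v (C *\<^sub>v veronese_map (n - 1) v)"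
      using inverse_coords[OF B] by metis
    then show ?thesis using yC[OF veronese_map_carrier, of v] y(1) C
      by (simp add: scalar_prod_smult_right)
  qed
  ultimately show ?thesis using that y by blast
qed

text \<open>A left kernel vector of \<open>C\<close> is a linear form vanishing on the inverses. Linear forms survive the Zariski closure
  and linear spans, so the span would lie in a hyperplane.\<close>

lemma spanning_imp_chow_nonsingular:
  assumes span: "S.span (\<Union>surface) = carrier (sym_space n)"
  shows "det C \<noteq> 0"
proof
  assume "det C = 0"
  then obtain y where y: "y \<in> carrier_vec N" "y \<noteq> 0\<^sub>v N" "\<And>B. B \<in> inverses L \<Longrightarrow> y \<bullet> sym_coords n B = 0"
    using left_kernel_of_chow_matrix by metis
  define H where "H = {A \<in> carrier (sym_space n). y \<bullet> sym_coords n A = 0}"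
  have coords: "sym_coords n A \<in> carrier_vec N" for A
    using sym_coords_carrier[of n A] by (simp add: length_positions)
  have "submodule class_ring H (sym_space n)"
  proof (unfold_locales)
    show "H \<subseteq> carrier (sym_space n)" by (auto simp: H_def)
    show "A \<oplus>\<^bsub>sym_space n\<^esub> B \<in> H" if "A \<in> H" "B \<in> H" for A B
    proof -
      have "A + B \<in> carrier (sym_space n)"
        using that S.a_closed[of A B] by (simp add: H_def sym_space_simps)
      then show ?thesis
        using that y(1) coords by (auto simp: H_def sym_space_simps carrier_sym_space sym_coords_add scalar_prod_add_distrib[of _ N])
    qed
    show "\<zero>\<^bsub>sym_space n\<^esub> \<in> H"
    proof -
      have "y \<bullet> sym_coords n (0\<^sub>m n n) = 0"
        unfolding sym_coords_zero length_positions using y(1) by simp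
      then show ?thesis using S.M.zero_closed by (simp add: H_def sym_space_simps)
    qed
    show "c \<odot>\<^bsub>sym_space n\<^esub> A \<in> H" if "c \<in> carrier class_ring" "A \<in> H" for c A
    proof -
      have "c \<cdot>\<^sub>m A \<in> carrier (sym_space n)"
        using that S.smult_closed[of c A] by (simp add: H_def sym_space_simps)
      then show ?thesis
        using that y(1) coords by (auto simp: H_def sym_space_simps carrier_sym_space sym_coords_smult)
    qed
  qed
  moreover have "\<Union>surface \<subseteq> H"
  proof
    fix B assume "B \<in> \<Union>surface"
    then obtain c A where A: "B = c \<cdot>\<^sub>m A" "A \<in> closure_inverses" by (auto simp: Union_surface)
    have "y \<bullet> sym_coords n A = 0" by (rule zariski_closure_linear[OF A(2) y(3)])
    moreover have "A \<in> carrier_mat n n" using A(2) closure_in_carrier by (auto simp: carrier_sym_space)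
    ultimately have "y \<bullet> sym_coords n B = 0" using y(1) coords by (simp add: A(1) sym_coords_smult)
    then show "B \<in> H" using \<open>B \<in> \<Union>surface\<close> Union_surface_carrier by (auto simp: H_def)
  qed
  ultimately have "carrier (sym_space n) \<subseteq> H"
    using S.span_is_subset[of "\<Union>surface" H] span by simp
  moreover obtain r where r: "r < N" "y $ r \<noteq> 0" using y(1,2) by (auto simp: vec_eq_iff)
  moreover have "sym_of_coords n (unit_vec N r) \<in> carrier (sym_space n)" by (simp add: carrier_sym_space)
  ultimately have "y \<bullet> sym_coords n (sym_of_coords n (unit_vec N r)) = 0" by (auto simp: H_def)
  then have "y \<bullet> unit_vec N r = 0" by (simp add: sym_coords_of_coords length_positions)
  then show False using r y(1) by (simp add: scalar_prod_right_unit)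
qed

lemma M_zero: "M (0\<^sub>v 3) = 0\<^sub>m n n"
  using X Y Z by (intro eq_matI) (simp_all add: net_member_def)

text \<open>If \<open>adj M(v)\<close> were zero, the nonzero vector \<open>\<nu>(v)\<close> would be in the kernel of \<open>C\<close>.\<close>

lemma chow_nonsingular_imp_rank:
  assumes d: "det C \<noteq> 0" and A: "A \<in> L" "A \<noteq> 0\<^sub>m n n"
  shows "vec_space.rank n A \<ge> n - 1"
proof -
  obtain v where v: "v \<in> carrier_vec 3" "A = M v" using A(1) by (auto simp: L_def)
  have v0: "v \<noteq> 0\<^sub>v 3" using A(2) v M_zero by auto
  have "adj_mat (M v) \<noteq> 0\<^sub>m n n"
  proof
    assume z: "adj_mat (M v) = 0\<^sub>m n n"
    have "C *\<^sub>v veronese_map (n - 1) v = 0\<^sub>v N"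
      unfolding C_mult_veronese[OF v(1)] z sym_coords_zero length_positions ..
    then show False
      using det_0_iff_vec_prod_zero_field[OF C] d veronese_map_nonzero[OF v(1) v0] veronese_map_carrier by blast
  qed
  then show ?thesis using adj_mat_nonzero_iff_rank[OF M, of v] n v(2) by simp
qed

text \<open>An invertible member \<open>P = M(p)\<close> is exchanged against one of \<open>X\<close>, \<open>Y\<close>, \<open>Z\<close> whose coefficient in \<open>P\<close> is not
  zero; together with the other two it is again a basis of the net.\<close>

lemma symmetric_trace_form_zero_net:
  assumes adj: "\<And>v. v \<in> carrier_vec 3 \<Longrightarrow> v \<noteq> 0\<^sub>v 3 \<Longrightarrow> adj_mat (M v) \<noteq> 0\<^sub>m n n"
    and B: "B \<in> carrier_mat n n" "transpose_mat B = B"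
    and tr: "\<And>v. v \<in> carrier_vec 3 \<Longrightarrow> mtrace n (B * adj_mat (M v)) = 0"
  shows "B = 0\<^sub>m n n"
proof -
  obtain p where p: "p \<in> carrier_vec 3" "det (M p) \<noteq> 0" using regular by blast
  have "p \<noteq> 0\<^sub>v 3"
  proof
    assume "p = 0\<^sub>v 3"
    then have "det (M p) = det (0 \<cdot>\<^sub>m M p)" using M_zero by simp
    then show False using p(2) n M[of p] by (simp add: power_0_left)
  qed
  then have "p $ 0 \<noteq> 0 \<or> p $ 1 \<noteq> 0 \<or> p $ 2 \<noteq> 0"
    using p(1) by (auto simp: vec_eq_iff less_Suc_eq numeral_3_eq_3 numeral_2_eq_2)
  have key: "B = 0\<^sub>m n n"
    if q: "q \<in> carrier_vec 3" "r \<in> carrier_vec 3"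
      and basis: "\<And>x y z. x \<cdot>\<^sub>v p + y \<cdot>\<^sub>v q + z \<cdot>\<^sub>v r = 0\<^sub>v 3 \<Longrightarrow> (x, y, z) = (0, 0, 0)" for q r
  proof (rule symmetric_trace_form_zero[of n "M p" "M q" "M r"])
    have lin: "x \<cdot>\<^sub>m M p + y \<cdot>\<^sub>m M q + z \<cdot>\<^sub>m M r = M (x \<cdot>\<^sub>v p + y \<cdot>\<^sub>v q + z \<cdot>\<^sub>v r)" for x y z
      using p(1) q by (simp add: M_add M_smult M assoc_add_mat[of _ n n])
    have c: "x \<cdot>\<^sub>v p + y \<cdot>\<^sub>v q + z \<cdot>\<^sub>v r \<in> carrier_vec 3" for x y z using p(1) q by simp
    show "adj_mat (x \<cdot>\<^sub>m M p + y \<cdot>\<^sub>m M q + z \<cdot>\<^sub>m M r) \<noteq> 0\<^sub>m n n" if "(x, y, z) \<noteq> (0, 0, 0)" for x y z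
      unfolding lin using adj[OF c] basis that by blast
    show "mtrace n (B * adj_mat (x \<cdot>\<^sub>m M p + y \<cdot>\<^sub>m M q + z \<cdot>\<^sub>m M r)) = 0" for x y z
      unfolding lin by (rule tr[OF c])
  qed (use n M symM p B in auto)
  have comp: "x * p $ k + y * q $ k + z * r $ k = 0"
    if "x \<cdot>\<^sub>v p + y \<cdot>\<^sub>v q + z \<cdot>\<^sub>v r = 0\<^sub>v 3" "k < 3" "q \<in> carrier_vec 3" "r \<in> carrier_vec 3" for x y z q r k
    using arg_cong[OF that(1), of "\<lambda>u. u $ k"] that(2-) p(1) by (simp add: add.assoc)
  have key_unit: "B = 0\<^sub>m n n" if ijk: "p $ i \<noteq> 0" and lt: "i < 3" "j < 3" "k < 3" and "i \<noteq> j" "i \<noteq> k" "j \<noteq> k" for i j k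
  proof (rule key[of "unit_vec 3 j" "unit_vec 3 k"])
    fix x y z assume *: "x \<cdot>\<^sub>v p + y \<cdot>\<^sub>v unit_vec 3 j + z \<cdot>\<^sub>v unit_vec 3 k = 0\<^sub>v 3"
    have "x * p $ i = 0" using comp[OF * lt(1)] lt that(5-6) by simp
    then have "x = 0" using ijk by simp
    then show "(x, y, z) = (0, 0, 0)"
      using comp[OF * lt(2)] comp[OF * lt(3)] lt that(7) by simp
  qed simp_all
  show ?thesis
    using \<open>p $ 0 \<noteq> 0 \<or> p $ 1 \<noteq> 0 \<or> p $ 2 \<noteq> 0\<close>
      key_unit[of 0 1 2] key_unit[of 1 0 2] key_unit[of 2 0 1] by auto
qed

lemma rank_imp_chow_nonsingular:
  assumes rank: "\<And>A. A \<in> L \<Longrightarrow> A \<noteq> 0\<^sub>m n n \<Longrightarrow> vec_space.rank n A \<ge> n - 1"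
  shows "det C \<noteq> 0"
proof
  assume "det C = 0"
  then obtain y where y: "y \<in> carrier_vec N" "y \<noteq> 0\<^sub>v N"
    "\<And>v. v \<in> carrier_vec 3 \<Longrightarrow> y \<bullet> sym_coords n (adj_mat (M v)) = 0"
    using left_kernel_of_chow_matrix by metis
  obtain B where B: "B \<in> carrier_mat n n" "transpose_mat B = B" "B \<noteq> 0\<^sub>m n n"
    "\<And>A. A \<in> carrier_mat n n \<Longrightarrow> transpose_mat A = A \<Longrightarrow> mtrace n (B * A) = y \<bullet> sym_coords n A"
    using trace_pairing_as_coords[of y n] y(1,2) unfolding length_positions by metis
  have "adj_mat (M v) \<noteq> 0\<^sub>m n n" if v: "v \<in> carrier_vec 3" "v \<noteq> 0\<^sub>v 3" for v
  proof -
    have "M v \<in> L" "M v \<noteq> 0\<^sub>m n n" using v indep by (auto simp: L_def)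
    then show ?thesis using rank adj_mat_nonzero_iff_rank[OF M, of v] n by simp
  qed
  moreover have "mtrace n (B * adj_mat (M v)) = 0" if "v \<in> carrier_vec 3" for v
    unfolding B(4)[OF adjM sym_adjM] by (rule y(3)[OF that])
  ultimately have "B = 0\<^sub>m n n"
    by (rule symmetric_trace_form_zero_net[OF _ B(1,2)])
  then show False using B(3) by simp
qed

lemma chow_nonsingular_imp_isomorphic:
  assumes d: "det C \<noteq> 0"
  shows "linearly_isomorphic (veronese_space (n - 1)) (veronese_surface (n - 1)) (sym_space n) surface"
proof -
  obtain D where D: "D \<in> carrier_mat N N" "C * D = 1\<^sub>m N" "D * C = 1\<^sub>m N"
    using nonsingular_inverse[OF C d] .
  define T where "T x = sym_of_coords n (C *\<^sub>v x)" for x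
  have Cx: "C *\<^sub>v x \<in> carrier_vec (length (sym_positions n))" if "x \<in> carrier_vec N" for x
    using C that by (simp add: length_positions)
  have T_closed: "T x \<in> carrier (sym_space n)" for x by (simp add: T_def carrier_sym_space)
  have T_add: "T (x + y) = T x + T y" if "x \<in> carrier_vec N" "y \<in> carrier_vec N" for x y
    using that mult_add_distrib_mat_vec[OF C that] by (simp add: T_def sym_of_coords_add Cx)
  have T_smult: "T (c \<cdot>\<^sub>v x) = c \<cdot>\<^sub>m T x" if "x \<in> carrier_vec N" for c x
    using that mult_mat_vec[OF C that] by (simp add: T_def sym_of_coords_smult Cx)
  have T_coords: "sym_coords n (T x) = C *\<^sub>v x" if "x \<in> carrier_vec N" for x
    using sym_coords_of_coords[OF Cx[OF that]] by (simp add: T_def)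
  have lin: "linear_map class_ring (veronese_space (n - 1)) (sym_space n) T"
  proof -
    have "T \<in> LinearCombinations.module_hom class_ring (veronese_space (n - 1)) (sym_space n)"
      unfolding LinearCombinations.module_hom_def module_vec_simps sym_space_simps
      using T_closed T_add T_smult by blast
    then show ?thesis
      by (intro linear_map.intro mod_hom.intro mod_hom_axioms.intro vec_vs vectorspace_sym_space
          V.module_axioms S.module_axioms)
  qed
  have bij: "bij_betw T (carrier_vec N) (carrier (sym_space n))"
  proof (rule bij_betw_byWitness[where f' = "\<lambda>A. D *\<^sub>v sym_coords n A"])
    show "\<forall>x\<in>carrier_vec N. D *\<^sub>v sym_coords n (T x) = x"
      using assoc_mult_mat_vec[OF D(1) C] by (simp add: T_coords D(3))
    show "\<forall>A\<in>carrier (sym_space n). T (D *\<^sub>v sym_coords n A) = A"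
    proof
      fix A assume A: "A \<in> carrier (sym_space n)"
      have "sym_coords n A \<in> carrier_vec N" using sym_coords_carrier[of n A] by (simp add: length_positions)
      then have "C *\<^sub>v (D *\<^sub>v sym_coords n A) = sym_coords n A"
        using assoc_mult_mat_vec[OF C D(1)] by (simp add: D(2))
      then show "T (D *\<^sub>v sym_coords n A) = A"
        using A by (simp add: T_def carrier_sym_space sym_of_coords_coords)
    qed
    show "T ` carrier_vec N \<subseteq> carrier (sym_space n)" using T_closed by auto
    show "(\<lambda>A. D *\<^sub>v sym_coords n A) ` carrier (sym_space n) \<subseteq> carrier_vec N"
      using D(1) sym_coords_carrier[of n] by (auto simp: length_positions)
  qed
  have line: "T ` V.span {x} = S.span {T x}" if "x \<in> carrier_vec N" for x
  proof -
    have "V.span {x} = range (\<lambda>c. c \<cdot>\<^sub>v x)"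
      using V.span_singleton[of x] that by (auto simp: module_vec_simps class_ring_simps)
    moreover have "S.span {T x} = range (\<lambda>c. c \<cdot>\<^sub>m T x)"
      by (auto simp: span_line_sym[OF T_closed])
    ultimately show ?thesis by (simp only: image_image T_smult[OF that])
  qed
  have T_veronese: "T (veronese_map (n - 1) v) = adj_mat (M v)" if "v \<in> carrier_vec 3" for v
    unfolding T_def C_mult_veronese[OF that] by (rule sym_of_coords_coords[OF adjM sym_adjM])
  have T0: "T (0\<^sub>v N) = 0\<^sub>m n n"
  proof -
    have "0 \<cdot>\<^sub>v 0\<^sub>v N = (0\<^sub>v N :: complex vec)" by (intro eq_vecI) auto
    then have "T (0\<^sub>v N) = 0 \<cdot>\<^sub>m T (0\<^sub>v N)" using T_smult[of "0\<^sub>v N" 0] by simp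
    also have "\<dots> = 0\<^sub>m n n"
      using T_closed[of "0\<^sub>v N"] by (intro eq_matI) (auto simp: carrier_sym_space)
    finally show ?thesis .
  qed
  have adj0: "adj_mat (M v) \<noteq> 0\<^sub>m n n" if v: "v \<in> carrier_vec 3" "v \<noteq> 0\<^sub>v 3" for v
  proof
    assume "adj_mat (M v) = 0\<^sub>m n n"
    then have "T (veronese_map (n - 1) v) = T (0\<^sub>v N)" using T_veronese v T0 by simp
    then have "veronese_map (n - 1) v = 0\<^sub>v N"
      using bij veronese_map_carrier unfolding bij_betw_def inj_on_def by (metis zero_carrier_vec)
    then show False using veronese_map_nonzero[OF v] by simp
  qed
  have "(\<lambda>p. T ` p) ` veronese_surface (n - 1) = (\<lambda>v. S.span {adj_mat (M v)}) ` {v \<in> carrier_vec 3. v \<noteq> 0\<^sub>v 3}"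
  proof -
    have "veronese_surface (n - 1) = (\<lambda>v. V.span {veronese_map (n - 1) v}) ` {v \<in> carrier_vec 3. v \<noteq> 0\<^sub>v 3}"
      using veronese_map_nonzero[of _ "n - 1"]
      by (auto simp: veronese_surface_def proj_pts_def module_vec_simps)
    then have "(\<lambda>p. T ` p) ` veronese_surface (n - 1) =
        (\<lambda>v. T ` V.span {veronese_map (n - 1) v}) ` {v \<in> carrier_vec 3. v \<noteq> 0\<^sub>v 3}"
      by (simp only: image_image)
    also have "\<dots> = (\<lambda>v. S.span {adj_mat (M v)}) ` {v \<in> carrier_vec 3. v \<noteq> 0\<^sub>v 3}"
      by (intro image_cong refl) (simp only: line[OF veronese_map_carrier] T_veronese mem_Collect_eq)
    finally show ?thesis .
  qed
  also have "\<dots> = surface"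
  proof
    show "(\<lambda>v. S.span {adj_mat (M v)}) ` {v \<in> carrier_vec 3. v \<noteq> 0\<^sub>v 3} \<subseteq> surface"
      using adj0 adj_mat_in_closure by (auto simp: reciprocal_surface_def proj_pts_def sym_space_simps)
    show "surface \<subseteq> (\<lambda>v. S.span {adj_mat (M v)}) ` {v \<in> carrier_vec 3. v \<noteq> 0\<^sub>v 3}"
    proof
      fix p assume "p \<in> surface"
      then obtain A where A: "p = S.span {A}" "A \<in> closure_inverses" "A \<noteq> 0\<^sub>m n n"
        by (auto simp: reciprocal_surface_def proj_pts_def sym_space_simps)
      obtain v where "v \<in> carrier_vec 3" "v \<noteq> 0\<^sub>v 3" "A = adj_mat (M v)"
        using closure_subset_cone[OF d A(2,3)] .
      then show "p \<in> (\<lambda>v. S.span {adj_mat (M v)}) ` {v \<in> carrier_vec 3. v \<noteq> 0\<^sub>v 3}"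
        using A(1) by blast
    qed
  qed
  finally show ?thesis
    unfolding linearly_isomorphic_def using lin bij by (auto simp: module_vec_simps)
qed

text \<open>The isomorphism \<open>T\<close> maps every Veronese vector \<open>\<nu>(v)\<close> into the span \<open>W\<close> of the surface. These vectors
  span their space, so \<open>T\<close> maps everything into \<open>W\<close>, and \<open>T\<close> is onto.\<close>

lemma isomorphic_imp_spanning:
  assumes "linearly_isomorphic (veronese_space (n - 1)) (veronese_surface (n - 1)) (sym_space n) surface"
  shows "S.span (\<Union>surface) = carrier (sym_space n)"
proof
  show "S.span (\<Union>surface) \<subseteq> carrier (sym_space n)"
    by (rule S.span_is_subset2[OF Union_surface_carrier])
  obtain T where lin: "linear_map class_ring (veronese_space (n - 1)) (sym_space n) T"
    and bij: "bij_betw T (carrier (veronese_space (n - 1))) (carrier (sym_space n))"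
    and im: "(\<lambda>p. T ` p) ` veronese_surface (n - 1) = surface"
    using assms unfolding linearly_isomorphic_def by blast
  interpret T: linear_map class_ring "veronese_space (n - 1)" "sym_space n" T by (rule lin)
  let ?W = "S.span (\<Union>surface)"
  interpret W: submodule class_ring ?W "sym_space n"
    by (rule S.span_is_submodule[OF Union_surface_carrier])
  have T_add: "T (x + y) = T x + T y" if "x \<in> carrier_vec N" "y \<in> carrier_vec N" for x y
    using T.T_add[of x y] that by (simp add: module_vec_simps sym_space_simps)
  have T_smult: "T (c \<cdot>\<^sub>v x) = c \<cdot>\<^sub>m T x" if "x \<in> carrier_vec N" for c x
    using T.T_smult[of c x] that by (simp add: module_vec_simps sym_space_simps class_ring_simps)
  have W_add: "A + B \<in> ?W" if "A \<in> ?W" "B \<in> ?W" for A B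
    using W.m_closed[OF that] by (simp add: sym_space_simps)
  have W_smult: "c \<cdot>\<^sub>m A \<in> ?W" if "A \<in> ?W" for c A
    using W.smult_closed[of c A] that by (simp add: sym_space_simps class_ring_simps)
  have W_zero: "0\<^sub>m n n \<in> ?W" using W.zero_closed by (simp add: sym_space_simps)
  have point: "T (veronese_map (n - 1) v) \<in> ?W" if v: "v \<in> carrier_vec 3" "v \<noteq> 0\<^sub>v 3" for v
  proof -
    let ?u = "veronese_map (n - 1) v"
    have "V.span {?u} \<in> veronese_surface (n - 1)"
      using veronese_map_nonzero[OF v, of "n - 1"] v
      by (auto simp: veronese_surface_def proj_pts_def module_vec_simps)
    moreover have "?u \<in> V.span {?u}" using V.in_own_span[of "{?u}"] by (simp add: module_vec_simps)
    ultimately have "T ?u \<in> \<Union>surface" unfolding im[symmetric] by blast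
    then show ?thesis using S.in_own_span[OF Union_surface_carrier] by blast
  qed
  have "T x \<in> ?W" if x: "x \<in> carrier_vec N" for x
  proof -
    obtain K :: nat and \<gamma> and v where v: "\<forall>i. v i \<in> carrier_vec 3 \<and> v i \<noteq> 0\<^sub>v 3"
      and x_eq: "x = vec N (\<lambda>k. \<Sum>i<K. \<gamma> i * veronese_map (n - 1) (v i) $ k)"
      using veronese_points_span[OF x] by (elim exE conjE)
    have "T (vec N (\<lambda>k. \<Sum>i<K'. \<gamma> i * veronese_map (n - 1) (v i) $ k)) \<in> ?W" for K' :: nat
    proof (induction K')
      case 0
      have "vec N (\<lambda>k. 0) = 0 \<cdot>\<^sub>v x" using x by (intro eq_vecI) auto
      moreover have "T x \<in> carrier_mat n n"
        using bij x by (auto simp: bij_betw_def module_vec_simps carrier_sym_space)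
      then have "0 \<cdot>\<^sub>m T x = 0\<^sub>m n n" by (intro eq_matI) auto
      ultimately show ?case using W_zero T_smult[OF x, of 0] by simp
    next
      case (Suc K')
      let ?s = "vec N (\<lambda>k. \<Sum>i<K'. \<gamma> i * veronese_map (n - 1) (v i) $ k)"
      let ?u = "veronese_map (n - 1) (v K')"
      have "vec N (\<lambda>k. \<Sum>i<Suc K'. \<gamma> i * veronese_map (n - 1) (v i) $ k) = ?s + \<gamma> K' \<cdot>\<^sub>v ?u"
        by (intro eq_vecI) (auto simp: carrier_vecD[OF veronese_map_carrier])
      then have "T (vec N (\<lambda>k. \<Sum>i<Suc K'. \<gamma> i * veronese_map (n - 1) (v i) $ k)) = T ?s + \<gamma> K' \<cdot>\<^sub>m T ?u"
        by (simp only: T_add T_smult vec_carrier smult_carrier_vec veronese_map_carrier)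
      then show ?case using W_add[OF Suc W_smult[OF point]] v by simp
    qed
    then show ?thesis unfolding x_eq .
  qed
  then have "T ` carrier_vec N \<subseteq> ?W" by (rule image_subsetI)
  then show "carrier (sym_space n) \<subseteq> ?W"
    using bij by (simp add: bij_betw_def module_vec_simps)
qed

end

theorem theorem6p2:
  fixes n :: nat and L :: "complex mat set" and X Y Z :: "complex mat"
  assumes "n \<ge> 3"
    and "regular_net n L"
    and "vectorspace.basis class_ring ((sym_space n)\<lparr>carrier := L\<rparr>) {X, Y, Z}"
  shows "((\<forall>A\<in>L. A \<noteq> 0\<^sub>m n n \<longrightarrow> vec_space.rank n A \<ge> n - 1) \<longleftrightarrow>
           proj_span (sym_space n) (reciprocal_surface n L) = proj_space (sym_space n)) \<and>
         (proj_span (sym_space n) (reciprocal_surface n L) = proj_space (sym_space n) \<longleftrightarrow>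
           linearly_isomorphic (veronese_space (n - 1)) (veronese_surface (n - 1))
             (sym_space n) (reciprocal_surface n L)) \<and>
         (linearly_isomorphic (veronese_space (n - 1)) (veronese_surface (n - 1))
             (sym_space n) (reciprocal_surface n L) \<longleftrightarrow>
           invertible_mat (chow_matrix n X Y Z))"
proof -
  let ?V = "(sym_space n)\<lparr>carrier := L\<rparr>"
  have sub: "VectorSpace.subspace class_ring L (sym_space n)"
    and dim: "vectorspace.dim class_ring ?V = 3" and inv: "\<exists>A\<in>L. invertible_mat A"
    using assms(2) by (auto simp: regular_net_def)
  have LS: "L \<subseteq> carrier (sym_space n)"
    using sub by (auto simp: VectorSpace.subspace_def submodule_def)
  interpret LV: vectorspace class_ring ?V
    by (rule vectorspace.subspace_is_vs[OF vectorspace_sym_space sub])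
  have basis: "\<not> LV.lin_dep {X, Y, Z}" "LV.span {X, Y, Z} = L" "{X, Y, Z} \<subseteq> L"
    using assms(3) by (auto simp: LV.basis_def)
  have "card {X, Y, Z} = 3" using LV.dim_basis[OF _ assms(3)] dim by simp
  then have dist: "X \<noteq> Y" "X \<noteq> Z" "Y \<noteq> Z" by (auto simp: card_insert_if split: if_splits)
  have XYZ: "X \<in> L" "Y \<in> L" "Z \<in> L" using basis(3) by auto
  then have c: "X \<in> carrier_mat n n" "Y \<in> carrier_mat n n" "Z \<in> carrier_mat n n"
    "transpose_mat X = X" "transpose_mat Y = Y" "transpose_mat Z = Z"
    using LS by (auto simp: carrier_sym_space)
  have lincomb: "LV.lincomb a {X, Y, Z} = net_member X Y Z (vec_of_list [a X, a Y, a Z])" for a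
  proof -
    have "LV.lincomb a {X, Y, Z} = a X \<cdot>\<^sub>m X + (a Y \<cdot>\<^sub>m Y + a Z \<cdot>\<^sub>m Z)"
      using LV.lincomb_three[of X Y Z a] XYZ dist by (simp add: sym_space_simps class_ring_simps)
    then show ?thesis
      using c by (simp add: net_member_def vec_of_list_index numeral_2_eq_2 assoc_add_mat[of _ n n])
  qed
  have vec3: "v = vec_of_list [v $ 0, v $ 1, v $ 2]" if "v \<in> carrier_vec 3" for v :: "complex vec"
    using that by (intro eq_vecI) (auto simp: vec_of_list_index less_Suc_eq numeral_3_eq_3 numeral_2_eq_2)
  define coeff where "coeff v A = (if A = X then v $ 0 else if A = Y then v $ 1 else v $ 2)" for v :: "complex vec" and A
  have member: "net_member X Y Z v = LV.lincomb (coeff v) {X, Y, Z}" if "v \<in> carrier_vec 3" for v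
    using lincomb[of "coeff v"] vec3[OF that] dist by (simp add: coeff_def)
  have carrier_list: "vec_of_list [x, y, z] \<in> carrier_vec 3" for x y z :: complex
    by (rule carrier_vecI) simp
  have L: "L = net_member X Y Z ` carrier_vec 3"
  proof -
    have "LV.span {X, Y, Z} = {LV.lincomb a {X, Y, Z} | a. True}"
      using LV.finite_span[of "{X, Y, Z}"] XYZ by (simp add: class_ring_simps)
    then have "L = {LV.lincomb a {X, Y, Z} | a. True}" using basis(2) by simp
    also have "\<dots> = net_member X Y Z ` carrier_vec 3"
    proof (intro equalityI subsetI)
      fix A assume "A \<in> {LV.lincomb a {X, Y, Z} | a. True}"
      then show "A \<in> net_member X Y Z ` carrier_vec 3" using carrier_list by (auto simp: lincomb)
    next
      fix A assume "A \<in> net_member X Y Z ` carrier_vec 3"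
      then obtain v where "v \<in> carrier_vec 3" "A = net_member X Y Z v" by blast
      then show "A \<in> {LV.lincomb a {X, Y, Z} | a. True}" using member by blast
    qed
    finally show ?thesis .
  qed
  interpret net_of_quadrics n X Y Z
  proof
    show "\<exists>v\<in>carrier_vec 3. det (net_member X Y Z v) \<noteq> 0"
    proof -
      obtain A where "A \<in> L" "invertible_mat A" using inv by blast
      moreover from this have "det A \<noteq> 0"
        using LS by (subst invertible_mat_iff_det[of A n, symmetric]) (auto simp: carrier_sym_space)
      ultimately show ?thesis unfolding L by auto
    qed
    show "v = 0\<^sub>v 3" if v: "v \<in> carrier_vec 3" and z: "net_member X Y Z v = 0\<^sub>m n n" for v
    proof (rule ccontr)
      assume "v \<noteq> 0\<^sub>v 3"
      then have "v $ 0 \<noteq> 0 \<or> v $ 1 \<noteq> 0 \<or> v $ 2 \<noteq> 0"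
        using v by (auto simp: vec_eq_iff less_Suc_eq numeral_3_eq_3 numeral_2_eq_2)
      then have "\<exists>A\<in>{X, Y, Z}. coeff v A \<noteq> 0" using dist by (auto simp: coeff_def)
      moreover have "LV.lincomb (coeff v) {X, Y, Z} = \<zero>\<^bsub>?V\<^esub>"
        using member[OF v] z by (simp add: sym_space_simps)
      ultimately have "LV.lin_dep {X, Y, Z}"
        unfolding LV.lin_dep_def by (intro exI[of _ "{X, Y, Z}"] exI[of _ "coeff v"]) (auto simp: class_ring_simps)
      then show False using basis(1) by simp
    qed
  qed (use assms(1) c in auto)
  have L_eq: "spanned_net.L X Y Z = L" unfolding L_def L ..
  note facts = spans_iff spanning_imp_chow_nonsingular chow_nonsingular_imp_rank
    rank_imp_chow_nonsingular chow_nonsingular_imp_isomorphic isomorphic_imp_spanning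
  note facts' = facts[unfolded L_eq]
  have "invertible_mat (chow_matrix n X Y Z) \<longleftrightarrow> det (chow_matrix n X Y Z) \<noteq> 0"
    by (rule invertible_mat_iff_det[OF C])
  then show ?thesis using facts' by blast
qed

end
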